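(* Let $r \geq 1$ be an integer and let $V\colon [0,\infty) \to \mathbb{R}$ be continuous with $$\lim_{x \to \infty} \bigl(V(x) - \log(1+x^2)\bigr) = +\infty.$$ Then there is a unique vector $(\mu_0^*, \mu_1^*, \ldots, \mu_{r-1}^* )$ of $r$ measures that minimizes the energy functional $$\sum_{j=0}^{r-1} I(\mu_j) - \sum_{j=0}^{r-2} I(\mu_j, \mu_{j+1}) + \int V \, d\mu_0$$ among all vectors $(\mu_0,\ldots,\mu_{r-1})$ of positive Borel measures satisfying, for every $j = 0, \ldots, r-1$: (i) $\operatorname{supp}(\mu_j) \subset \Delta_j$, (ii) $\mu_j(\Delta_j) = 1 - \frac{j}{r}$, and (iii) $I(\mu_j) < +\infty$. Moreover, the measure $\mu_0^*$ has compact support, and it is the unique minimizer of the functional $$\frac{1}{2} \iint \log \frac{1}{|x-y|} \, d\mu(x) d\mu(y) + \frac{1}{2} \iint \log \frac{1}{|x^{1/r} - y^{1/r}|} \, d\mu(x) d\mu(y) + \int V(x) \, d\mu(x)$$ among all probability measures $\mu$ on $[0,\infty)$.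
   Context: For $j \in \mathbb{Z}$, $\Delta_j = [0,\infty)$ if $j$ is even and $\Delta_j = (-\infty,0]$ if $j$ is odd. For positive Borel measures $\mu,\nu$, the logarithmic energy and the mutual energy are $$I(\mu) = \iint \log\frac{1}{|x-y|}\, d\mu(x)d\mu(y), \qquad I(\mu,\nu) = \iint \log\frac{1}{|x-y|}\, d\mu(x)d\nu(y).$$ Empty sums are $0$. Conventions for unbounded supports: the condition $I(\mu_j)<+\infty$ is understood as the double integral defining $I(\mu_j)$ being absolutely convergent (so that all terms $I(\mu_j), I(\mu_j,\mu_{j+1})$ of the vector functional are finite, and $\int V d\mu_0 \in (-\infty,+\infty]$). The functional of a single probability measure $\mu$ on $[0,\infty)$ is understood as the integral, with values in $(-\infty,+\infty]$, of the combined kernel $$\frac12\log\frac{1}{|x-y|}+\frac12\log\frac{1}{|x^{1/r}-y^{1/r}|}+\frac12 V(x)+\frac12 V(y)$$ against $d\mu(x)d\mu(y)$; this kernel is bounded below under the growth assumption on $V$. *)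

theory Defs
  imports "HOL-Probability.Probability"
begin

definition Delta :: "int \<Rightarrow> real set" where
  "Delta j = (if even j then {0..} else {..0})"

definition measure_support :: "'a::topological_space measure \<Rightarrow> 'a set" where
  "measure_support \<mu> = {x. \<forall>U. open U \<longrightarrow> x \<in> U \<longrightarrow> emeasure \<mu> U > 0}"

text \<open>The kernel is extended-real valued because \<^term>\<open>ln (1 / 0) = (0::real)\<close>; with a real-valued
  kernel a measure with atoms could have finite logarithmic energy.\<close>

definition log_kernel :: "real \<Rightarrow> real \<Rightarrow> ereal" where
  "log_kernel x y = (if x = y then \<infinity> else ereal (ln (1 / \<bar>x - y\<bar>)))"

text \<open>Integral of an extended-real valued function as positive part minus negative part
  (\<^const>\<open>e2ennreal\<close> truncates negative values to 0). It has its usual meaning as soon as one of the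
  two parts is finite; below, the negative part is finite in every case of interest.
  (On \<^typ>\<open>ereal\<close>, the difference of infinity and infinity is infinity.)\<close>

definition ereal_integral :: "'a measure \<Rightarrow> ('a \<Rightarrow> ereal) \<Rightarrow> ereal" where
  "ereal_integral M f =
     enn2ereal (\<integral>\<^sup>+x. e2ennreal (f x) \<partial>M) - enn2ereal (\<integral>\<^sup>+x. e2ennreal (- f x) \<partial>M)"

definition mutual_energy :: "real measure \<Rightarrow> real measure \<Rightarrow> ereal" where
  "mutual_energy \<mu> \<nu> = ereal_integral (\<mu> \<Otimes>\<^sub>M \<nu>) (\<lambda>(x, y). log_kernel x y)"

definition log_energy :: "real measure \<Rightarrow> ereal" where
  "log_energy \<mu> = mutual_energy \<mu> \<mu>"

text \<open>For unbounded supports, finiteness of the energy means absolute convergence of the double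
  integral.\<close>

definition finite_log_energy :: "real measure \<Rightarrow> bool" where
  "finite_log_energy \<mu> \<longleftrightarrow>
     (\<integral>\<^sup>+(x, y). e2ennreal \<bar>log_kernel x y\<bar> \<partial>(\<mu> \<Otimes>\<^sub>M \<mu>)) < \<infinity>"

text \<open>A vector of \<open>r\<close> measures is a function on \<^typ>\<open>nat\<close> that is \<^const>\<open>extensional\<close> on the index
  set, so that equality of vectors is equality of the components with index below \<open>r\<close>.\<close>

definition admissible_vector :: "nat \<Rightarrow> (nat \<Rightarrow> real measure) \<Rightarrow> bool" where
  "admissible_vector r \<mu> \<longleftrightarrow> \<mu> \<in> extensional {..<r} \<and>
     (\<forall>j<r. sets (\<mu> j) = sets borel \<and>
            measure_support (\<mu> j) \<subseteq> Delta (int j) \<and>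
            emeasure (\<mu> j) (Delta (int j)) = ennreal (1 - real j / real r) \<and>
            finite_log_energy (\<mu> j))"

text \<open>The external field \<open>V\<close> is a total function, but only its values on the nonnegative
  half-line matter, since this is where \<open>\<mu> 0\<close> (and \<open>\<mu>\<close> below) is supported.\<close>

definition vector_energy :: "nat \<Rightarrow> (real \<Rightarrow> real) \<Rightarrow> (nat \<Rightarrow> real measure) \<Rightarrow> ereal" where
  "vector_energy r V \<mu> =
     (\<Sum>j<r. log_energy (\<mu> j)) - (\<Sum>j<r - 1. mutual_energy (\<mu> j) (\<mu> (j + 1)))
       + ereal_integral (\<mu> 0) (\<lambda>x. ereal (V x))"

definition half_line_prob :: "real measure \<Rightarrow> bool" where
  "half_line_prob \<mu> \<longleftrightarrow> prob_space \<mu> \<and> sets \<mu> = sets borel \<and> measure_support \<mu> \<subseteq> {0..}"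

text \<open>The three terms of the scalar functional are combined into one kernel, which is bounded below
  under the growth assumption on \<open>V\<close>; the individual terms need not make sense separately.\<close>

definition scalar_energy :: "nat \<Rightarrow> (real \<Rightarrow> real) \<Rightarrow> real measure \<Rightarrow> ereal" where
  "scalar_energy r V \<mu> = ereal_integral (\<mu> \<Otimes>\<^sub>M \<mu>)
     (\<lambda>(x, y). ereal (1/2) * log_kernel x y + ereal (1/2) * log_kernel (root r x) (root r y)
               + ereal (1/2 * V x) + ereal (1/2 * V y))"

end

theory Submission
  imports Defs "HOL-Complex_Analysis.Complex_Analysis" "HOL-Real_Asymp.Real_Asymp"
begin

text \<open>Fix the first component \<open>\<mu>\<close> of the vector. What remains is a quadratic minimization over the other
components, and its solution can be written down. In the variables \<open>s = ln \<bar>x\<bar>\<close> the logarithmic kernel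
becomes, up to terms linear in \<open>s\<close>, a convolution kernel \<open>log_cosh t\<close>, with \<open>t = 0\<close> for points on the
same side of the origin and \<open>t = \<pi>\<close> for points on opposite sides. Let \<open>swept r j \<mu>\<close> be the measure on the
\<open>j\<close>-th half-line that is obtained from \<open>\<mu>\<close> by convolution, on the logarithmic scale, with
\<open>sweep_density r j\<close>; it has mass \<open>1 - j / r\<close>. Its potential is computed by residues: a function on a
strip of width \<open>2 * \<pi>\<close> is represented by its jump across the strip
(\<open>strip_boundary_representation\<close>), and the sum of the hyperbolic cotangents over \<open>r - j\<close> consecutive
sheets has a jump that telescopes to a multiple of the density (\<open>sheet_sum_diff\<close>). Integrating this
identity gives \<open>sweep_log_transform\<close>: the potential of a swept point mass is again a sum of terms
\<open>log_cosh\<close>, with the angles \<open>(j + 2 * l) * \<pi> / r\<close>, \<open>l < r - j\<close>. Counting angles shows that the potentials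
\<open>P j\<close> satisfy \<open>2 * P j = P (j - 1) + P (j + 1)\<close> on the \<open>j\<close>-th half-line, with \<open>P r = 0\<close>
(\<open>swept_potential_balance\<close>). These are the Euler--Lagrange equations of the functional in the components
\<open>1, \<dots>, r - 1\<close>. On the positive half-line \<open>P 1\<close> is the kernel
\<open>ln \<bar>y - x\<bar> - ln \<bar>root r y - root r x\<bar>\<close> (\<open>swept_potential_one\<close>); this is where the \<open>r\<close>-th roots of the
scalar functional come from.

The Euler--Lagrange equations characterize the minimum because the functional is strictly convex.
Frullani's integral writes \<open>- 2 * ln \<bar>d\<bar>\<close> as a superposition of the Gaussians \<open>exp (- t * d\<^sup>2)\<close>, \<open>t > 0\<close>,
up to a divergent constant that vanishes on differences of measures with equal mass. The Gaussian energy
of such a difference is a weighted \<open>L\<^sup>2\<close> norm squared of its characteristic function, so that the form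
\<open>\<Sum>j. I \<sigma>\<^sub>j - \<Sum>j. I (\<sigma>\<^sub>j, \<sigma>\<^sub>j\<^sub>+\<^sub>1)\<close> is an integral of the tridiagonal form with rows
\<open>- 1 / 2, 1, - 1 / 2\<close>, which is positive definite (\<open>nikishin_form_pos_def\<close>). Completing the square at
\<open>lift r \<mu>\<close>, the vector of the swept measures, shows that the functional at a vector with first component
\<open>\<mu>\<close> is at least the scalar functional at \<open>\<mu>\<close>, with equality only for \<open>lift r \<mu>\<close>
(\<open>vector_log_energy_ge\<close>).

It remains to treat the scalar functional. Its kernel is lower semicontinuous and, by the growth of the
field, coercive; so a minimizer exists (\<open>energy_attained\<close>). Far away the kernel exceeds the minimal
energy, so that truncating a minimizer and normalizing it would decrease the energy unless the support is
bounded (\<open>minimizer_bounded\<close>). Two minimizers coincide by strict convexity (\<open>minimizer_unique\<close>). Hence the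
minimizing vectors are exactly the lifts of the one scalar minimizer (\<open>vector_minimizer_iff\<close>).\<close>

section \<open>A boundary representation in a strip of width two pi\<close>

text \<open>The function \<open>coth (z / 2)\<close>. In this form its period \<open>2 * \<pi> * \<i>\<close> and its poles, the solutions of
\<open>exp z = 1\<close>, can be read off.\<close>

definition coth_half :: "complex \<Rightarrow> complex" where
  "coth_half z = (exp z + 1) / (exp z - 1)"

lemma cosh_minus_cos_pos:
  fixes s t :: real
  assumes "cos t \<noteq> 1 \<or> s \<noteq> 0"
  shows "cosh s - cos t > 0"
  using assms cosh_real_ge_1[of s] cos_le_one[of t] cosh_real_one_iff[of s] by linarith

lemma cos_less_one:
  fixes t :: real
  assumes "0 < t" "t < 2 * pi"
  shows "cos t < 1"
proof -
  have "cos t \<noteq> 1"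
  proof
    assume "cos t = 1"
    then obtain n :: int where "t = of_int n * 2 * pi" using cos_one_2pi_int by blast
    with assms have "0 < of_int n * (2 * pi)" "of_int n * (2 * pi) < 1 * (2 * pi)" by (auto simp: mult_ac)
    hence "0 < (of_int n :: real)" "(of_int n :: real) < 1" using pi_gt_zero
      by (auto simp: zero_less_mult_iff mult_less_cancel_right)
    thus False by simp
  qed
  thus ?thesis using cos_le_one[of t] by linarith
qed

lemma exp_minus_one_norm:
  "(norm (exp (Complex s t) - 1))\<^sup>2 = 2 * exp s * (cosh s - cos t)"
proof -
  have "(norm (exp (Complex s t) - 1))\<^sup>2 = (exp s * cos t - 1)\<^sup>2 + (exp s * sin t)\<^sup>2"
    by (simp add: cmod_power2 exp_eq_polar cis.code Re_exp Im_exp)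
  also have "\<dots> = exp s * exp s - 2 * exp s * cos t + exp s * exp (- s)"
    using sin_cos_squared_add[of t] exp_minus_inverse[of s] by algebra
  also have "\<dots> = 2 * exp s * (cosh s - cos t)"
    by (simp add: cosh_def field_simps)
  finally show ?thesis .
qed

lemma exp_ne_1:
  assumes "cos t \<noteq> 1 \<or> s \<noteq> 0"
  shows "exp (Complex s t) \<noteq> 1"
  using exp_minus_one_norm[of s t] cosh_minus_cos_pos[OF assms] by auto

lemma coth_half_Complex:
  assumes "cos t \<noteq> 1 \<or> s \<noteq> 0"
  shows "coth_half (Complex s t) =
    Complex (sinh s / (cosh s - cos t)) (- sin t / (cosh s - cos t))"
proof -
  let ?w = "exp (Complex s t)" and ?d = "cosh s - cos t"
  have d: "?d > 0" by (rule cosh_minus_cos_pos[OF assms])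
  have "coth_half (Complex s t) = (?w + 1) * cnj (?w - 1) / ((?w - 1) * cnj (?w - 1))"
    unfolding coth_half_def using exp_ne_1[OF assms]
    by (intro mult_divide_mult_cancel_right[symmetric]) auto
  also have "(?w - 1) * cnj (?w - 1) = of_real (2 * exp s * ?d)"
    unfolding complex_norm_square[symmetric] exp_minus_one_norm ..
  also have "(?w + 1) * cnj (?w - 1) = of_real (2 * exp s) * Complex (sinh s) (- sin t)"
  proof -
    have "(?w + 1) * cnj (?w - 1) = ?w * cnj ?w - 1 - (?w - cnj ?w)"
      by (simp add: algebra_simps)
    also have "\<dots> = of_real ((norm ?w)\<^sup>2) - 1 - \<i> * of_real (2 * Im ?w)"
      by (simp only: complex_norm_square complex_diff_cnj mult.commute)
    also have "\<dots> = of_real (2 * exp s) * Complex (sinh s) (- sin t)"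
      by (simp add: complex_eq_iff Im_exp norm_exp_eq_Re sinh_def power2_eq_square field_simps
                flip: exp_add)
    finally show ?thesis .
  qed
  also have "of_real (2 * exp s) * Complex (sinh s) (- sin t) / of_real (2 * exp s * ?d)
      = Complex (sinh s / ?d) (- sin t / ?d)"
    using d by (simp add: complex_eq_iff field_simps)
  finally show ?thesis .
qed

lemma coth_half_periodic: "coth_half (z + 2 * of_real pi * \<i>) = coth_half z"
  by (simp add: coth_half_def exp_add)

lemma coth_half_bound:
  assumes "k * cosh s \<le> cosh s - cos t" "0 < k"
  shows "norm (coth_half (Complex s t)) \<le> 2 / k"
proof -
  let ?d = "cosh s - cos t"
  have d: "?d > 0" using assms mult_pos_pos[OF assms(2) cosh_real_pos[of s]] by linarith
  have 2: "\<bar>sinh s\<bar> \<le> cosh s"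
    by (simp add: sinh_def cosh_def abs_le_iff field_simps)
  have 3: "\<bar>sin t\<bar> \<le> cosh s" using abs_sin_le_one[of t] cosh_real_ge_1[of s] by linarith
  have q: "x / ?d \<le> 1 / k" if "x \<le> cosh s" for x
  proof -
    have "k * x \<le> k * cosh s" using assms that by (intro mult_left_mono) auto
    hence "k * x \<le> ?d" using assms by linarith
    thus ?thesis using d assms by (simp add: field_simps)
  qed
  have "norm (coth_half (Complex s t)) \<le> \<bar>sinh s / ?d\<bar> + \<bar>- sin t / ?d\<bar>"
    using d by (subst coth_half_Complex) (auto intro: order_trans[OF cmod_le])
  also have "\<dots> \<le> 1 / k + 1 / k"
    using d q[OF 2] q[OF 3] by (intro add_mono) (simp_all add: abs_div)
  finally show ?thesis by simp
qed

lemma coth_half_bound_angle: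
  assumes "cos t \<le> c" "0 \<le> c" "c < 1"
  shows "norm (coth_half (Complex s t)) \<le> 2 / (1 - c)"
proof (rule coth_half_bound)
  show "(1 - c) * cosh s \<le> cosh s - cos t"
    using assms cosh_real_ge_1[of s] mult_left_mono[of 1 "cosh s" c] by (simp add: algebra_simps)
qed (use assms in simp)

lemma coth_half_bound_far:
  assumes "\<bar>s\<bar> \<ge> 1"
  shows "norm (coth_half (Complex s t)) \<le> 2 / (1 - 1 / cosh 1)"
proof (rule coth_half_bound)
  have "cosh 1 \<le> cosh \<bar>s\<bar>" using assms cosh_real_nonneg_le_iff[of 1 "\<bar>s\<bar>"] by simp
  hence "cosh 1 \<le> cosh s" by simp
  hence "1 \<le> 1 / cosh 1 * cosh s" using cosh_real_pos[of "1::real"] by simp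
  with cos_le_one[of t] have "cos t \<le> 1 / cosh 1 * cosh s" by (rule order_trans)
  thus "(1 - 1 / cosh 1) * cosh s \<le> cosh s - cos t"
    by (simp only: left_diff_distrib mult_1_left)
  show "0 < 1 - 1 / cosh (1::real)"
    using cosh_real_nonneg_less_iff[of 0 "1::real"] by simp
qed

lemma coth_half_at_top: "((\<lambda>s. coth_half (Complex s t)) \<longlongrightarrow> 1) at_top"
proof -
  have "((\<lambda>s. Complex (sinh s / (cosh s - cos t)) (- sin t / (cosh s - cos t))) \<longlongrightarrow> Complex 1 0) at_top"
    unfolding sinh_field_def cosh_field_def by (intro tendsto_Complex) real_asymp+
  moreover have "\<forall>\<^sub>F s in at_top. Complex (sinh s / (cosh s - cos t)) (- sin t / (cosh s - cos t))
      = coth_half (Complex s t)"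
    using eventually_gt_at_top[of 0] by eventually_elim (simp add: coth_half_Complex)
  ultimately have "((\<lambda>s. coth_half (Complex s t)) \<longlongrightarrow> Complex 1 0) at_top"
    by (rule Lim_transform_eventually)
  thus ?thesis by (simp add: one_complex.code)
qed

lemma coth_half_at_bot: "((\<lambda>s. coth_half (Complex s t)) \<longlongrightarrow> - 1) at_bot"
proof -
  have "((\<lambda>s. Complex (sinh s / (cosh s - cos t)) (- sin t / (cosh s - cos t))) \<longlongrightarrow> Complex (-1) 0) at_bot"
    unfolding sinh_field_def cosh_field_def by (intro tendsto_Complex) real_asymp+
  moreover have "\<forall>\<^sub>F s in at_bot. Complex (sinh s / (cosh s - cos t)) (- sin t / (cosh s - cos t))
      = coth_half (Complex s t)"
    using eventually_gt_at_bot[of 0] by eventually_elim (simp add: coth_half_Complex)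
  ultimately have "((\<lambda>s. coth_half (Complex s t)) \<longlongrightarrow> Complex (- 1) 0) at_bot"
    by (rule Lim_transform_eventually)
  moreover have "Complex (- 1) 0 = - 1" by (simp add: complex_eq_iff)
  ultimately show ?thesis by simp
qed

text \<open>At \<open>w = z\<close> the numerator of \<open>coth_half (z - w)\<close> equals \<open>2\<close>, and its denominator has a simple zero with
derivative \<open>- 1\<close>.\<close>

lemma residue_coth_half:
  assumes "open S" "z \<in> S" "G holomorphic_on S" "\<And>w. w \<in> S - {z} \<Longrightarrow> exp (z - w) \<noteq> 1"
  shows "residue (\<lambda>w. G w * coth_half (z - w)) z = - 2 * G z"
proof (rule residue_simple'[OF assms(1,2)])
  show "(\<lambda>w. G w * coth_half (z - w)) holomorphic_on S - {z}"
    unfolding coth_half_def using assms(3,4)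
    by (intro holomorphic_intros) (auto intro: holomorphic_on_subset)
  have "((\<lambda>w. exp (z - w)) has_field_derivative - 1) (at z)"
    by (auto intro!: derivative_eq_intros)
  hence "((\<lambda>w. (exp (z - w) - 1) / (w - z)) \<longlongrightarrow> - 1) (at z)"
    by (simp add: has_field_derivative_iff)
  hence "((\<lambda>w. inverse ((exp (z - w) - 1) / (w - z))) \<longlongrightarrow> inverse (- 1)) (at z)"
    by (intro tendsto_inverse) auto
  moreover have "(G \<longlongrightarrow> G z) (at z)"
    using assms holomorphic_on_imp_continuous_on[OF assms(3)]
    by (simp add: continuous_on_eq_continuous_at isCont_def)
  moreover have "((\<lambda>w. exp (z - w) + 1) \<longlongrightarrow> exp (z - z) + 1) (at z)"
    by (intro tendsto_intros)
  ultimately have "((\<lambda>w. G w * (exp (z - w) + 1) * inverse ((exp (z - w) - 1) / (w - z))) \<longlongrightarrow>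
      G z * (exp (z - z) + 1) * inverse (- 1)) (at z)"
    by (intro tendsto_mult)
  thus "((\<lambda>w. G w * coth_half (z - w) * (w - z)) \<longlongrightarrow> - 2 * G z) (at z)"
    by (simp add: coth_half_def field_simps)
qed

lemma contour_integral_linepath_horizontal:
  assumes "a < b"
  shows "contour_integral (linepath (Complex a c) (Complex b c)) f = integral {a..b} (\<lambda>x. f (Complex x c))"
proof -
  have "linepath (Complex a c) (Complex b c) = (+) (Complex 0 c) \<circ> linepath (of_real a) (of_real b)"
    by (auto simp: linepath_def fun_eq_iff complex_eq_iff algebra_simps)
  hence "contour_integral (linepath (Complex a c) (Complex b c)) f
      = contour_integral (linepath (of_real a) (of_real b)) (\<lambda>x. f (x + Complex 0 c))"
    by (simp only: contour_integral_translate)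
  also have "\<dots> = integral {a..b} (\<lambda>x. f (of_real x + Complex 0 c))"
    using assms by (subst contour_integral_linepath_Reals_eq) auto
  also have "(\<lambda>x. f (of_real x + Complex 0 c)) = (\<lambda>x. f (Complex x c))"
    by (simp add: complex_of_real_def fun_eq_iff complex_add)
  finally show ?thesis .
qed

text \<open>Cauchy's formula for a strip, by the residue theorem on rectangles that exhaust it. The kernel has the
width of the strip as its period, so the two horizontal sides combine into one integral of the jump \<open>D\<close>.
The vertical sides cancel in the limit: at the right end \<open>G\<close> and the kernel tend to \<open>c\<close> and \<open>- 1\<close>, at
the left end to \<open>- c\<close> and \<open>1\<close>, and both products are \<open>- c\<close>.\<close>

lemma strip_boundary_representation:
  fixes G :: "complex \<Rightarrow> complex" and c :: complex
  assumes \<delta>: "\<delta> > 0"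
    and holo: "G holomorphic_on {w. - \<delta> < Im w \<and> Im w < 2 * pi + \<delta>}"
    and bound: "\<And>s t. 0 \<le> t \<Longrightarrow> t \<le> 2 * pi \<Longrightarrow> norm (G (Complex s t)) \<le> B"
    and top: "\<And>t. 0 \<le> t \<Longrightarrow> t \<le> 2 * pi \<Longrightarrow> ((\<lambda>s. G (Complex s t)) \<longlongrightarrow> c) at_top"
    and bot: "\<And>t. 0 \<le> t \<Longrightarrow> t \<le> 2 * pi \<Longrightarrow> ((\<lambda>s. G (Complex s t)) \<longlongrightarrow> - c) at_bot"
    and D: "\<And>v. D v = G (Complex v 0) - G (Complex v (2 * pi))"
    and D_int: "integrable lborel D"
    and z: "0 < Im z" "Im z < 2 * pi"
  shows "(LBINT v. D v * coth_half (z - of_real v)) = - 4 * pi * \<i> * G z"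
proof -
  \<comment> \<open>The pole \<open>z\<close> must be the only zero of \<open>exp (z - w) - 1\<close> in the enlarged strip \<open>S\<close>, so the margin is at most the distance of \<open>z\<close> to the sides.\<close>
  define \<epsilon> where "\<epsilon> = min \<delta> (min (Im z) (2 * pi - Im z))"
  have \<epsilon>: "\<epsilon> > 0" "\<epsilon> \<le> \<delta>" "\<epsilon> \<le> Im z" "\<epsilon> \<le> 2 * pi - Im z" using z \<delta> by (auto simp: \<epsilon>_def)
  define S where "S = {w. - \<epsilon> < Im w} \<inter> {w. Im w < 2 * pi + \<epsilon>}"
  have S: "open S" "convex S" unfolding S_def
    by (auto intro!: open_Int convex_Int open_halfspace_Im_lt open_halfspace_Im_gt
          convex_halfspace_Im_lt convex_halfspace_Im_gt)
  have zS: "z \<in> S" using z \<epsilon> by (auto simp: S_def)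
  have holoS: "G holomorphic_on S"
    by (rule holomorphic_on_subset[OF holo]) (use \<epsilon> in \<open>auto simp: S_def\<close>)
  have ne1: "exp (z - w) \<noteq> 1" if "w \<in> S - {z}" for w
  proof
    assume "exp (z - w) = 1"
    then obtain n :: int where n: "Re (z - w) = 0" "Im (z - w) = of_int (2 * n) * pi"
      by (auto simp: exp_eq_1)
    have "\<bar>Im (z - w)\<bar> < 2 * pi" using that \<epsilon> z by (auto simp: S_def)
    hence "\<bar>of_int n * (2 * pi)\<bar> < 1 * (2 * pi)" using n by (simp add: mult_ac)
    hence "\<bar>of_int n :: real\<bar> < 1" unfolding abs_mult using pi_gt_zero
      by (metis abs_of_pos mult_less_cancel_right_pos zero_less_mult_iff zero_less_numeral)
    hence "n = 0" by linarith
    with n have "z = w" by (simp add: complex_eq_iff)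
    with that show False by auto
  qed
  define f where "f = (\<lambda>w. G w * coth_half (z - w))"
  have f_holo: "f holomorphic_on S - {z}"
    unfolding f_def coth_half_def using holoS ne1
    by (intro holomorphic_intros) (auto intro: holomorphic_on_subset)
  have f_cont: "continuous_on (S - {z}) f" using f_holo by (rule holomorphic_on_imp_continuous_on)
  have res: "residue f z = - 2 * G z"
    unfolding f_def by (rule residue_coth_half[OF S(1) zS holoS ne1])
  have bottom_cont: "continuous_on UNIV (\<lambda>v::real. f (Complex v 0))"
    by (rule continuous_on_compose2[OF f_cont]) (use z \<epsilon> in \<open>auto simp: S_def intro!: continuous_intros\<close>)
  have top_cont: "continuous_on UNIV (\<lambda>v::real. f (Complex v (2 * pi)))"
    by (rule continuous_on_compose2[OF f_cont]) (use z \<epsilon> in \<open>auto simp: S_def intro!: continuous_intros\<close>)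
  have side_cont: "continuous_on {0..2*pi} (\<lambda>t. f (Complex T t))" if "T \<noteq> Re z" for T
    by (rule continuous_on_compose2[OF f_cont]) (use that \<epsilon> in \<open>auto simp: S_def intro!: continuous_intros\<close>)
  have contour: "integral {-T..T} (\<lambda>v. f (Complex v 0) - f (Complex v (2 * pi)))
      = - 4 * pi * \<i> * G z + \<i> * integral {0..2*pi} (\<lambda>t. f (Complex (-T) t) - f (Complex T t))"
    if T: "T > \<bar>Re z\<bar>" for T
  proof -
    let ?a1 = "Complex (-T) 0" and ?a2 = "Complex T 0" and ?a3 = "Complex T (2 * pi)" and ?a4 = "Complex (-T) (2 * pi)"
    let ?g = "rectpath ?a1 ?a3"
    have im: "path_image ?g \<subseteq> S - {z}" using T z \<epsilon>
      by (subst path_image_rectpath) (auto simp: S_def)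
    have box: "z \<in> box ?a1 ?a3" using T z by (auto simp: in_box_complex_iff)
    have "contour_integral ?g f = 2 * pi * \<i> * (\<Sum>p\<in>{z}. winding_number ?g p * residue f p)"
    proof (rule Residue_theorem[OF S(1) convex_connected[OF S(2)] _ f_holo])
      show "\<forall>w. w \<notin> S \<longrightarrow> winding_number ?g w = 0"
        using T \<epsilon> by (auto intro!: winding_number_rectpath_outside simp: S_def in_cbox_complex_iff)
    qed (use im in auto)
    hence 1: "contour_integral ?g f = - 4 * pi * \<i> * G z"
      using winding_number_rectpath[OF box] res by simp
    have seg: "closed_segment a b \<subseteq> S - {z}"
      if "closed_segment a b \<subseteq> path_image ?g" for a b using that im by blast
    have ci: "f contour_integrable_on linepath a b"
      if "closed_segment a b \<subseteq> path_image ?g" for a b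
      using seg[OF that] f_cont
      by (intro contour_integrable_continuous_linepath continuous_on_subset[OF f_cont]) auto
    have segs: "closed_segment ?a1 ?a2 \<subseteq> path_image ?g" "closed_segment ?a2 ?a3 \<subseteq> path_image ?g"
       "closed_segment ?a3 ?a4 \<subseteq> path_image ?g" "closed_segment ?a4 ?a1 \<subseteq> path_image ?g"
      by (auto simp: rectpath_def Let_def path_image_join)
    note cis = segs[THEN ci]
    have 2: "contour_integral ?g f = contour_integral (linepath ?a1 ?a2) f + contour_integral (linepath ?a2 ?a3) f
       - contour_integral (linepath ?a4 ?a3) f - contour_integral (linepath ?a1 ?a4) f"
    proof -
      have "contour_integral (linepath ?a3 ?a4) f = - contour_integral (linepath ?a4 ?a3) f"
           "contour_integral (linepath ?a4 ?a1) f = - contour_integral (linepath ?a1 ?a4) f"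
        using segs[THEN seg] by (auto intro!: contour_integral_reverse_linepath continuous_on_subset[OF f_cont])
      moreover have "contour_integral ?g f = contour_integral (linepath ?a1 ?a2) f + (contour_integral (linepath ?a2 ?a3) f
       + (contour_integral (linepath ?a3 ?a4) f + contour_integral (linepath ?a4 ?a1) f))"
        using cis by (simp add: rectpath_def Let_def contour_integrable_joinI)
      ultimately show ?thesis by simp
    qed
    have 3: "contour_integral (linepath ?a1 ?a2) f = integral {-T..T} (\<lambda>v. f (Complex v 0))"
      by (rule contour_integral_linepath_horizontal) (use T in auto)
    have 4: "contour_integral (linepath ?a4 ?a3) f = integral {-T..T} (\<lambda>v. f (Complex v (2*pi)))"
      by (rule contour_integral_linepath_horizontal) (use T in auto)
    have 5: "contour_integral (linepath ?a2 ?a3) f = \<i> * integral {0..2*pi} (\<lambda>t. f (Complex T t))"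
      by (rule contour_integral_linepath_same_Re) (use T in auto)
    have 6: "contour_integral (linepath ?a1 ?a4) f = \<i> * integral {0..2*pi} (\<lambda>t. f (Complex (-T) t))"
      by (rule contour_integral_linepath_same_Re) (use T in auto)
    have 7: "integral {-T..T} (\<lambda>v. f (Complex v 0) - f (Complex v (2 * pi)))
        = integral {-T..T} (\<lambda>v. f (Complex v 0)) - integral {-T..T} (\<lambda>v. f (Complex v (2*pi)))"
      by (intro Henstock_Kurzweil_Integration.integral_diff integrable_continuous_real)
         (auto intro: continuous_on_subset[OF bottom_cont] continuous_on_subset[OF top_cont])
    have 8: "integral {0..2*pi} (\<lambda>t. f (Complex (-T) t) - f (Complex T t))
       = integral {0..2*pi} (\<lambda>t. f (Complex (-T) t)) - integral {0..2*pi} (\<lambda>t. f (Complex T t))"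
      by (intro Henstock_Kurzweil_Integration.integral_diff integrable_continuous_real side_cont) (use T in auto)
    show ?thesis using 1 unfolding 2 3 4 5 6 7 8 by (simp add: algebra_simps)
  qed
  have Df: "f (Complex v 0) - f (Complex v (2 * pi)) = D v * coth_half (z - of_real v)" for v
  proof -
    have "z - Complex v 0 = (z - Complex v (2*pi)) + 2 * of_real pi * \<i>"
      by (simp add: complex_eq_iff)
    hence "coth_half (z - Complex v (2*pi)) = coth_half (z - Complex v 0)"
      by (metis coth_half_periodic)
    thus ?thesis by (simp add: f_def D algebra_simps complex_of_real_def)
  qed
  let ?h = "\<lambda>v. D v * coth_half (z - of_real v)"
  have z_eq: "z - of_real v = Complex (Re z - v) (Im z)" "z - Complex v t = Complex (Re z - v) (Im z - t)" for v t
    by (simp_all add: complex_eq_iff)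
  have cosz: "cos (Im z) < 1" using z by (rule cos_less_one)
  define c0 where "c0 = max 0 (cos (Im z))"
  have c0: "cos (Im z) \<le> c0" "0 \<le> c0" "c0 < 1" using cosz by (auto simp: c0_def)
  have h_cont: "continuous_on UNIV ?h"
    unfolding Df[symmetric] by (intro continuous_intros bottom_cont top_cont)
  hence h_meas: "?h \<in> borel_measurable borel" by (rule borel_measurable_continuous_onI)
  have h_int: "integrable lborel ?h"
  proof (rule Bochner_Integration.integrable_bound)
    show "integrable lborel (\<lambda>v. norm (D v) * (2 / (1 - c0)))"
      using D_int by (intro integrable_mult_left integrable_norm) auto
    show "AE v in lborel. norm (?h v) \<le> norm (norm (D v) * (2 / (1 - c0)))"
    proof (rule AE_I2)
      fix v :: real
      show "norm (?h v) \<le> norm (norm (D v) * (2 / (1 - c0)))"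
        using mult_left_mono[OF coth_half_bound_angle[OF c0, of "Re z - v"] norm_ge_zero[of "D v"]] c0(3)
        unfolding z_eq by (simp add: norm_mult)
    qed
  qed (use h_meas in simp)
  have "((\<lambda>T. LBINT v. indicator {-T..T} v *\<^sub>R ?h v) \<longlongrightarrow> (LBINT v. ?h v)) at_top"
  proof (rule integral_dominated_convergence_at_top[where w = "\<lambda>v. norm (?h v)"])
    show "integrable lborel (\<lambda>v. norm (?h v))" using h_int by (rule integrable_norm)
    show "AE v in lborel. ((\<lambda>T. indicator {-T..T} v *\<^sub>R ?h v) \<longlongrightarrow> ?h v) at_top"
    proof (intro AE_I2 tendsto_eventually)
      fix v :: real
      show "\<forall>\<^sub>F T in at_top. indicator {-T..T} v *\<^sub>R ?h v = ?h v"
        using eventually_ge_at_top[of "\<bar>v\<bar>"] by eventually_elim (simp add: indicator_def abs_le_iff)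
    qed
    show "\<forall>\<^sub>F T in at_top. AE v in lborel. norm (indicator {-T..T} v *\<^sub>R ?h v) \<le> norm (?h v)"
      by (intro always_eventually allI AE_I2) (auto split: split_indicator)
  qed (use h_meas in auto)
  moreover have "(LBINT v. indicator {-T..T} v *\<^sub>R ?h v) = integral {-T..T} ?h" for T
    using set_borel_integral_eq_integral(2)[of "{-T..T}" ?h]
      borel_integrable_compact[of "{-T..T}" ?h] continuous_on_subset[OF h_cont]
    by (auto simp: set_integrable_def set_lebesgue_integral_def)
  ultimately have lim1: "((\<lambda>T. integral {-T..T} ?h) \<longlongrightarrow> (LBINT v. ?h v)) at_top" by simp

  let ?k = "\<lambda>T t. if \<bar>Re z\<bar> < T then indicator {0..2*pi} t *\<^sub>R (f (Complex (-T) t) - f (Complex T t)) else 0"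
  let ?K = "2 / (1 - 1 / cosh 1) :: real"
  have "((\<lambda>T. LBINT t. ?k T t) \<longlongrightarrow> (LBINT t::real. 0)) at_top"
  proof (rule integral_dominated_convergence_at_top[where w = "\<lambda>t. indicator {0..2*pi} t *\<^sub>R (2 * B * ?K)"])
    show "integrable lborel (\<lambda>t::real. indicator {0..2*pi} t *\<^sub>R (2 * B * ?K))"
      by (intro borel_integrable_compact continuous_intros) auto
    show "AE t in lborel. ((\<lambda>T. ?k T t) \<longlongrightarrow> 0) at_top"
    proof (rule AE_I2)
      fix t :: real
      show "((\<lambda>T. ?k T t) \<longlongrightarrow> 0) at_top"
      proof (cases "t \<in> {0..2*pi}")
        case True
        hence t: "0 \<le> t" "t \<le> 2 * pi" by auto
        have "filterlim (\<lambda>T::real. Re z - - T) at_top at_top" "filterlim (\<lambda>T::real. Re z - T) at_bot at_top"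
             "filterlim (\<lambda>T::real. - T) at_bot at_top" by real_asymp+
        note fl = this
        have "((\<lambda>T. f (Complex (-T) t) - f (Complex T t)) \<longlongrightarrow> (- c) * 1 - c * (- 1)) at_top"
          unfolding f_def z_eq
          by (intro tendsto_intros top[OF t] filterlim_compose[OF bot[OF t] fl(3)]
              filterlim_compose[OF coth_half_at_top fl(1)] filterlim_compose[OF coth_half_at_bot fl(2)])
        moreover have "\<forall>\<^sub>F T in at_top. f (Complex (-T) t) - f (Complex T t) = ?k T t"
          using eventually_gt_at_top[of "\<bar>Re z\<bar>"] by eventually_elim (use True in auto)
        ultimately show ?thesis by (simp add: Lim_transform_eventually)
      qed (auto cong: if_cong)
    qed
    show "\<forall>\<^sub>F T in at_top. AE t in lborel. norm (?k T t) \<le> indicator {0..2*pi} t *\<^sub>R (2 * B * ?K)"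
      using eventually_ge_at_top[of "\<bar>Re z\<bar> + 1"]
    proof eventually_elim
      case (elim T)
      have "norm (f (Complex s t)) \<le> B * ?K" if "\<bar>s\<bar> = T" "0 \<le> t" "t \<le> 2 * pi" for s t
      proof -
        have "norm (coth_half (z - Complex s t)) \<le> ?K"
          unfolding z_eq by (rule coth_half_bound_far) (use that elim in linarith)
        moreover have "0 \<le> B" using bound[OF that(2,3)] norm_ge_zero order_trans by blast
        ultimately show ?thesis unfolding f_def norm_mult
          using bound[OF that(2,3), of s] by (intro mult_mono) auto
      qed
      hence "norm (f (Complex (-T) t) - f (Complex T t)) \<le> B * ?K + B * ?K" if "0 \<le> t" "t \<le> 2 * pi" for t
        using that elim by (intro order_trans[OF norm_triangle_ineq4] add_mono) auto
      with elim show ?case by (intro AE_I2) (auto split: split_indicator)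
    qed
    show "?k T \<in> borel_measurable lborel" for T
    proof (cases "\<bar>Re z\<bar> < T")
      case True
      hence "continuous_on {0..2*pi} (\<lambda>t. f (Complex (-T) t) - f (Complex T t))"
        by (intro continuous_intros side_cont) auto
      from borel_integrable_compact[OF _ this] True show ?thesis
        by (simp add: borel_measurable_integrable)
    qed simp
  qed auto
  moreover have "\<forall>\<^sub>F T in at_top. (LBINT t. ?k T t) = integral {0..2*pi} (\<lambda>t. f (Complex (-T) t) - f (Complex T t))"
    using eventually_gt_at_top[of "\<bar>Re z\<bar>"]
  proof eventually_elim
    case (elim T)
    hence "continuous_on {0..2*pi} (\<lambda>t. f (Complex (-T) t) - f (Complex T t))"
      by (intro continuous_intros side_cont) auto
    with elim show ?case
      using set_borel_integral_eq_integral(2)[of "{0..2*pi}" "\<lambda>t. f (Complex (-T) t) - f (Complex T t)"]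
      borel_integrable_compact[of "{0..2*pi}" "\<lambda>t. f (Complex (-T) t) - f (Complex T t)"]
      by (auto simp: set_integrable_def set_lebesgue_integral_def)
  qed
  ultimately have lim2: "((\<lambda>T. integral {0..2*pi} (\<lambda>t. f (Complex (-T) t) - f (Complex T t))) \<longlongrightarrow> 0) at_top"
    by (simp add: Lim_transform_eventually)
  have "((\<lambda>T. integral {-T..T} ?h) \<longlongrightarrow> - 4 * pi * \<i> * G z + \<i> * 0) at_top"
  proof (rule Lim_transform_eventually)
    show "((\<lambda>T. - 4 * pi * \<i> * G z + \<i> * integral {0..2*pi} (\<lambda>t. f (Complex (-T) t) - f (Complex T t)))
        \<longlongrightarrow> - 4 * pi * \<i> * G z + \<i> * 0) at_top"
      by (intro tendsto_intros lim2)
    show "\<forall>\<^sub>F T in at_top. - 4 * pi * \<i> * G z + \<i> * integral {0..2*pi} (\<lambda>t. f (Complex (-T) t) - f (Complex T t))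
        = integral {-T..T} ?h"
      using eventually_gt_at_top[of "\<bar>Re z\<bar>"] by eventually_elim (use contour in \<open>simp add: Df\<close>)
  qed
  from tendsto_unique[OF _ lim1 this] show ?thesis by simp
qed

section \<open>The sweeping density and its hyperbolic cotangent transform\<close>

text \<open>The response on the \<open>j\<close>-th half-line to a unit mass at \<open>x > 0\<close>, in the variable \<open>v = ln (\<bar>y\<bar> / x)\<close>. For
\<open>r = 2\<close>, \<open>j = 1\<close> it is half the balayage of the point mass onto the negative half-line; in general it is
the harmonic measure of one side of a strip of width \<open>\<pi> * r\<close>, seen from a point at distance \<open>\<pi> * j\<close> from
this side.\<close>

definition sweep_density :: "nat \<Rightarrow> nat \<Rightarrow> real \<Rightarrow> real" where
  "sweep_density r j v =
     sin (pi * j / r) / (2 * pi * r * (cosh (v / r) - cos (pi * j / r)))"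

context
  fixes r j :: nat
  assumes j: "1 \<le> j" "j < r"
begin

lemma sweep_angle: "0 < pi * j / r" "pi * j / r < pi"
  using j by (auto simp: field_simps)

lemma sweep_sin_pos: "sin (pi * j / r) > 0"
  using sweep_angle by (intro sin_gt_zero)

lemma sweep_cos_less: "cos (pi * j / r) < 1"
  using cos_monotone_0_pi[of 0 "pi * j / r"] sweep_angle by simp

lemma sweep_denominator_pos: "cosh v - cos (pi * j / r) > 0"
  using sweep_cos_less cosh_real_ge_1[of v] by linarith

lemma sweep_density_pos: "sweep_density r j v > 0"
  unfolding sweep_density_def using sweep_sin_pos sweep_denominator_pos j
  by (intro divide_pos_pos mult_pos_pos) auto

lemma sweep_density_nonneg: "sweep_density r j v \<ge> 0"
  using sweep_density_pos by (rule less_imp_le)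

lemma sweep_density_minus: "sweep_density r j (- v) = sweep_density r j v"
  by (simp add: sweep_density_def)

lemma continuous_sweep_density: "continuous_on UNIV (sweep_density r j)"
  unfolding sweep_density_def[abs_def] using sweep_denominator_pos j
  by (intro continuous_intros) (auto simp: less_imp_neq[symmetric])

lemma measurable_sweep_density [measurable]: "sweep_density r j \<in> borel_measurable borel"
  using continuous_sweep_density by (rule borel_measurable_continuous_onI)

text \<open>With \<open>\<theta> = \<pi> * j / r\<close>, a primitive is \<open>arctan ((exp (v / r) - cos \<theta>) / sin \<theta>) / \<pi>\<close>; it tends to \<open>1 / 2\<close>
at infinity, and its value at \<open>0\<close> is \<open>\<theta> / (2 * \<pi>)\<close> because \<open>(1 - cos \<theta>) / sin \<theta> = tan (\<theta> / 2)\<close>.\<close>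

lemma sweep_density_half_line:
  "has_bochner_integral lborel (\<lambda>v. indicator {0..} v *\<^sub>R sweep_density r j v) ((1 - j / r) / 2)"
proof -
  let ?\<theta> = "pi * j / r"
  let ?F = "\<lambda>v. 1 / pi * arctan ((exp (v / r) - cos ?\<theta>) / sin ?\<theta>)"
  have "(\<integral>\<^sup>+v. ennreal (sweep_density r j v) * indicator {0..} v \<partial>lborel) = ennreal (1 / pi * (pi / 2) - ?F 0)"
  proof (rule nn_integral_FTC_atLeast)
    fix x :: real
    let ?e = "exp (x / r)"
    have r: "real r > 0" using j by simp
    have "((\<lambda>v. (exp (v / r) - cos ?\<theta>) / sin ?\<theta>) has_real_derivative ?e * (1 / r) / sin ?\<theta>) (at x)"
      using sweep_sin_pos r by (auto intro!: derivative_eq_intros)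
    from DERIV_cmult[OF DERIV_chain2[OF DERIV_arctan this], of "1 / pi"]
    have "(?F has_real_derivative 1 / pi * (1 / (1 + ((?e - cos ?\<theta>) / sin ?\<theta>)\<^sup>2) * (?e * (1 / r) / sin ?\<theta>))) (at x)"
      by (simp add: inverse_eq_divide)
    also have "1 + ((?e - cos ?\<theta>) / sin ?\<theta>)\<^sup>2 = 2 * ?e * (cosh (x / r) - cos ?\<theta>) / (sin ?\<theta>)\<^sup>2"
    proof -
      have "(sin ?\<theta>)\<^sup>2 + (?e - cos ?\<theta>)\<^sup>2 = 2 * ?e * (cosh (x / r) - cos ?\<theta>)"
      proof -
        have "2 * ?e * (cosh (x / r) - cos ?\<theta>) = ?e * ?e + ?e * exp (- (x / r)) - 2 * ?e * cos ?\<theta>"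
          by (simp add: cosh_field_def field_simps)
        thus ?thesis using sin_cos_squared_add[of ?\<theta>] exp_minus_inverse[of "x / r"] by algebra
      qed
      thus ?thesis using sweep_sin_pos by (simp add: field_simps)
    qed
    also have "1 / pi * (1 / (2 * ?e * (cosh (x / r) - cos ?\<theta>) / (sin ?\<theta>)\<^sup>2) * (?e * (1 / r) / sin ?\<theta>))
        = sweep_density r j x"
      using sweep_sin_pos sweep_denominator_pos[of "x / r"] r
      by (simp add: sweep_density_def divide_simps) (simp add: power2_eq_square algebra_simps)
    finally show "(?F has_real_derivative sweep_density r j x) (at x)" .
    show "(?F \<longlongrightarrow> 1 / pi * (pi / 2)) at_top"
      by (intro tendsto_intros filterlim_compose[OF tendsto_arctan_at_top]) 
        (use r sweep_sin_pos in real_asymp)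
  qed (auto simp: sweep_density_nonneg)
  also have "1 / pi * (pi / 2) - ?F 0 = (1 - j / r) / 2"
  proof -
    have "(1 - cos ?\<theta>) / sin ?\<theta> = tan (?\<theta> / 2)"
      using cos_double_sin[of "?\<theta> / 2"] sin_double[of "?\<theta> / 2"] sweep_sin_pos
      by (simp add: tan_def power2_eq_square)
    moreover have "arctan (tan (?\<theta> / 2)) = ?\<theta> / 2"
      using sweep_angle by (intro arctan_tan) auto
    ultimately show ?thesis by (simp add: field_simps)
  qed
  finally have "(\<integral>\<^sup>+v. ennreal (indicator {0..} v *\<^sub>R sweep_density r j v) \<partial>lborel) = ennreal ((1 - j / r) / 2)"
    by (simp add: indicator_mult_ennreal mult.commute)
  thus ?thesis using j
    by (intro has_bochner_integral_nn_integral) (auto simp: sweep_density_nonneg field_simps)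
qed

lemma sweep_density_mass: "has_bochner_integral lborel (sweep_density r j) (1 - j / r)"
proof -
  have "2 *\<^sub>R ((1 - real j / real r) / 2) = 1 - real j / real r" by (simp add: field_simps)
  thus ?thesis
    using has_bochner_integral_even_function[OF sweep_density_half_line sweep_density_minus] by metis
qed

lemma sweep_density_exp_bound:
  obtains K where "K > 0" "\<And>v. sweep_density r j v \<le> K * exp (- \<bar>v\<bar> / r)"
proof
  let ?\<theta> = "pi * j / r"
  define c where "c = max 0 (cos ?\<theta>)"
  have c: "cos ?\<theta> \<le> c" "0 \<le> c" "c < 1" using sweep_cos_less by (auto simp: c_def)
  let ?K = "sin ?\<theta> / (2 * pi * r * ((1 - c) / 2))"
  show "?K > 0" using sweep_sin_pos c j by (intro divide_pos_pos mult_pos_pos) auto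
  fix v :: real
  have "(1 - c) / 2 * exp (\<bar>v / r\<bar>) \<le> (1 - c) * cosh (v / r)"
    using c by (auto simp: cosh_field_def abs_if field_simps)
  also have "\<dots> \<le> cosh (v / r) - cos ?\<theta>"
    using c cosh_real_ge_1[of "v / r"] mult_left_mono[of 1 "cosh (v / r)" c] by (simp add: algebra_simps)
  finally have "(1 - c) / 2 * exp (\<bar>v / r\<bar>) \<le> cosh (v / r) - cos ?\<theta>" .
  hence "sweep_density r j v \<le> sin ?\<theta> / (2 * pi * r * ((1 - c) / 2 * exp (\<bar>v / r\<bar>)))"
    unfolding sweep_density_def using sweep_sin_pos c j
    by (intro divide_left_mono mult_left_mono mult_pos_pos sweep_denominator_pos) auto
  also have "\<dots> = ?K * exp (- \<bar>v\<bar> / r)" by (simp add: exp_minus field_simps)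
  finally show "sweep_density r j v \<le> ?K * exp (- \<bar>v\<bar> / r)" .
qed

lemma sweep_density_first_moment: "integrable lborel (\<lambda>v. \<bar>v\<bar> * sweep_density r j v)"
proof -
  obtain K where K: "K > 0" "\<And>v. sweep_density r j v \<le> K * exp (- \<bar>v\<bar> / r)"
    by (rule sweep_density_exp_bound) blast
  have r: "real r > 0" using j by simp
  \<comment> \<open>Half of the exponential decay rate is given up to absorb the factor \<open>\<bar>v\<bar>\<close>.\<close>
  let ?a = "1 / (2 * real r)"
  have "has_bochner_integral lborel (\<lambda>v. indicator {0..} v *\<^sub>R exp (- ?a * \<bar>v\<bar>)) (2 * r)"
  proof (rule has_bochner_integral_nn_integral)
    have "(\<integral>\<^sup>+v. ennreal (exp (- ?a * v)) * indicator {0..} v \<partial>lborel) = ennreal (0 - (- 2 * r * exp (- ?a * 0)))"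
    proof (rule nn_integral_FTC_atLeast)
      show "((\<lambda>v. - 2 * r * exp (- ?a * v)) \<longlongrightarrow> 0) at_top" using r by real_asymp
      show "((\<lambda>v. - 2 * r * exp (- ?a * v)) has_real_derivative exp (- ?a * x)) (at x)" for x
        using r by (auto intro!: derivative_eq_intros simp: field_simps)
    qed auto
    moreover have "ennreal (exp (- ?a * v)) * indicator {0..} v = ennreal (indicator {0..} v *\<^sub>R exp (- ?a * \<bar>v\<bar>))" for v
      by (auto split: split_indicator)
    ultimately show "(\<integral>\<^sup>+v. ennreal (indicator {0..} v *\<^sub>R exp (- ?a * \<bar>v\<bar>)) \<partial>lborel) = ennreal (2 * r)"
      by simp
  qed auto
  hence "has_bochner_integral lborel (\<lambda>v. exp (- ?a * \<bar>v\<bar>)) (2 *\<^sub>R (2 * r))"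
    by (rule has_bochner_integral_even_function) simp
  hence "integrable lborel (\<lambda>v. (2 * r * K) * exp (- ?a * \<bar>v\<bar>))"
    by (intro integrable_mult_right) (simp add: has_bochner_integral_iff)
  thus ?thesis
  proof (rule Bochner_Integration.integrable_bound)
    show "AE v in lborel. norm (\<bar>v\<bar> * sweep_density r j v) \<le> norm ((2 * r * K) * exp (- ?a * \<bar>v\<bar>))"
    proof (rule AE_I2)
      fix v :: real
      have "?a * \<bar>v\<bar> \<le> exp (?a * \<bar>v\<bar>)" using exp_ge_add_one_self[of "?a * \<bar>v\<bar>"] by linarith
      hence "\<bar>v\<bar> \<le> 2 * r * exp (?a * \<bar>v\<bar>)" using r by (simp add: field_simps)
      hence "\<bar>v\<bar> * sweep_density r j v \<le> 2 * r * exp (?a * \<bar>v\<bar>) * (K * exp (- \<bar>v\<bar> / r))"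
        using K sweep_density_nonneg by (intro mult_mono) auto
      also have "\<dots> = 2 * r * K * exp (?a * \<bar>v\<bar> + (- \<bar>v\<bar> / r))" unfolding exp_add by simp
      also have "?a * \<bar>v\<bar> + (- \<bar>v\<bar> / r) = - ?a * \<bar>v\<bar>" using r by (simp add: field_simps)
      finally show "norm (\<bar>v\<bar> * sweep_density r j v) \<le> norm ((2 * r * K) * exp (- ?a * \<bar>v\<bar>))"
        using K r sweep_density_nonneg by simp
    qed
  qed simp
qed

text \<open>The strip \<open>0 \<le> Im z \<le> 2 * \<pi>\<close>, shrunk by the factor \<open>r\<close>, is stacked \<open>r - j\<close> times between the heights
\<open>\<pi> * j / r\<close> and \<open>2 * \<pi> - \<pi> * j / r\<close>; the sum runs over the copies. The upper side of each copy is the lower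
side of the next one.\<close>

definition sheet_sum :: "complex \<Rightarrow> complex" where
  "sheet_sum z = (\<Sum>l<r - j. of_real (1 / r) * coth_half ((z + \<i> * of_real ((j + 2 * l) * pi)) / of_real r))"

lemma sheet_arg: "(Complex s t + \<i> * of_real a) / of_real r = Complex (s / r) ((t + a) / r)"
  by (simp add: complex_eq_iff Re_divide_of_real Im_divide_of_real)

text \<open>The heights of the stacked copies stay at distance at least \<open>\<pi> * j / r\<close> from the multiples of \<open>2 * \<pi>\<close>, the
heights of the poles of \<open>coth_half\<close>.\<close>

lemma sweep_cos_le:
  assumes "j * pi \<le> t" "t \<le> (2 * r - j) * pi"
  shows "cos (t / r) \<le> cos (pi * j / r)"
proof (cases "t / r \<le> pi")
  case True
  have "pi * j / r \<le> t / r" using assms by (simp add: divide_right_mono mult.commute)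
  thus ?thesis using True sweep_angle by (intro cos_monotone_0_pi_le) auto
next
  case False
  have "pi * j / r \<le> 2 * pi - t / r" using assms j by (simp add: field_simps)
  hence "cos (2 * pi - t / r) \<le> cos (pi * j / r)" using False sweep_angle by (intro cos_monotone_0_pi_le) auto
  thus ?thesis by simp
qed

lemma sheet_angle_range:
  assumes "l < r - j" "0 \<le> t" "t \<le> 2 * pi"
  shows "j * pi \<le> t + (j + 2 * l) * pi" "t + (j + 2 * l) * pi \<le> (2 * r - j) * pi"
proof -
  show "j * pi \<le> t + (j + 2 * l) * pi" using assms by (auto simp: algebra_simps)
  have "real l + 1 \<le> real r - j" using assms j by linarith
  hence "(2 + (j + 2 * real l)) * pi \<le> (2 * r - j) * pi" by (intro mult_right_mono) auto
  thus "t + (j + 2 * l) * pi \<le> (2 * r - j) * pi" using assms by (simp add: algebra_simps)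
qed

text \<open>The jump telescopes over the copies. Only the lowest and the highest side remain; their heights add up
to \<open>2 * \<pi>\<close>, so that the two values are complex conjugate, and the density is the imaginary part up to a
factor.\<close>

lemma sheet_sum_diff:
  "sheet_sum (Complex v 0) - sheet_sum (Complex v (2 * pi)) = - 4 * pi * \<i> * of_real (sweep_density r j v)"
proof -
  let ?\<theta> = "pi * j / r"
  define a where "a l = of_real (1 / r) * coth_half (Complex (v / r) ((j + 2 * l) * pi / r))" for l :: nat
  have r: "real r > 0" using j by simp
  have "sheet_sum (Complex v 0) - sheet_sum (Complex v (2 * pi)) = (\<Sum>l<r-j. a l - a (Suc l))"
    unfolding sheet_sum_def sum_subtractf[symmetric] a_def sheet_arg
    by (intro sum.cong refl arg_cong2[where f = minus]) (simp_all add: algebra_simps)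
  also have "\<dots> = a 0 - a (r - j)" by (rule sum_lessThan_telescope')
  also have "(j + 2 * (r - j)) * pi / r = 2 * pi - ?\<theta>" using j r by (simp add: of_nat_diff field_simps)
  hence "a (r - j) = of_real (1 / r) * coth_half (Complex (v / r) (2 * pi - ?\<theta>))" by (simp add: a_def)
  also have "\<dots> = of_real (1 / r) * Complex (sinh (v / r) / (cosh (v / r) - cos ?\<theta>)) (sin ?\<theta> / (cosh (v / r) - cos ?\<theta>))"
    using sweep_cos_less by (subst coth_half_Complex) (auto simp: sin_diff)
  also have "a 0 = of_real (1 / r) * Complex (sinh (v / r) / (cosh (v / r) - cos ?\<theta>)) (- sin ?\<theta> / (cosh (v / r) - cos ?\<theta>))"
    unfolding a_def using sweep_cos_less
    by (subst coth_half_Complex) (auto simp: mult.commute)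
  also have "\<dots> - of_real (1 / r) * Complex (sinh (v / r) / (cosh (v / r) - cos ?\<theta>)) (sin ?\<theta> / (cosh (v / r) - cos ?\<theta>))
      = - 4 * pi * \<i> * of_real (sweep_density r j v)"
  proof -
    have "1 / r * (- s / d) - 1 / r * (s / d) = - 4 * pi * (s / (2 * pi * r * d))" if "d > 0" for s d :: real
      using that r by (simp add: field_simps)
    from this[OF sweep_denominator_pos[of "v / r"], of "sin ?\<theta>"] show ?thesis
      by (simp add: complex_eq_iff sweep_density_def)
  qed
  finally show ?thesis .
qed

text \<open>The boundary representation for \<open>sheet_sum\<close>: its jump is \<open>- 4 * \<pi> * \<i>\<close> times the density, and the same
factor stands in front of the represented function.\<close>

lemma sweep_coth_transform:
  assumes z: "0 < Im z" "Im z < 2 * pi"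
  shows "(LBINT v. of_real (sweep_density r j v) * coth_half (z - of_real v)) = sheet_sum z"
proof -
  let ?D = "\<lambda>v. - 4 * pi * \<i> * of_real (sweep_density r j v)"
  define c0 where "c0 = max 0 (cos (pi * j / r))"
  have c0: "cos (pi * j / r) \<le> c0" "0 \<le> c0" "c0 < 1" using sweep_cos_less by (auto simp: c0_def)
  have r: "real r > 0" using j by simp
  have "(LBINT v. ?D v * coth_half (z - of_real v)) = - 4 * pi * \<i> * sheet_sum z"
  proof (rule strip_boundary_representation[where \<delta> = "pi / 2" and c = "\<Sum>l<r - j. of_real (1 / r) * 1"
        and B = "\<Sum>l<r - j. norm (of_real (1 / r) :: complex) * (2 / (1 - c0))"])
    show "sheet_sum holomorphic_on {w. - (pi / 2) < Im w \<and> Im w < 2 * pi + pi / 2}"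
    proof -
      have "exp ((w + \<i> * of_real ((j + 2 * l) * pi)) / of_real r) \<noteq> 1"
        if l: "l < r - j" and w: "- (pi / 2) < Im w" "Im w < 2 * pi + pi / 2" for l w
      proof -
        have "1 * pi \<le> (j + 2 * l) * pi" using j by (intro mult_right_mono) auto
        hence "0 < Im w + (j + 2 * l) * pi" using w pi_gt_zero by linarith
        moreover have "Im w + (j + 2 * l) * pi < 2 * pi * r"
        proof -
          have "real (2 * r - j) \<le> 2 * real r - 1" using j by linarith
          hence "(2 * r - j) * pi \<le> (2 * real r - 1) * pi" by (intro mult_right_mono) auto
          moreover have "2 * pi + (j + 2 * l) * pi \<le> (2 * r - j) * pi"
            using sheet_angle_range(2)[OF l, of "2 * pi"] by simp
          ultimately show ?thesis using w by (simp add: algebra_simps)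
        qed
        ultimately have t: "0 < (Im w + (j + 2 * l) * pi) / r" "(Im w + (j + 2 * l) * pi) / r < 2 * pi"
          using r by (auto simp: field_simps)
        have "cos ((Im w + (j + 2 * l) * pi) / r) < 1" using t by (rule cos_less_one)
        thus ?thesis using exp_ne_1[of "(Im w + (j + 2 * l) * pi) / r" "Re w / r"] sheet_arg[of "Re w" "Im w" "(j + 2 * l) * pi"]
          by simp
      qed
      thus ?thesis unfolding sheet_sum_def[abs_def] coth_half_def using j
        by (intro holomorphic_intros) auto
    qed
    fix t :: real assume t: "0 \<le> t" "t \<le> 2 * pi"
    show "norm (sheet_sum (Complex s t)) \<le> (\<Sum>l<r - j. norm (of_real (1 / r) :: complex) * (2 / (1 - c0)))" for s
      unfolding sheet_sum_def sheet_arg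
    proof (intro sum_norm_le)
      fix l assume "l \<in> {..<r - j}"
      hence "cos ((t + (j + 2 * l) * pi) / r) \<le> c0"
        using sweep_cos_le[OF sheet_angle_range[OF _ t]] c0 by (meson lessThan_iff order_trans)
      from coth_half_bound_angle[OF this c0(2,3)]
      show "norm (of_real (1 / r) * coth_half (Complex (s / r) ((t + (j + 2 * l) * pi) / r)))
          \<le> norm (of_real (1 / r) :: complex) * (2 / (1 - c0))"
        unfolding norm_mult by (intro mult_left_mono) auto
    qed
    have "filterlim (\<lambda>s. s / r) at_top at_top" "filterlim (\<lambda>s. s / r) at_bot at_bot" using r by real_asymp+
    note fl = this
    show "((\<lambda>s. sheet_sum (Complex s t)) \<longlongrightarrow> (\<Sum>l<r - j. of_real (1 / r) * 1)) at_top"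
      unfolding sheet_sum_def sheet_arg
      by (intro tendsto_intros filterlim_compose[OF coth_half_at_top fl(1)])
    have "((\<lambda>s. sheet_sum (Complex s t)) \<longlongrightarrow> (\<Sum>l<r - j. of_real (1 / r) * (- 1))) at_bot"
      unfolding sheet_sum_def sheet_arg
      by (intro tendsto_intros filterlim_compose[OF coth_half_at_bot fl(2)])
    thus "((\<lambda>s. sheet_sum (Complex s t)) \<longlongrightarrow> - (\<Sum>l<r - j. of_real (1 / r) * 1)) at_bot"
      by (simp add: sum_negf)
  next
    show "integrable lborel ?D"
      using sweep_density_mass by (intro integrable_mult_right integrable_of_real) (simp add: has_bochner_integral_iff)
  qed (use sheet_sum_diff z in auto)
  also have "(\<lambda>v. ?D v * coth_half (z - of_real v)) = (\<lambda>v. (- 4 * pi * \<i>) * (of_real (sweep_density r j v) * coth_half (z - of_real v)))"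
    by (simp add: mult_ac)
  finally show ?thesis by (simp del: mult_minus_left)
qed

end

section \<open>The logarithmic transform of the sweeping density\<close>

text \<open>The function \<open>ln \<bar>exp (s / 2) - exp (\<i> * t) * exp (- s / 2)\<bar>\<close>. For \<open>t = 0\<close> and \<open>t = \<pi>\<close> it is the logarithmic
kernel between points with logarithms of their distances to the origin differing by \<open>s\<close>, on the same side
and on opposite sides, up to the mean of these two logarithms. Twice its derivative in \<open>s\<close> is the real
part of \<open>coth_half (s + \<i> * t)\<close>.\<close>

definition log_cosh :: "real \<Rightarrow> real \<Rightarrow> real" where
  "log_cosh t s = ln (2 * cosh s - 2 * cos t) / 2"

lemma log_cosh_minus [simp]: "log_cosh t (- s) = log_cosh t s"
  by (simp add: log_cosh_def)

lemma log_cosh_reflect: "log_cosh (2 * pi - t) s = log_cosh t s"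
  by (simp add: log_cosh_def)

lemma log_cosh_measurable [measurable]: "log_cosh t \<in> borel_measurable borel"
  unfolding log_cosh_def[abs_def] cosh_field_def by measurable

lemma log_cosh_deriv:
  assumes "cos t \<noteq> 1 \<or> s \<noteq> 0"
  shows "(log_cosh t has_real_derivative (sinh s / (cosh s - cos t)) / 2) (at s)"
proof -
  have d: "cosh s - cos t > 0" using assms by (rule cosh_minus_cos_pos)
  show ?thesis unfolding log_cosh_def[abs_def]
    using d by (auto intro!: derivative_eq_intros simp: divide_simps)
qed

lemma log_cosh_bound:
  assumes "cos t < 1"
  obtains C where "C \<ge> 0" "\<And>s. \<bar>log_cosh t s - \<bar>s\<bar> / 2\<bar> \<le> C"
proof
  define c where "c = max 0 (cos t)"
  have c: "cos t \<le> c" "0 \<le> c" "c < 1" using assms by (auto simp: c_def)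
  let ?C = "(ln 4 + \<bar>ln (1 - c)\<bar>) / 2"
  show "?C \<ge> 0" by simp
  fix s :: real
  have e: "exp \<bar>s\<bar> \<le> 2 * cosh s" "cosh s \<le> exp \<bar>s\<bar>" by (auto simp: cosh_field_def abs_if)
  have "(1 - c) * exp \<bar>s\<bar> \<le> (1 - c) * (2 * cosh s)" using c e by (intro mult_left_mono) auto
  also have "\<dots> \<le> 2 * cosh s - 2 * cos t"
    using c cosh_real_ge_1[of s] mult_left_mono[of 1 "cosh s" c] by (simp add: algebra_simps)
  finally have 1: "(1 - c) * exp \<bar>s\<bar> \<le> 2 * cosh s - 2 * cos t" .
  have 2: "2 * cosh s - 2 * cos t \<le> 4 * exp \<bar>s\<bar>"
    using cosh_real_ge_1[of s] cos_ge_minus_one[of t] e by linarith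
  have p: "0 < (1 - c) * exp \<bar>s\<bar>" using c by simp
  have "ln ((1 - c) * exp \<bar>s\<bar>) \<le> ln (2 * cosh s - 2 * cos t)" using 1 p by (subst ln_le_cancel_iff) auto
  hence 3: "ln (1 - c) + \<bar>s\<bar> \<le> ln (2 * cosh s - 2 * cos t)" using c by (simp add: ln_mult)
  have "ln (2 * cosh s - 2 * cos t) \<le> ln (4 * exp \<bar>s\<bar>)" using 1 2 p by (subst ln_le_cancel_iff) auto
  hence 4: "ln (2 * cosh s - 2 * cos t) \<le> ln 4 + \<bar>s\<bar>" by (simp add: ln_mult)
  show "\<bar>log_cosh t s - \<bar>s\<bar> / 2\<bar> \<le> ?C"
  proof -
    have "\<bar>L / 2 - x / 2\<bar> \<le> (e + \<bar>d\<bar>) / 2" if "d + x \<le> L" "L \<le> e + x" "0 \<le> e" for L x d e :: real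
      using that by (auto simp: abs_if field_simps)
    from this[OF 3 4] show ?thesis unfolding log_cosh_def by simp
  qed
qed

lemma log_cosh_asymp: "((\<lambda>s. log_cosh t s - s / 2) \<longlongrightarrow> 0) at_top"
  unfolding log_cosh_def cosh_field_def by real_asymp

lemma log_cosh_mono:
  assumes "0 \<le> t" "t \<le> t'" "t' \<le> pi" "s \<noteq> 0"
  shows "log_cosh t s \<le> log_cosh t' s"
proof -
  have "cos t' \<le> cos t" using assms by (intro cos_monotone_0_pi_le) auto
  moreover have "cosh s - cos t > 0" using assms by (intro cosh_minus_cos_pos) auto
  ultimately show ?thesis unfolding log_cosh_def by simp
qed

context
  fixes r j :: nat
  assumes j: "1 \<le> j" "j < r"
begin

definition sheet_angle :: "nat \<Rightarrow> real \<Rightarrow> real" where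
  "sheet_angle l t = (t + (j + 2 * l) * pi) / r"

lemma sheet_angle_cos_less:
  assumes "l < r - j" "0 \<le> t" "t \<le> 2 * pi"
  shows "cos (sheet_angle l t) < 1"
  unfolding sheet_angle_def
  using sweep_cos_le[OF j sheet_angle_range[OF j assms]] sweep_cos_less[OF j] by linarith

lemma sweep_integrable_bound:
  assumes "f \<in> borel_measurable borel" "\<And>v. \<bar>f v\<bar> \<le> A + B * \<bar>v\<bar>"
  shows "integrable lborel (\<lambda>v. f v * sweep_density r j v)"
proof -
  note [measurable] = assms(1) measurable_sweep_density[OF j]
  have "integrable lborel (\<lambda>v. A * sweep_density r j v + B * (\<bar>v\<bar> * sweep_density r j v))"
    using sweep_density_mass[OF j] sweep_density_first_moment[OF j]
    by (intro Bochner_Integration.integrable_add integrable_mult_right) (auto simp: has_bochner_integral_iff)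
  thus ?thesis
  proof (rule Bochner_Integration.integrable_bound)
    show "AE v in lborel. norm (f v * sweep_density r j v) \<le> norm (A * sweep_density r j v + B * (\<bar>v\<bar> * sweep_density r j v))"
    proof (rule AE_I2)
      fix v :: real
      have "\<bar>f v\<bar> * sweep_density r j v \<le> (A + B * \<bar>v\<bar>) * sweep_density r j v"
        using assms(2) sweep_density_nonneg[OF j] by (intro mult_right_mono) auto
      thus "norm (f v * sweep_density r j v) \<le> norm (A * sweep_density r j v + B * (\<bar>v\<bar> * sweep_density r j v))"
        using sweep_density_nonneg[OF j, of v] by (simp add: abs_mult algebra_simps)
    qed
  qed simp
qed

lemma sweep_first_moment_zero: "has_bochner_integral lborel (\<lambda>v. v * sweep_density r j v) 0"
proof -
  have i: "integrable lborel (\<lambda>v. v * sweep_density r j v)"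
    by (rule sweep_integrable_bound[of _ 0 1]) auto
  have "(LBINT v. v * sweep_density r j v) = \<bar>- 1\<bar> *\<^sub>R (LBINT v. (0 + (- 1) * v) * sweep_density r j (0 + (- 1) * v))"
    by (rule lborel_integral_real_affine) simp
  also have "\<dots> = - (LBINT v. v * sweep_density r j v)"
    by (simp add: sweep_density_minus[OF j])
  finally show ?thesis using i by (simp add: has_bochner_integral_iff)
qed

lemma log_cosh_sweep_integrable:
  assumes "cos t < 1"
  shows "integrable lborel (\<lambda>v. log_cosh t (u - v) * sweep_density r j v)"
proof -
  obtain C where C: "C \<ge> 0" "\<And>s. \<bar>log_cosh t s - \<bar>s\<bar> / 2\<bar> \<le> C"
    using log_cosh_bound[OF assms] by blast
  have "\<bar>log_cosh t (u - v)\<bar> \<le> (C + \<bar>u\<bar>) + 1 * \<bar>v\<bar>" for v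
  proof -
    have "\<bar>u - v\<bar> \<le> \<bar>u\<bar> + \<bar>v\<bar>" by (rule abs_triangle_ineq4)
    moreover have "\<bar>log_cosh t (u - v)\<bar> \<le> C + \<bar>u - v\<bar> / 2"
      using C(2)[of "u - v"] abs_triangle_ineq[of "log_cosh t (u - v) - \<bar>u - v\<bar> / 2" "\<bar>u - v\<bar> / 2"] by simp
    moreover have "x \<le> C + b + 1 * c" if "a \<le> b + c" "x \<le> C + a / 2" "0 \<le> a" for x a b c :: real
      using that by linarith
    ultimately show ?thesis using abs_ge_zero by blast
  qed
  thus ?thesis by (rule sweep_integrable_bound[rotated]) measurable
qed

lemma sweep_log_deriv:
  assumes t: "0 < t" "t < 2 * pi"
  shows "(LBINT v. sweep_density r j v * (sinh (u - v) / (cosh (u - v) - cos t)))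
     = (\<Sum>l<r - j. 1 / r * (sinh (u / r) / (cosh (u / r) - cos (sheet_angle l t))))"
proof -
  have ct: "cos t < 1" using t by (rule cos_less_one)
  define c0 where "c0 = max 0 (cos t)"
  have c0: "cos t \<le> c0" "0 \<le> c0" "c0 < 1" using ct by (auto simp: c0_def)
  have z: "Complex u t - of_real v = Complex (u - v) t" for v by (simp add: complex_eq_iff)
  let ?f = "\<lambda>v. of_real (sweep_density r j v) * coth_half (Complex u t - of_real v)"
  have f: "?f v = of_real (sweep_density r j v) *
      Complex (sinh (u - v) / (cosh (u - v) - cos t)) (- sin t / (cosh (u - v) - cos t))" for v
    unfolding z using ct by (subst coth_half_Complex) auto
  have "integrable lborel ?f"
  proof (rule Bochner_Integration.integrable_bound)
    show "integrable lborel (\<lambda>v. sweep_density r j v * (2 / (1 - c0)))"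
      using sweep_density_mass[OF j] by (intro integrable_mult_left) (auto simp: has_bochner_integral_iff)
    show "?f \<in> borel_measurable lborel"
    proof -
      have [measurable]: "sweep_density r j \<in> borel_measurable borel" by (rule measurable_sweep_density[OF j])
      have "(\<lambda>v. exp (Complex u t - of_real v)) \<in> borel_measurable borel"
        by (intro borel_measurable_continuous_onI continuous_intros)
      note [measurable] = this
      show ?thesis unfolding coth_half_def by measurable
    qed
    show "AE v in lborel. norm (?f v) \<le> norm (sweep_density r j v * (2 / (1 - c0)))"
    proof (rule AE_I2)
      fix v :: real
      show "norm (?f v) \<le> norm (sweep_density r j v * (2 / (1 - c0)))"
        using mult_left_mono[OF coth_half_bound_angle[OF c0, of "u - v"] sweep_density_nonneg[OF j, of v]]
          sweep_density_nonneg[OF j, of v] c0(3)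
        unfolding z by (simp add: norm_mult)
    qed
  qed
  from integral_Re[OF this]
  have "(LBINT v. Re (?f v)) = Re (sheet_sum r j (Complex u t))"
    using sweep_coth_transform[OF j, of "Complex u t"] t by simp
  also have "(LBINT v. Re (?f v)) = (LBINT v. sweep_density r j v * (sinh (u - v) / (cosh (u - v) - cos t)))"
    unfolding f by simp
  also have "Re (sheet_sum r j (Complex u t)) =
      (\<Sum>l<r - j. 1 / r * (sinh (u / r) / (cosh (u / r) - cos (sheet_angle l t))))"
    unfolding sheet_sum_def[OF j] Re_sum sheet_arg[OF j]
  proof (intro sum.cong refl)
    fix l assume "l \<in> {..<r - j}"
    hence "cos ((t + (j + 2 * l) * pi) / r) < 1"
      using sheet_angle_cos_less[of l t] t by (auto simp: sheet_angle_def)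
    thus "Re (of_real (1 / r) * coth_half (Complex (u / r) ((t + (j + 2 * l) * pi) / r)))
        = 1 / r * (sinh (u / r) / (cosh (u / r) - cos (sheet_angle l t)))"
      by (subst coth_half_Complex) (auto simp: sheet_angle_def)
  qed
  finally show ?thesis .
qed

definition swept_log :: "real \<Rightarrow> real \<Rightarrow> real" where
  "swept_log t u = (LBINT v. log_cosh t (u - v) * sweep_density r j v)"

definition sheet_log :: "real \<Rightarrow> real \<Rightarrow> real" where
  "sheet_log t u = (\<Sum>l<r - j. log_cosh (sheet_angle l t) (u / r))"

text \<open>The real part of \<open>sweep_coth_transform\<close>, integrated over \<open>u\<close> from \<open>a\<close> to \<open>b\<close>: Fubini's theorem and the
fundamental theorem of calculus turn both sides into increments of \<open>log_cosh\<close>.\<close>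

lemma swept_log_increment:
  assumes t: "0 < t" "t < 2 * pi" "cos t < 1" and ab: "a \<le> b"
  shows "swept_log t b - swept_log t a = sheet_log t b - sheet_log t a"
proof -
  define g where "g s = sinh s / (cosh s - cos t) / 2" for s
  define c0 where "c0 = max 0 (cos t)"
  have c0: "cos t \<le> c0" "0 \<le> c0" "c0 < 1" using t by (auto simp: c0_def)
  have ne: "cosh s - cos t \<noteq> 0" for s using t(3) cosh_real_ge_1[of s] by linarith
  have g_cont: "continuous_on UNIV g" unfolding g_def by (intro continuous_intros) (use ne in auto)
  have g_meas [measurable]: "g \<in> borel_measurable borel" using g_cont by (rule borel_measurable_continuous_onI)
  have g_bound: "\<bar>g s\<bar> \<le> 1 / (1 - c0)" for s
  proof -
    have "\<bar>Re (coth_half (Complex s t))\<bar> \<le> 2 / (1 - c0)"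
      using coth_half_bound_angle[OF c0, of s] abs_Re_le_cmod order_trans by blast
    moreover have "Re (coth_half (Complex s t)) = 2 * g s" 
    proof -
      have "Re (coth_half (Complex s t)) = sinh s / (cosh s - cos t)" using t by (subst coth_half_Complex) auto
      moreover have "x = 2 * (x / 2)" for x :: real by simp
      ultimately show ?thesis unfolding g_def by metis
    qed
    ultimately show ?thesis by (simp add: abs_mult)
  qed
  have log_g: "(log_cosh t has_real_derivative g s) (at s)" for s
    using log_cosh_deriv[of t s] t by (auto simp: g_def)
  note [measurable] = measurable_sweep_density[OF j]
  have k_int: "integrable lborel (sweep_density r j)" using sweep_density_mass[OF j] by (simp add: has_bochner_integral_iff)
  let ?F = "\<lambda>u v. indicator {a..b} u * (sweep_density r j v * g (u - v))"
  have gk: "integrable lborel (\<lambda>v. sweep_density r j v * g (u - v))" for u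
    using sweep_integrable_bound[of "\<lambda>v. g (u - v)" "1 / (1 - c0)" 0] g_bound by (simp add: mult.commute)
  have Fub: "integrable (lborel \<Otimes>\<^sub>M lborel) (\<lambda>(u, v). ?F u v)"
  proof (rule lborel_pair.Fubini_integrable)
    show "(\<lambda>(u, v). ?F u v) \<in> borel_measurable (lborel \<Otimes>\<^sub>M lborel)" by measurable
    show "AE u in lborel. integrable lborel (\<lambda>v. (\<lambda>(u, v). ?F u v) (u, v))"
      using gk by (auto intro!: integrable_mult_right)
    show "integrable lborel (\<lambda>u. LBINT v. norm ((\<lambda>(u, v). ?F u v) (u, v)))"
    proof (rule Bochner_Integration.integrable_bound)
      show "integrable lborel (\<lambda>u. indicator {a..b} u *\<^sub>R (1 / (1 - c0)))"
        by (intro borel_integrable_compact continuous_intros) auto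
      show "AE u in lborel. norm (LBINT v. norm ((\<lambda>(u, v). ?F u v) (u, v))) \<le> norm (indicator {a..b} u *\<^sub>R (1 / (1 - c0)) :: real)"
      proof (rule AE_I2)
        fix u :: real
        have "sweep_density r j v * \<bar>g (u - v)\<bar> \<le> sweep_density r j v * (1 / (1 - c0))" for v
          by (intro mult_left_mono g_bound sweep_density_nonneg[OF j])
        hence "(LBINT v. norm (sweep_density r j v * g (u - v))) \<le> (LBINT v. sweep_density r j v * (1 / (1 - c0)))"
          using gk k_int sweep_density_nonneg[OF j]
          by (intro integral_mono integrable_norm integrable_mult_left) (auto simp: abs_mult)
        also have "\<dots> = (1 - j / r) * (1 / (1 - c0))"
          using sweep_density_mass[OF j] by (simp add: has_bochner_integral_iff)
        also have "\<dots> \<le> 1 * (1 / (1 - c0))" using c0 j by (intro mult_right_mono) (auto simp: field_simps)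
        finally show "norm (LBINT v. norm ((\<lambda>(u, v). ?F u v) (u, v))) \<le> norm (indicator {a..b} u *\<^sub>R (1 / (1 - c0)) :: real)"
          using c0 by (simp add: abs_mult split: split_indicator)
      qed
    qed measurable
  qed
  from lborel_pair.Fubini_integral[OF this]
  have "(LBINT v. LBINT u. ?F u v) = (LBINT u. LBINT v. ?F u v)" .
  also have "(LBINT v. LBINT u. ?F u v) = (LBINT v. (log_cosh t (b - v) - log_cosh t (a - v)) * sweep_density r j v)"
  proof (intro Bochner_Integration.integral_cong refl)
    fix v :: real
    have "(LBINT u. g (u - v) * indicator {a..b} u) = log_cosh t (b - v) - log_cosh t (a - v)"
    proof (rule integral_FTC_Icc_real[OF ab])
      show "((\<lambda>u. log_cosh t (u - v)) has_real_derivative g (u - v)) (at u)" for u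
      proof -
        have "((\<lambda>u. u - v) has_real_derivative 1) (at u)" by (auto intro!: derivative_eq_intros)
        from DERIV_chain2[OF log_g this] show ?thesis by simp
      qed
      show "isCont (\<lambda>u. g (u - v)) u" for u
      proof -
        have "continuous_on UNIV (\<lambda>u. g (u - v))"
          by (rule continuous_on_compose2[OF g_cont]) (auto intro!: continuous_intros)
        thus ?thesis by (simp add: continuous_on_eq_continuous_at)
      qed
    qed
    moreover have "(LBINT u. ?F u v) = (LBINT u. sweep_density r j v * (g (u - v) * indicator {a..b} u))"
      by (intro Bochner_Integration.integral_cong) (auto simp: mult_ac)
    ultimately show "(LBINT u. ?F u v) = (log_cosh t (b - v) - log_cosh t (a - v)) * sweep_density r j v" by simp
  qed
  also have "\<dots> = swept_log t b - swept_log t a" unfolding swept_log_def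
    using log_cosh_sweep_integrable[OF t(3)]
    by (simp add: left_diff_distrib Bochner_Integration.integral_diff)
  also have "(LBINT u. LBINT v. ?F u v) =
     (LBINT u. (\<Sum>l<r - j. 1 / r * (sinh (u / r) / (cosh (u / r) - cos (sheet_angle l t))) / 2) * indicator {a..b} u)"
  proof (intro Bochner_Integration.integral_cong refl)
    fix u :: real
    have alg: "x * (s * (q / 2)) = x / 2 * (s * q)" for x s q :: real by simp
    have "(LBINT v. ?F u v) = indicator {a..b} u / 2 * (LBINT v. sweep_density r j v * (sinh (u - v) / (cosh (u - v) - cos t)))"
      unfolding g_def alg by (rule integral_mult_right_zero)
    also have "\<dots> = (\<Sum>l<r - j. 1 / r * (sinh (u / r) / (cosh (u / r) - cos (sheet_angle l t))) / 2) * indicator {a..b} u"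
      unfolding sweep_log_deriv[OF t(1,2)] sum_divide_distrib[symmetric] by simp
    finally show "(LBINT v. ?F u v) = \<dots>" .
  qed
  also have "\<dots> = sheet_log t b - sheet_log t a"
  proof (rule integral_FTC_Icc_real[OF ab])
    fix u :: real
    have cl: "cos (sheet_angle l t) < 1" if "l < r - j" for l
      using sheet_angle_cos_less[OF that, of t] t by auto
    show "(sheet_log t has_real_derivative (\<Sum>l<r - j. 1 / r * (sinh (u / r) / (cosh (u / r) - cos (sheet_angle l t))) / 2)) (at u)"
      unfolding sheet_log_def[abs_def]
    proof (rule DERIV_sum)
      fix l assume "l \<in> {..<r - j}"
      hence "(log_cosh (sheet_angle l t) has_real_derivative (sinh (u / r) / (cosh (u / r) - cos (sheet_angle l t))) / 2) (at (u / r))"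
        using cl[of l] by (intro log_cosh_deriv) auto
      moreover have "((\<lambda>u. u / r) has_real_derivative 1 / r) (at u)"
        using j by (auto intro!: derivative_eq_intros)
      ultimately have "((\<lambda>u. log_cosh (sheet_angle l t) (u / r)) has_real_derivative (sinh (u / r) / (cosh (u / r) - cos (sheet_angle l t))) / 2 * (1 / r)) (at u)"
        by (rule DERIV_chain2)
      thus "((\<lambda>u. log_cosh (sheet_angle l t) (u / r)) has_real_derivative 1 / r * (sinh (u / r) / (cosh (u / r) - cos (sheet_angle l t))) / 2) (at u)"
      proof -
        have "q / 2 * (1 / r) = 1 / r * q / 2" for q :: real by simp
        with \<open>((\<lambda>u. log_cosh (sheet_angle l t) (u / r)) has_real_derivative _) _\<close> show ?thesis by metis
      qed
    qed
    have "cosh (u / r) - cos (sheet_angle l t) \<noteq> 0" if "l < r - j" for l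
      using cl[OF that] cosh_real_ge_1[of "u / r"] by linarith
    thus "isCont (\<lambda>u. \<Sum>l<r - j. 1 / r * (sinh (u / r) / (cosh (u / r) - cos (sheet_angle l t))) / 2) u"
      using j by (intro continuous_intros) auto
  qed
  finally show ?thesis by simp
qed

text \<open>This and the next lemma fix the constant of integration. Adding the values at \<open>u\<close> and \<open>- u\<close> removes the
shift by \<open>v\<close> from the leading term, of which only \<open>u\<close> times the mass of the density remains.\<close>

lemma swept_log_asymp:
  assumes "cos t < 1"
  shows "((\<lambda>u. swept_log t u + swept_log t (- u) - (1 - j / r) * u) \<longlongrightarrow> 0) at_top"
proof -
  obtain C where C: "C \<ge> 0" "\<And>s. \<bar>log_cosh t s - \<bar>s\<bar> / 2\<bar> \<le> C"
    using log_cosh_bound[OF assms] by blast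
  note [measurable] = measurable_sweep_density[OF j]
  let ?f = "\<lambda>u v. (log_cosh t (u - v) + log_cosh t (u + v) - u) * sweep_density r j v"
  have "((\<lambda>u. LBINT v. ?f u v) \<longlongrightarrow> (LBINT v::real. 0)) at_top"
  proof (rule integral_dominated_convergence_at_top[where w = "\<lambda>v. (2 * C + \<bar>v\<bar>) * sweep_density r j v"])
    show "integrable lborel (\<lambda>v. (2 * C + \<bar>v\<bar>) * sweep_density r j v)"
      using C by (intro sweep_integrable_bound[of _ "2 * C" 1]) auto
    show "AE v in lborel. ((\<lambda>u. ?f u v) \<longlongrightarrow> 0) at_top"
    proof (rule AE_I2)
      fix v :: real
      have fl: "filterlim (\<lambda>u. u - v) at_top at_top" "filterlim (\<lambda>u. u + v) at_top at_top" by real_asymp+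
      have "((\<lambda>u. ((log_cosh t (u - v) - (u - v) / 2) + (log_cosh t (u + v) - (u + v) / 2)) * sweep_density r j v)
         \<longlongrightarrow> (0 + 0) * sweep_density r j v) at_top"
        by (intro tendsto_intros filterlim_compose[OF log_cosh_asymp fl(1)] filterlim_compose[OF log_cosh_asymp fl(2)])
      moreover have "((log_cosh t (u - v) - (u - v) / 2) + (log_cosh t (u + v) - (u + v) / 2)) * sweep_density r j v = ?f u v" for u
        by (simp add: field_simps)
      ultimately show "((\<lambda>u. ?f u v) \<longlongrightarrow> 0) at_top" by simp
    qed
    show "\<forall>\<^sub>F u in at_top. AE v in lborel. norm (?f u v) \<le> (2 * C + \<bar>v\<bar>) * sweep_density r j v"
      using eventually_ge_at_top[of 0]
    proof eventually_elim
      case (elim u)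
      have "\<bar>log_cosh t (u - v) + log_cosh t (u + v) - u\<bar> \<le> 2 * C + \<bar>v\<bar>" for v
        using C(2)[of "u - v"] C(2)[of "u + v"] elim by (auto simp: abs_if field_simps split: if_splits)
      thus ?case using sweep_density_nonneg[OF j] by (auto simp: abs_mult intro!: mult_right_mono)
    qed
  qed auto
  moreover have "(LBINT v. ?f u v) = swept_log t u + swept_log t (- u) - (1 - j / r) * u" for u
  proof -
    have lm: "log_cosh t (- u - v) = log_cosh t (u + v)" for v
      using log_cosh_minus[of t "u + v"] by simp
    have i: "integrable lborel (\<lambda>v. log_cosh t (u - v) * sweep_density r j v)"
       "integrable lborel (\<lambda>v. log_cosh t (u + v) * sweep_density r j v)"
       "integrable lborel (\<lambda>v. u * sweep_density r j v)"
       and m: "(LBINT v. u * sweep_density r j v) = (1 - j / r) * u"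
      using log_cosh_sweep_integrable[OF assms, of u] log_cosh_sweep_integrable[OF assms, of "- u"] sweep_density_mass[OF j]
      unfolding lm by (auto simp: has_bochner_integral_iff)
    have e: "swept_log t (- u) = (LBINT v. log_cosh t (u + v) * sweep_density r j v)"
      unfolding swept_log_def lm ..
    have e': "swept_log t u = (LBINT v. log_cosh t (u - v) * sweep_density r j v)"
      unfolding swept_log_def ..
    show ?thesis
      unfolding e e' m[symmetric] using i by (simp add: algebra_simps)
  qed
  ultimately show ?thesis by simp
qed

lemma sheet_log_asymp: "((\<lambda>u. sheet_log t u + sheet_log t (- u) - (1 - j / r) * u) \<longlongrightarrow> 0) at_top"
proof -
  have fl: "filterlim (\<lambda>u. u / r) at_top at_top" using j by real_asymp
  have "((\<lambda>u. 2 * (\<Sum>l<r - j. log_cosh (sheet_angle l t) (u / r) - (u / r) / 2)) \<longlongrightarrow> 2 * (\<Sum>l<r - j. 0)) at_top"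
    by (intro tendsto_intros filterlim_compose[OF log_cosh_asymp fl])
  moreover have "2 * (\<Sum>l<r - j. log_cosh (sheet_angle l t) (u / r) - (u / r) / 2) = sheet_log t u + sheet_log t (- u) - (1 - j / r) * u" for u
  proof -
    have "(\<Sum>l<r - j. log_cosh (sheet_angle l t) (u / r) - (u / r) / 2) = sheet_log t u - (real r - j) * ((u / r) / 2)"
      using j by (simp add: sheet_log_def sum_subtractf of_nat_diff)
    moreover have "sheet_log t (- u) = sheet_log t u" by (simp add: sheet_log_def)
    moreover have "2 * ((real r - j) * ((u / r) / 2)) = (1 - j / r) * u" using j by (simp add: field_simps)
    ultimately show ?thesis by (simp add: right_diff_distrib)
  qed
  ultimately show ?thesis by simp
qed

lemma swept_log_eq_pos:
  assumes t: "0 < t" "t < 2 * pi" "cos t < 1"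
  shows "swept_log t u = sheet_log t u"
proof -
  define D where "D u = swept_log t u - sheet_log t u" for u
  have const: "D a = D b" if "a \<le> b" for a b
    using swept_log_increment[OF t that] by (simp add: D_def)
  have "((\<lambda>u. (swept_log t u + swept_log t (- u) - (1 - j / r) * u) - (sheet_log t u + sheet_log t (- u) - (1 - j / r) * u)) \<longlongrightarrow> 0 - 0) at_top"
    by (intro tendsto_diff swept_log_asymp sheet_log_asymp t)
  moreover have "D x = D u" for x using const[of x u] const[of u x] by linarith
  hence "(swept_log t x + swept_log t (- x) - (1 - j / r) * x) - (sheet_log t x + sheet_log t (- x) - (1 - j / r) * x) = 2 * D u" for x
    by (smt (verit) D_def)
  ultimately have "((\<lambda>x::real. 2 * D u) \<longlongrightarrow> 0) at_top" by simp
  hence "2 * D u = 0" by (simp add: tendsto_const_iff)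
  thus ?thesis by (simp add: D_def)
qed

text \<open>For \<open>t = 0\<close> the kernel has a logarithmic singularity on the line of integration. This case is the limit of
positive angles decreasing to \<open>0\<close>, where \<open>log_cosh t s\<close> decreases, by monotone convergence.\<close>

lemma sweep_log_transform:
  assumes t: "0 \<le> t" "t \<le> pi"
  shows "has_bochner_integral lborel (\<lambda>v. log_cosh t (u - v) * sweep_density r j v) (sheet_log t u)"
proof (cases "t = 0")
  case False
  hence ct: "cos t < 1" using t cos_monotone_0_pi[of 0 t] by simp
  show ?thesis using swept_log_eq_pos[of t u] log_cosh_sweep_integrable[OF ct, of u] t False ct
    by (simp add: has_bochner_integral_iff swept_log_def)
next
  case True
  define a where "a n = pi / real (Suc n)" for n :: nat
  have a: "0 < a n" "a n \<le> pi" "a n < 2 * pi" for n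
    unfolding a_def by (auto simp: field_simps intro: order.strict_trans2[of _ "pi"])
  have a_lim: "a \<longlonglongrightarrow> 0" unfolding a_def by real_asymp
  have a_dec: "a n \<le> a m" if "m \<le> n" for m n unfolding a_def using that by (intro divide_left_mono) auto
  have ca: "cos (a n) < 1" for n using cos_monotone_0_pi[of 0 "a n"] a[of n] by simp
  note [measurable] = measurable_sweep_density[OF j]
  have "has_bochner_integral lborel (\<lambda>v. - (log_cosh 0 (u - v) * sweep_density r j v)) (- sheet_log 0 u)"
  proof (rule has_bochner_integral_monotone_convergence)
    show "integrable lborel (\<lambda>v. - (log_cosh (a n) (u - v) * sweep_density r j v))" for n
      using log_cosh_sweep_integrable[OF ca] by simp
    have ae: "AE v in lborel. v \<noteq> u" by (rule AE_lborel_singleton)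
    show "AE v in lborel. incseq (\<lambda>n. - (log_cosh (a n) (u - v) * sweep_density r j v))"
      using ae
    proof eventually_elim
      case (elim v)
      show ?case
      proof (rule incseq_SucI)
        fix n
        have "log_cosh (a (Suc n)) (u - v) \<le> log_cosh (a n) (u - v)"
          using a[of "Suc n"] a[of n] a_dec[of n "Suc n"] elim by (intro log_cosh_mono) auto
        thus "- (log_cosh (a n) (u - v) * sweep_density r j v) \<le> - (log_cosh (a (Suc n)) (u - v) * sweep_density r j v)"
          using sweep_density_nonneg[OF j] by (simp add: mult_right_mono)
      qed
    qed
    show "AE v in lborel. (\<lambda>n. - (log_cosh (a n) (u - v) * sweep_density r j v)) \<longlonglongrightarrow> - (log_cosh 0 (u - v) * sweep_density r j v)"
      using ae
    proof eventually_elim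
      case (elim v)
      hence "cosh (u - v) - cos 0 > 0" by (intro cosh_minus_cos_pos) auto
      thus ?case unfolding log_cosh_def by (intro tendsto_intros a_lim) auto
    qed
    have "(\<lambda>n. - sheet_log (a n) u) \<longlonglongrightarrow> - sheet_log 0 u"
      unfolding sheet_log_def log_cosh_def sheet_angle_def
    proof (intro tendsto_intros a_lim)
      fix l assume "l \<in> {..<r - j}"
      hence "cos ((0 + (j + 2 * l) * pi) / r) < 1" using sheet_angle_cos_less[of l 0] by (simp add: sheet_angle_def)
      thus "2 * cosh (u / r) - 2 * cos ((0 + (j + 2 * l) * pi) / r) \<noteq> 0"
        using cosh_real_ge_1[of "u / r"] by simp
    qed (use j in auto)
    moreover have "(LBINT v. - (log_cosh (a n) (u - v) * sweep_density r j v)) = - sheet_log (a n) u" for n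
      using swept_log_eq_pos[OF a(1,3) ca] by (simp add: swept_log_def)
    ultimately show "(\<lambda>n. LBINT v. - (log_cosh (a n) (u - v) * sweep_density r j v)) \<longlonglongrightarrow> - sheet_log 0 u" by simp
  qed measurable
  from has_bochner_integral_minus[OF this] True show ?thesis by simp
qed

end

section \<open>Potentials of swept point masses\<close>

text \<open>Both sides are monic polynomials of degree \<open>r\<close> in \<open>X\<close>, and for \<open>Y \<noteq> 0\<close> the \<open>r\<close> distinct numbers
\<open>exp (\<i> * (t + 2 * l * \<pi>) / r) * Y\<close> are roots of both.\<close>

lemma prod_minus_cis_roots:
  fixes X Y :: complex and r :: nat
  assumes r: "r \<ge> 1"
  shows "(\<Prod>l<r. X - cis ((t + 2 * real l * pi) / r) * Y) = X ^ r - cis t * Y ^ r"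
proof (cases "Y = 0")
  case True
  thus ?thesis using r by (simp add: power_0_left)
next
  case False
  define c where "c l = cis (t / r) * cis (2 * pi * real l / r)" for l
  have c: "cis ((t + 2 * real l * pi) / r) = c l" for l :: nat
    by (simp add: c_def cis_mult add_divide_distrib mult_ac)
  have c_pow: "c l ^ r = cis t" if "l < r" for l
  proof -
    have "cis (2 * pi * real l / r) ^ r = 1"
      unfolding Complex.DeMoivre using r by simp
    thus ?thesis using r by (simp add: c_def power_mult_distrib Complex.DeMoivre)
  qed
  have inj: "inj_on (\<lambda>l. c l * Y) {..<r}"
    using Complex.bij_betw_roots_unity[of r] r False unfolding c_def
    by (auto simp: bij_betw_def inj_on_def)
  let ?p = "\<Prod>l<r. [:- (c l * Y), 1:]"
  let ?q = "monom 1 r - [:cis t * Y ^ r:]"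
  have deg: "degree ?p = r"
    by (subst degree_prod_eq_sum_degree) auto
  have "?p = ?q"
  proof (rule poly_eqI_degree_lead_coeff[where n = r and A = "(\<lambda>l. c l * Y) ` {..<r}"])
    have "lead_coeff ?p = 1" by (subst lead_coeff_prod) auto
    moreover have "coeff ?q r = 1" using r by (cases r) auto
    ultimately show "coeff ?p r = coeff ?q r" using deg by simp
    show "r \<le> card ((\<lambda>l. c l * Y) ` {..<r})" using inj by (simp add: card_image)
    show "degree ?p \<le> r" using deg by simp
    show "degree ?q \<le> r" by (intro degree_diff_le degree_monom_le) auto
    fix z assume "z \<in> (\<lambda>l. c l * Y) ` {..<r}"
    then obtain l where l: "l < r" "z = c l * Y" by auto
    hence "poly ?p z = 0" by (auto simp: poly_prod)
    moreover have "poly ?q z = 0" using l c_pow[OF l(1)] by (simp add: poly_monom power_mult_distrib)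
    ultimately show "poly ?p z = poly ?q z" by simp
  qed
  hence "poly ?p X = poly ?q X" by simp
  thus ?thesis unfolding c by (simp add: poly_prod poly_monom algebra_simps)
qed

lemma norm_exp_minus_cis:
  "(norm (of_real (exp (w / 2)) - cis t * of_real (exp (- w / 2))))\<^sup>2 = 2 * cosh w - 2 * cos t"
proof -
  have "(norm (of_real (exp (w / 2)) - cis t * of_real (exp (- w / 2))))\<^sup>2
      = (exp (w / 2) - cos t * exp (- w / 2))\<^sup>2 + (sin t * exp (- w / 2))\<^sup>2"
    by (simp add: cmod_power2)
  also have "\<dots> = (exp (w / 2))\<^sup>2 - 2 * cos t * (exp (w / 2) * exp (- w / 2)) + (exp (- w / 2))\<^sup>2"
    using sin_cos_squared_add[of t] by algebra
  also have "\<dots> = 2 * cosh w - 2 * cos t"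
    by (simp add: cosh_field_def power2_eq_square flip: exp_add)
  finally show ?thesis .
qed

text \<open>The logarithm of the modulus of the factorization of \<open>X ^ r - exp (\<i> * t) * Y ^ r\<close>, at
\<open>X = exp (u / (2 * r))\<close> and \<open>Y = exp (- u / (2 * r))\<close>.\<close>

lemma log_cosh_product:
  fixes r :: nat
  assumes r: "r \<ge> 1" and pos: "cosh u - cos t > 0"
  shows "(\<Sum>l<r. log_cosh ((t + 2 * real l * pi) / r) (u / r)) = log_cosh t u"
proof -
  let ?X = "of_real (exp (u / r / 2)) :: complex" and ?Y = "of_real (exp (- (u / r) / 2)) :: complex"
  have "?X ^ r = of_real (exp (u / 2))" "?Y ^ r = of_real (exp (- u / 2))"
    using r by (simp_all flip: of_real_power exp_of_nat_mult)
  hence "(\<Prod>l<r. ?X - cis ((t + 2 * real l * pi) / r) * ?Y) = of_real (exp (u / 2)) - cis t * of_real (exp (- u / 2))"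
    using prod_minus_cis_roots[OF r, of ?X t ?Y] by simp
  hence "(\<Prod>l<r. (norm (?X - cis ((t + 2 * real l * pi) / r) * ?Y))\<^sup>2) = 2 * cosh u - 2 * cos t"
    using norm_exp_minus_cis[of u t] unfolding prod_power_distrib[symmetric] prod_norm by simp
  hence P: "(\<Prod>l<r. 2 * cosh (u / r) - 2 * cos ((t + 2 * real l * pi) / r)) = 2 * cosh u - 2 * cos t"
    unfolding norm_exp_minus_cis .
  have nz: "2 * cosh (u / r) - 2 * cos ((t + 2 * real l * pi) / r) \<noteq> 0" if "l < r" for l
  proof
    assume "2 * cosh (u / r) - 2 * cos ((t + 2 * real l * pi) / r) = 0"
    hence "(\<Prod>l<r. 2 * cosh (u / r) - 2 * cos ((t + 2 * real l * pi) / r)) = 0"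
      using that by (intro prod_zero) auto
    with P pos show False by simp
  qed
  have "ln (2 * cosh u - 2 * cos t) = (\<Sum>l<r. ln (2 * cosh (u / r) - 2 * cos ((t + 2 * real l * pi) / r)))"
    unfolding P[symmetric] by (rule ln_prod) (use nz in auto)
  thus ?thesis by (simp add: log_cosh_def sum_divide_distrib)
qed

lemma ln_add_log_cosh:
  assumes "p > 0" "q > 0"
  shows "ln (q + p) = (ln p + ln q) / 2 + log_cosh pi (ln q - ln p)"
proof -
  have "2 * cosh (ln q - ln p) - 2 * cos pi = (q + p)\<^sup>2 / (p * q)"
    using assms by (simp add: cosh_field_def exp_diff power2_eq_square field_simps)
  hence "ln (2 * cosh (ln q - ln p) - 2 * cos pi) = 2 * ln (q + p) - (ln p + ln q)"
    using assms by (simp add: ln_div ln_mult ln_realpow)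
  thus ?thesis by (simp add: log_cosh_def field_simps)
qed

lemma ln_diff_log_cosh:
  assumes "p > 0" "q > 0" "p \<noteq> q"
  shows "ln \<bar>q - p\<bar> = (ln p + ln q) / 2 + log_cosh 0 (ln q - ln p)"
proof -
  have "2 * cosh (ln q - ln p) - 2 * cos 0 = (q - p)\<^sup>2 / (p * q)"
    using assms by (simp add: cosh_field_def exp_diff power2_eq_square field_simps)
  moreover have "ln ((q - p)\<^sup>2) = 2 * ln \<bar>q - p\<bar>" using ln_realpow[of "\<bar>q - p\<bar>" 2] assms by simp
  ultimately have "ln (2 * cosh (ln q - ln p) - 2 * cos 0) = 2 * ln \<bar>q - p\<bar> - (ln p + ln q)"
    using assms by (simp add: ln_div ln_mult)
  thus ?thesis by (simp add: log_cosh_def field_simps)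
qed

text \<open>The integral of \<open>ln \<bar>y' - t\<bar>\<close> over the unit mass at \<open>x\<close>, swept onto the \<open>j\<close>-th half-line, where \<open>y\<close> is the
distance of \<open>y'\<close> from the origin and \<open>e\<close> is \<open>0\<close> if \<open>y'\<close> lies on the side of this half-line and \<open>1\<close> if it lies
on the other side. The formula makes sense also for \<open>j = 0\<close> and \<open>j = r\<close>, which provide the boundary terms
of the Euler--Lagrange equations.\<close>

definition swept_potential :: "nat \<Rightarrow> nat \<Rightarrow> nat \<Rightarrow> real \<Rightarrow> real \<Rightarrow> real" where
  "swept_potential r j e x y = (1 - j / r) * ((ln x + ln y) / 2)
     + (\<Sum>l<r - j. log_cosh (real (e + j + 2 * l) * pi / r) ((ln y - ln x) / r))"

text \<open>On the logarithmic scale the kernel is \<open>log_cosh 0\<close> plus a linear term. The part of this term that is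
proportional to \<open>v\<close> integrates to \<open>0\<close> because the density is even.\<close>

lemma swept_potential_same_side:
  assumes j: "1 \<le> j" "j < r" and "x > 0" "y > 0"
  shows "has_bochner_integral lborel (\<lambda>v. ln \<bar>y - x * exp v\<bar> * sweep_density r j v) (swept_potential r j 0 x y)"
proof -
  note [measurable] = measurable_sweep_density[OF j]
  have "has_bochner_integral lborel (\<lambda>v. ((ln x + ln y) / 2) * sweep_density r j v + (v * sweep_density r j v) / 2
      + log_cosh 0 ((ln y - ln x) - v) * sweep_density r j v)
      ((ln x + ln y) / 2 * (1 - j / r) + 0 / 2 + sheet_log r j 0 (ln y - ln x))"
    by (intro has_bochner_integral_add has_bochner_integral_mult_right has_bochner_integral_divide
        sweep_density_mass[OF j] sweep_first_moment_zero[OF j] sweep_log_transform[OF j]) auto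
  also have "(ln x + ln y) / 2 * (1 - j / r) + 0 / 2 + sheet_log r j 0 (ln y - ln x) = swept_potential r j 0 x y"
    by (simp add: swept_potential_def sheet_log_def[OF j] sheet_angle_def[OF j] algebra_simps)
  finally show ?thesis
  proof (subst has_bochner_integral_cong_AE)
    have "AE v in lborel. v \<noteq> ln y - ln x" by (rule AE_lborel_singleton)
    thus "AE v in lborel. ln \<bar>y - x * exp v\<bar> * sweep_density r j v =
      ((ln x + ln y) / 2) * sweep_density r j v + (v * sweep_density r j v) / 2
      + log_cosh 0 ((ln y - ln x) - v) * sweep_density r j v"
    proof eventually_elim
      case (elim v)
      have "x * exp v \<noteq> y"
      proof
        assume "x * exp v = y"
        hence "ln x + v = ln y" using assms by (auto simp: ln_mult)
        thus False using elim by simp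
      qed
      hence "ln \<bar>y - x * exp v\<bar> = (ln x + v + ln y) / 2 + log_cosh 0 (ln y - (ln x + v))"
        using ln_diff_log_cosh[of "x * exp v" y] assms by (simp add: ln_mult)
      thus ?case by (simp add: algebra_simps add_divide_distrib)
    qed
  qed (auto simp: log_cosh_def)
qed

lemma swept_potential_opposite_side:
  assumes j: "1 \<le> j" "j < r" and "x > 0" "y > 0"
  shows "has_bochner_integral lborel (\<lambda>v. ln (y + x * exp v) * sweep_density r j v) (swept_potential r j 1 x y)"
proof -
  have "has_bochner_integral lborel (\<lambda>v. ((ln x + ln y) / 2) * sweep_density r j v + (v * sweep_density r j v) / 2
      + log_cosh pi ((ln y - ln x) - v) * sweep_density r j v)
      ((ln x + ln y) / 2 * (1 - j / r) + 0 / 2 + sheet_log r j pi (ln y - ln x))"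
    by (intro has_bochner_integral_add has_bochner_integral_mult_right has_bochner_integral_divide
        sweep_density_mass[OF j] sweep_first_moment_zero[OF j] sweep_log_transform[OF j]) auto
  also have "(ln x + ln y) / 2 * (1 - j / r) + 0 / 2 + sheet_log r j pi (ln y - ln x) = swept_potential r j 1 x y"
    by (simp add: swept_potential_def sheet_log_def[OF j] sheet_angle_def[OF j] algebra_simps)
  also have "(\<lambda>v. ((ln x + ln y) / 2) * sweep_density r j v + (v * sweep_density r j v) / 2
      + log_cosh pi ((ln y - ln x) - v) * sweep_density r j v) = (\<lambda>v. ln (y + x * exp v) * sweep_density r j v)"
  proof (rule ext)
    fix v
    have "ln (y + x * exp v) = (ln x + v + ln y) / 2 + log_cosh pi (ln y - (ln x + v))"
      using ln_add_log_cosh[of "x * exp v" y] assms by (simp add: ln_mult)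
    thus "((ln x + ln y) / 2) * sweep_density r j v + (v * sweep_density r j v) / 2
      + log_cosh pi ((ln y - ln x) - v) * sweep_density r j v = ln (y + x * exp v) * sweep_density r j v"
      by (simp add: algebra_simps add_divide_distrib)
  qed
  finally show ?thesis .
qed

text \<open>For \<open>j = 0\<close> the angles are all the \<open>r\<close>-th parts of \<open>\<pi>\<close> modulo \<open>2 * \<pi>\<close>, and their sum collapses to the kernel
of the point mass itself.\<close>

lemma swept_potential_zero:
  assumes "r \<ge> 1" "x > 0" "y > 0"
  shows "swept_potential r 0 1 x y = ln (y + x)"
proof -
  have "cosh (ln y - ln x) - cos pi > 0" by (simp add: add_pos_pos)
  from log_cosh_product[OF assms(1) this]
  have "(\<Sum>l<r. log_cosh (real (1 + 2 * l) * pi / r) ((ln y - ln x) / r)) = log_cosh pi (ln y - ln x)"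
    by (simp add: algebra_simps)
  thus ?thesis using ln_add_log_cosh[of x y] assms by (simp add: swept_potential_def)
qed

text \<open>The Euler--Lagrange equation on the \<open>j\<close>-th half-line. In multiples of \<open>\<pi> / r\<close> and in steps of two, the angles
on the left run from \<open>j\<close> to \<open>2 * r - j - 2\<close>, and those on the right from \<open>j\<close> to \<open>2 * r - j\<close> and from \<open>j + 2\<close> to
\<open>2 * r - j - 2\<close>. Since \<open>2 * r - j\<close> and \<open>j\<close> give the same value, both sides agree.\<close>

lemma swept_potential_balance:
  assumes j: "1 \<le> j" "j < r"
  shows "2 * swept_potential r j 0 x y = swept_potential r (j - 1) 1 x y + swept_potential r (j + 1) 1 x y"
proof -
  define M where "M n = log_cosh (real n * pi / r) ((ln y - ln x) / r)" for n :: nat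
  obtain k where k: "r = j + Suc k" using j less_iff_Suc_add by auto
  have refl: "M (j + 2 * Suc k) = M j"
  proof -
    have "real (j + 2 * Suc k) * pi / r = 2 * pi - real j * pi / r" using k by (simp add: field_simps)
    thus ?thesis unfolding M_def by (simp only: log_cosh_reflect)
  qed
  have 1: "(\<Sum>l<r - (j - 1). M (1 + (j - 1) + 2 * l)) = (\<Sum>l<Suc k. M (j + 2 * l)) + M j"
    using j k refl by simp
  have 2: "(\<Sum>l<Suc k. M (j + 2 * l)) = M j + (\<Sum>l<r - (j + 1). M (1 + (j + 1) + 2 * l))"
    unfolding sum.lessThan_Suc_shift using k by (simp add: add_ac)
  have 3: "(\<Sum>l<r - j. M (0 + j + 2 * l)) = (\<Sum>l<Suc k. M (j + 2 * l))" using k by simp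
  have 4: "2 * (1 - j / r) = (1 - real (j - 1) / r) + (1 - real (j + 1) / r)"
    using j by (simp add: of_nat_diff field_simps)
  have 5: "2 * ((1 - j / r) * L) = (1 - real (j - 1) / r) * L + (1 - real (j + 1) / r) * L" for L
    unfolding mult.assoc[symmetric] 4 by (rule distrib_right)
  \<comment> \<open>The equation is linear in the two sums once the common term \<open>M j\<close> is split off.\<close>
  have lin: "2 * (a + S) = (b + (S + m)) + (c + T)" if "S = m + T" "2 * a = b + c" for a b c m S T :: real
    using that by simp
  show ?thesis unfolding swept_potential_def M_def[symmetric] 1 3 by (rule lin[OF 2 5])
qed

lemma swept_potential_top: "swept_potential r r e x y = (1 - r / r) * ((ln x + ln y) / 2)"
  by (simp add: swept_potential_def)

text \<open>For \<open>j = 1\<close> the angles are the multiples of \<open>2 * \<pi> / r\<close> except \<open>0\<close>. The full sum would be the kernel of the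
point mass, and the missing term is the kernel between the \<open>r\<close>-th roots.\<close>

lemma swept_potential_one:
  assumes r: "r \<ge> 1" and xy: "x > 0" "y > 0" "x \<noteq> y"
  shows "swept_potential r 1 1 x y = ln \<bar>y - x\<bar> - ln \<bar>root r y - root r x\<bar>"
proof -
  let ?u = "ln y - ln x"
  define M where "M n = log_cosh (real n * pi / r) (?u / r)" for n :: nat
  have u: "?u \<noteq> 0" using xy by simp
  have "(\<Sum>l<r. M (2 * l)) = log_cosh 0 ?u"
    using log_cosh_product[OF r, of ?u 0] cosh_minus_cos_pos[of 0 ?u] u
    by (simp add: M_def mult_ac)
  moreover obtain k where k: "r = Suc k" using r by (cases r) auto
  have "(\<Sum>l<r. M (2 * l)) = M 0 + (\<Sum>l<r - 1. M (1 + 1 + 2 * l))"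
    unfolding k sum.lessThan_Suc_shift by (simp add: add_ac)
  moreover have "ln (root r y) = ln y / r" "ln (root r x) = ln x / r" using xy r by (simp_all add: ln_root)
  hence "ln \<bar>root r y - root r x\<bar> = (ln x / r + ln y / r) / 2 + M 0"
    using ln_diff_log_cosh[of "root r x" "root r y"] xy r by (simp add: M_def diff_divide_distrib)
  moreover have "ln \<bar>y - x\<bar> = (ln x + ln y) / 2 + log_cosh 0 ?u"
    using ln_diff_log_cosh[of x y] xy by simp
  moreover have "(1 - real 1 / r) * ((ln x + ln y) / 2) = (ln x + ln y) / 2 - (ln x / r + ln y / r) / 2"
    using r by (simp add: left_diff_distrib) (simp add: field_simps)
  ultimately show ?thesis unfolding swept_potential_def M_def[symmetric] by linarith
qed

section \<open>Positive definiteness of the logarithmic energy\<close>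

text \<open>Both sides are iterated integrals of \<open>exp (- t * s)\<close> over \<open>t > 0\<close> and \<open>p \<le> s \<le> q\<close>.\<close>

lemma nn_integral_frullani:
  assumes pq: "0 < p" "p \<le> q"
  shows "(\<integral>\<^sup>+t. ennreal (indicator {0<..} t * ((exp (- t * p) - exp (- t * q)) / t)) \<partial>lborel) = ennreal (ln q - ln p)"
proof -
  have inner: "(\<integral>\<^sup>+s. ennreal (exp (- t * s)) * indicator {p..q} s \<partial>lborel) = ennreal ((exp (- t * p) - exp (- t * q)) / t)"
    if "t > 0" for t
  proof -
    have "(\<integral>\<^sup>+s. ennreal (exp (- t * s)) * indicator {p..q} s \<partial>lborel) = ennreal (- exp (- t * q) / t - (- exp (- t * p) / t))"
      by (rule nn_integral_FTC_Icc) (use that pq in \<open>auto intro!: derivative_eq_intros\<close>)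
    thus ?thesis by (simp add: diff_divide_distrib)
  qed
  have outer: "(\<integral>\<^sup>+t. ennreal (exp (- t * s)) * indicator {0<..} t \<partial>lborel) = ennreal (1 / s)" if "s > 0" for s
  proof -
    have "(\<integral>\<^sup>+t. ennreal (exp (- t * s)) * indicator {0<..} t \<partial>lborel) = (\<integral>\<^sup>+t. ennreal (exp (- t * s)) * indicator {0..} t \<partial>lborel)"
      by (intro nn_integral_cong_AE eventually_mono[OF AE_lborel_singleton[of 0]]) (auto split: split_indicator)
    also have "\<dots> = ennreal (0 - (- exp (- 0 * s) / s))"
    proof (rule nn_integral_FTC_atLeast)
      show "((\<lambda>t. - exp (- t * s) / s) \<longlongrightarrow> 0) at_top" using that by real_asymp
    qed (use that in \<open>auto intro!: derivative_eq_intros\<close>)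
    finally show ?thesis by simp
  qed
  have "(\<integral>\<^sup>+t. ennreal (indicator {0<..} t * ((exp (- t * p) - exp (- t * q)) / t)) \<partial>lborel)
      = (\<integral>\<^sup>+t. \<integral>\<^sup>+s. ennreal (exp (- t * s)) * indicator {p..q} s * indicator {0<..} t \<partial>lborel \<partial>lborel)"
  proof (intro nn_integral_cong)
    fix t :: real
    show "ennreal (indicator {0<..} t * ((exp (- t * p) - exp (- t * q)) / t))
        = (\<integral>\<^sup>+s. ennreal (exp (- t * s)) * indicator {p..q} s * indicator {0<..} t \<partial>lborel)"
      using inner[of t] by (cases "t > 0") (simp_all add: nn_integral_multc)
  qed
  also have "\<dots> = (\<integral>\<^sup>+s. \<integral>\<^sup>+t. ennreal (exp (- t * s)) * indicator {p..q} s * indicator {0<..} t \<partial>lborel \<partial>lborel)"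
    by (rule lborel_pair.Fubini') measurable
  also have "\<dots> = (\<integral>\<^sup>+s. ennreal (1 / s) * indicator {p..q} s \<partial>lborel)"
  proof (intro nn_integral_cong)
    fix s :: real
    have "(\<integral>\<^sup>+t. ennreal (exp (- t * s)) * indicator {p..q} s * indicator {0<..} t \<partial>lborel)
      = (\<integral>\<^sup>+t. (ennreal (exp (- t * s)) * indicator {0<..} t) * indicator {p..q} s \<partial>lborel)"
      by (simp add: mult_ac)
    also have "\<dots> = (\<integral>\<^sup>+t. ennreal (exp (- t * s)) * indicator {0<..} t \<partial>lborel) * indicator {p..q} s"
      by (rule nn_integral_multc) measurable
    also have "\<dots> = ennreal (1 / s) * indicator {p..q} s"
      using outer[of s] pq by (cases "s \<in> {p..q}") auto
    finally show "(\<integral>\<^sup>+t. ennreal (exp (- t * s)) * indicator {p..q} s * indicator {0<..} t \<partial>lborel) = ennreal (1 / s) * indicator {p..q} s" .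
  qed
  also have "\<dots> = ennreal (ln q - ln p)"
    by (rule nn_integral_FTC_Icc) (use pq in \<open>auto intro!: derivative_eq_intros simp: divide_simps\<close>)
  finally show ?thesis .
qed

text \<open>Frullani's integrand for \<open>p = d\<^sup>2\<close>, \<open>q = 1\<close>. Its integral writes the logarithmic kernel as a superposition of
Gaussian kernels, which are positive definite; the subtracted exponential does not depend on \<open>d\<close> and
disappears on measures of total mass \<open>0\<close>.\<close>

definition gauss_diff :: "real \<Rightarrow> real \<Rightarrow> real" where
  "gauss_diff d t = indicator {0<..} t * ((exp (- t * d\<^sup>2) - exp (- t)) / t)"

lemma gauss_diff_measurable [measurable]:
  "(\<lambda>(d, t). gauss_diff d t) \<in> borel_measurable (borel \<Otimes>\<^sub>M borel)"
  unfolding gauss_diff_def by measurable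

lemma nn_integral_gauss_diff:
  assumes "d \<noteq> 0"
  shows "(\<integral>\<^sup>+t. ennreal \<bar>gauss_diff d t\<bar> \<partial>lborel) = ennreal (2 * \<bar>ln \<bar>d\<bar>\<bar>)"
proof -
  have l: "ln (d\<^sup>2) = 2 * ln \<bar>d\<bar>" using ln_realpow[of "\<bar>d\<bar>" 2] assms by simp
  have d2: "0 < d\<^sup>2" using assms by simp
  show ?thesis
  proof (cases "d\<^sup>2 \<le> 1")
    case True
    hence "ln \<bar>d\<bar> \<le> 0" using l ln_le_cancel_iff[OF d2, of 1] by simp
    moreover have "ennreal \<bar>gauss_diff d t\<bar> = ennreal (indicator {0<..} t * ((exp (- t * d\<^sup>2) - exp (- t * 1)) / t))" for t
    proof -
      have "t > 0 \<Longrightarrow> t * d\<^sup>2 \<le> t" using True by (simp add: mult_left_le)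
      thus ?thesis unfolding gauss_diff_def by (auto simp: indicator_def)
    qed
    ultimately show ?thesis using nn_integral_frullani[OF d2 True] l by simp
  next
    case False
    hence d1: "1 \<le> d\<^sup>2" by simp
    hence "ln \<bar>d\<bar> \<ge> 0" using l ln_le_cancel_iff[of 1 "d\<^sup>2"] d2 by simp
    moreover have "ennreal \<bar>gauss_diff d t\<bar> = ennreal (indicator {0<..} t * ((exp (- t * 1) - exp (- t * d\<^sup>2)) / t))" for t
    proof -
      have "t > 0 \<Longrightarrow> t \<le> t * d\<^sup>2" using mult_left_mono[OF d1, of t] by simp
      thus ?thesis unfolding gauss_diff_def by (auto simp: indicator_def abs_if divide_simps)
    qed
    ultimately show ?thesis using nn_integral_frullani[OF _ d1] l by simp
  qed
qed

lemma has_integral_gauss_diff: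
  assumes "d \<noteq> 0"
  shows "has_bochner_integral lborel (gauss_diff d) (- 2 * ln \<bar>d\<bar>)"
proof -
  have i: "integrable lborel (gauss_diff d)"
    using nn_integral_gauss_diff[OF assms] by (intro integrableI_bounded) auto
  have d2: "0 < d\<^sup>2" using assms by simp
  have l: "ln (d\<^sup>2) = 2 * ln \<bar>d\<bar>" using ln_realpow[of "\<bar>d\<bar>" 2] assms by simp
  have "integral\<^sup>L lborel (gauss_diff d) = - 2 * ln \<bar>d\<bar>"
  proof (cases "d\<^sup>2 \<le> 1")
    case True
    hence "ln \<bar>d\<bar> \<le> 0" using l ln_le_cancel_iff[OF d2, of 1] by simp
    moreover have "t > 0 \<Longrightarrow> t * d\<^sup>2 \<le> t" for t using True by (simp add: mult_left_le)
    hence nn: "gauss_diff d t \<ge> 0" for t by (auto simp: gauss_diff_def indicator_def)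
    hence "ennreal (integral\<^sup>L lborel (gauss_diff d)) = ennreal (2 * \<bar>ln \<bar>d\<bar>\<bar>)"
      using nn_integral_gauss_diff[OF assms] nn_integral_eq_integral[OF i] by simp
    hence "integral\<^sup>L lborel (gauss_diff d) = 2 * \<bar>ln \<bar>d\<bar>\<bar>"
      using nn by (subst (asm) ennreal_inj) (auto intro!: integral_nonneg_AE)
    ultimately show ?thesis by simp
  next
    case False
    hence d1: "1 \<le> d\<^sup>2" by simp
    hence "ln \<bar>d\<bar> \<ge> 0" using l ln_le_cancel_iff[of 1 "d\<^sup>2"] d2 by simp
    moreover have "t > 0 \<Longrightarrow> t \<le> t * d\<^sup>2" for t using mult_left_mono[OF d1, of t] by simp
    hence nn: "- gauss_diff d t \<ge> 0" for t by (auto simp: gauss_diff_def indicator_def divide_nonpos_pos)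
    hence "\<bar>gauss_diff d t\<bar> = - gauss_diff d t" for t using nn[of t] by (simp only: abs_of_nonpos neg_0_le_iff_le)
    hence "ennreal (LBINT t. - gauss_diff d t) = ennreal (2 * \<bar>ln \<bar>d\<bar>\<bar>)"
      using nn_integral_gauss_diff[OF assms] nn_integral_eq_integral[of lborel "\<lambda>t. - gauss_diff d t"] i nn by simp
    hence "(LBINT t. - gauss_diff d t) = 2 * \<bar>ln \<bar>d\<bar>\<bar>"
      using nn by (subst (asm) ennreal_inj) (auto intro!: integral_nonneg_AE simp del: integral_minus)
    ultimately show ?thesis by simp
  qed
  with i show ?thesis by (simp add: has_bochner_integral_iff)
qed

definition gauss_energy :: "real measure \<Rightarrow> real measure \<Rightarrow> real \<Rightarrow> real" where
  "gauss_energy \<mu> \<nu> t = (\<integral>z. exp (- t * (fst z - snd z)\<^sup>2) \<partial>(\<mu> \<Otimes>\<^sub>M \<nu>))"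

definition log_inner :: "real measure \<Rightarrow> real measure \<Rightarrow> real" where
  "log_inner \<mu> \<nu> = - (\<integral>z. ln \<bar>fst z - snd z\<bar> \<partial>(\<mu> \<Otimes>\<^sub>M \<nu>))"

text \<open>Since \<open>ln 0 = 0\<close>, integrability of the real-valued kernel does not exclude mass on the diagonal, where the
true kernel is infinite.\<close>

definition log_compatible :: "real measure \<Rightarrow> real measure \<Rightarrow> bool" where
  "log_compatible \<mu> \<nu> \<longleftrightarrow> integrable (\<mu> \<Otimes>\<^sub>M \<nu>) (\<lambda>z. ln \<bar>fst z - snd z\<bar>) \<and>
     (AE z in \<mu> \<Otimes>\<^sub>M \<nu>. fst z \<noteq> snd z)"

definition finite_borel :: "real measure \<Rightarrow> bool" where
  "finite_borel \<mu> \<longleftrightarrow> finite_measure \<mu> \<and> sets \<mu> = sets borel"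

lemma finite_borel_pair:
  assumes "finite_borel \<mu>" "finite_borel \<nu>"
  shows "finite_measure (\<mu> \<Otimes>\<^sub>M \<nu>)" "sets (\<mu> \<Otimes>\<^sub>M \<nu>) = sets (borel \<Otimes>\<^sub>M borel)"
    "measure (\<mu> \<Otimes>\<^sub>M \<nu>) (space (\<mu> \<Otimes>\<^sub>M \<nu>)) = measure \<mu> UNIV * measure \<nu> UNIV"
    "pair_sigma_finite \<mu> \<nu>"
proof -
  interpret m: finite_measure \<mu> using assms by (simp add: finite_borel_def)
  interpret n: finite_measure \<nu> using assms by (simp add: finite_borel_def)
  interpret pair_sigma_finite \<mu> \<nu> ..
  have s: "sets \<mu> = sets borel" "sets \<nu> = sets borel" using assms by (auto simp: finite_borel_def)
  have sp: "space \<mu> = UNIV" "space \<nu> = UNIV" using s[THEN sets_eq_imp_space_eq] by auto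
  have e: "emeasure (\<mu> \<Otimes>\<^sub>M \<nu>) (UNIV \<times> UNIV) = emeasure \<mu> UNIV * emeasure \<nu> UNIV"
    using s by (intro n.emeasure_pair_measure_Times) auto
  show "finite_measure (\<mu> \<Otimes>\<^sub>M \<nu>)"
    using e m.emeasure_finite n.emeasure_finite
    by (intro finite_measureI) (simp add: space_pair_measure sp ennreal_mult_eq_top_iff)
  show "sets (\<mu> \<Otimes>\<^sub>M \<nu>) = sets (borel \<Otimes>\<^sub>M borel)" using s by (rule sets_pair_measure_cong)
  show "measure (\<mu> \<Otimes>\<^sub>M \<nu>) (space (\<mu> \<Otimes>\<^sub>M \<nu>)) = measure \<mu> UNIV * measure \<nu> UNIV"
    using e by (simp add: measure_def space_pair_measure sp enn2real_mult)
  show "pair_sigma_finite \<mu> \<nu>" ..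
qed

lemma gauss_energy_log_inner:
  assumes fin: "finite_borel \<mu>" "finite_borel \<nu>" and lc: "log_compatible \<mu> \<nu>"
  shows "has_bochner_integral lborel
    (\<lambda>t. indicator {0<..} t * ((gauss_energy \<mu> \<nu> t - measure \<mu> UNIV * measure \<nu> UNIV * exp (- t)) / t))
    (2 * log_inner \<mu> \<nu>)"
proof -
  note [measurable_cong] = finite_borel_pair(2)[OF fin]
  let ?P = "\<mu> \<Otimes>\<^sub>M \<nu>"
  interpret P: finite_measure ?P by (rule finite_borel_pair(1)[OF fin])
  interpret PL: pair_sigma_finite ?P "lborel :: real measure" ..
  let ?f = "\<lambda>(z, t). gauss_diff (fst z - snd z) t"
  have meas: "?f \<in> borel_measurable (?P \<Otimes>\<^sub>M lborel)" unfolding gauss_diff_def by measurable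
  have ae: "AE z in ?P. fst z - snd z \<noteq> 0" using lc by (auto simp: log_compatible_def)
  have norm_int: "(LBINT t. norm (?f (z, t))) = 2 * \<bar>ln \<bar>fst z - snd z\<bar>\<bar>" if "fst z - snd z \<noteq> 0" for z
  proof -
    have "has_bochner_integral lborel (\<lambda>t. \<bar>gauss_diff (fst z - snd z) t\<bar>) (2 * \<bar>ln \<bar>fst z - snd z\<bar>\<bar>)"
      by (intro has_bochner_integral_nn_integral nn_integral_gauss_diff that) auto
    thus ?thesis by (simp add: has_bochner_integral_iff)
  qed
  have Fi: "integrable (?P \<Otimes>\<^sub>M lborel) ?f"
  proof (rule PL.Fubini_integrable[OF meas])
    have i: "integrable ?P (\<lambda>z. 2 * \<bar>ln \<bar>fst z - snd z\<bar>\<bar>)"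
      using lc by (auto simp: log_compatible_def)
    have e: "AE z in ?P. 2 * \<bar>ln \<bar>fst z - snd z\<bar>\<bar> = (LBINT t. norm (?f (z, t)))"
      using ae by eventually_elim (use norm_int in simp)
    have m: "(\<lambda>z. LBINT t. norm (?f (z, t))) \<in> borel_measurable ?P"
      unfolding gauss_diff_def by measurable
    show "integrable ?P (\<lambda>z. LBINT t. norm (?f (z, t)))"
      by (rule integrable_cong_AE_imp[OF i m e])
    show "AE z in ?P. integrable lborel (\<lambda>t. ?f (z, t))"
      using ae by eventually_elim (use has_integral_gauss_diff in \<open>auto simp: has_bochner_integral_iff\<close>)
  qed
  have inner: "(\<integral>z. gauss_diff (fst z - snd z) t \<partial>?P) =
    indicator {0<..} t * ((gauss_energy \<mu> \<nu> t - measure \<mu> UNIV * measure \<nu> UNIV * exp (- t)) / t)" for t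
  proof (cases "t > 0")
    case True
    have i: "integrable ?P (\<lambda>z. exp (- t * (fst z - snd z)\<^sup>2))"
      using True by (intro P.integrable_const_bound[where B = 1]) auto
    have "(\<integral>z. gauss_diff (fst z - snd z) t \<partial>?P) = (\<integral>z. (exp (- t * (fst z - snd z)\<^sup>2) - exp (- t)) / t \<partial>?P)"
      using True by (simp add: gauss_diff_def)
    also have "\<dots> = (gauss_energy \<mu> \<nu> t - (\<integral>z. exp (- t) \<partial>?P)) / t"
      using i by (simp add: gauss_energy_def)
    also have "(\<integral>z. exp (- t) \<partial>?P) = measure \<mu> UNIV * measure \<nu> UNIV * exp (- t)"
      using finite_borel_pair(3)[OF fin] by simp
    finally show ?thesis using True by simp
  qed (simp add: gauss_diff_def)
  have "integrable lborel (\<lambda>t. \<integral>z. gauss_diff (fst z - snd z) t \<partial>?P)"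
    by (rule PL.integrable_snd[OF Fi])
  moreover have "(LBINT t. \<integral>z. gauss_diff (fst z - snd z) t \<partial>?P) = (\<integral>z. (LBINT t. gauss_diff (fst z - snd z) t) \<partial>?P)"
    using PL.Fubini_integral[of "\<lambda>z t. gauss_diff (fst z - snd z) t"] Fi by simp
  moreover have "(\<integral>z. (LBINT t. gauss_diff (fst z - snd z) t) \<partial>?P) = (\<integral>z. - 2 * ln \<bar>fst z - snd z\<bar> \<partial>?P)"
  proof (rule integral_cong_AE)
    show "(\<lambda>z. LBINT t. gauss_diff (fst z - snd z) t) \<in> borel_measurable ?P" using meas by measurable
    show "AE z in ?P. (LBINT t. gauss_diff (fst z - snd z) t) = - 2 * ln \<bar>fst z - snd z\<bar>"
      using ae by eventually_elim (use has_integral_gauss_diff in \<open>auto simp: has_bochner_integral_iff\<close>)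
  qed measurable
  ultimately show ?thesis by (simp add: has_bochner_integral_iff inner log_inner_def)
qed

lemma finite_borelD:
  assumes "finite_borel \<mu>"
  shows "finite_measure \<mu>" "sets \<mu> = sets borel" "space \<mu> = UNIV"
  using assms sets_eq_imp_space_eq[of \<mu> borel] by (auto simp: finite_borel_def)

lemma char_measurable_finite [measurable]:
  assumes "finite_borel \<mu>"
  shows "char \<mu> \<in> borel_measurable borel"
proof -
  interpret finite_measure \<mu> using assms by (rule finite_borelD)
  note [measurable_cong] = finite_borelD(2)[OF assms]
  show ?thesis unfolding char_def by measurable
qed

lemma continuous_char_finite:
  assumes "finite_borel \<mu>"
  shows "continuous_on UNIV (char \<mu>)"
proof -
  interpret finite_measure \<mu> using assms by (rule finite_borelD)
  note [measurable_cong] = finite_borelD(2)[OF assms]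
  have "isCont (char \<mu>) t" for t
    unfolding continuous_at_sequentially comp_def char_def
  proof safe
    fix X assume X: "X \<longlonglongrightarrow> t"
    show "(\<lambda>n. CLINT x|\<mu>. iexp (X n * x)) \<longlonglongrightarrow> (CLINT x|\<mu>. iexp (t * x))"
    proof (rule integral_dominated_convergence[where w = "\<lambda>_. 1"])
      show "AE x in \<mu>. (\<lambda>n. iexp (X n * x)) \<longlonglongrightarrow> iexp (t * x)"
        using X by (auto intro!: tendsto_intros)
    qed auto
  qed
  thus ?thesis by (simp add: continuous_on_eq_continuous_at)
qed

lemma norm_char_finite:
  assumes "finite_borel \<mu>"
  shows "norm (char \<mu> t) \<le> measure \<mu> UNIV"
proof -
  interpret finite_measure \<mu> using assms by (rule finite_borelD)
  have "norm (char \<mu> t) \<le> (\<integral>x. norm (iexp (t * x)) \<partial>\<mu>)" unfolding char_def by (rule integral_norm_bound)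
  thus ?thesis using finite_borelD(3)[OF assms] by simp
qed

text \<open>The Gaussian is the characteristic function of a normal law. Integrating over this law last turns the
Gaussian kernel into the product of the two characteristic functions.\<close>

lemma gauss_energy_char:
  assumes fin: "finite_borel \<mu>" "finite_borel \<nu>" and t: "t > 0"
  shows "gauss_energy \<mu> \<nu> t =
    (\<integral>s. (char \<mu> (sqrt (2 * t) * s)) \<bullet> (char \<nu> (sqrt (2 * t) * s)) \<partial>std_normal_distribution)"
proof -
  note [measurable_cong] = finite_borel_pair(2)[OF fin]
  let ?P = "\<mu> \<Otimes>\<^sub>M \<nu>" and ?N = "std_normal_distribution" and ?w = "sqrt (2 * t)"
  interpret mn: pair_sigma_finite \<mu> \<nu> by (rule finite_borel_pair(4)[OF fin])
  interpret P: finite_measure ?P by (rule finite_borel_pair(1)[OF fin])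
  interpret N: real_distribution ?N by (rule real_dist_normal_dist)
  interpret PN: pair_sigma_finite ?P ?N ..
  interpret PNf: finite_measure "?P \<Otimes>\<^sub>M ?N"
    by (rule finite_measure_pair_measure) unfold_locales
  have 1: "exp (- t * d\<^sup>2) = (\<integral>s. cos (?w * s * d) \<partial>?N)" for d
  proof -
    have "complex_of_real (exp (- t * d\<^sup>2)) = char ?N (?w * d)"
      using t by (simp add: char_std_normal_distribution power_mult_distrib)
    hence "exp (- t * d\<^sup>2) = Re (char ?N (?w * d))" by (metis Re_complex_of_real)
    also have "\<dots> = (\<integral>s. Re (iexp (?w * d * s)) \<partial>?N)"
      unfolding char_def by (rule integral_Re[symmetric]) (intro N.integrable_iexp; simp)
    also have "\<dots> = (\<integral>s. cos (?w * s * d) \<partial>?N)"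
      by (simp add: mult_ac Re_exp)
    finally show ?thesis .
  qed
  have "gauss_energy \<mu> \<nu> t = (\<integral>z. \<integral>s. cos (?w * s * (fst z - snd z)) \<partial>?N \<partial>?P)"
    unfolding gauss_energy_def 1 ..
  also have "\<dots> = (\<integral>s. \<integral>z. cos (?w * s * (fst z - snd z)) \<partial>?P \<partial>?N)"
    by (rule PN.Fubini_integral[symmetric]) 
       (auto intro!: PNf.integrable_const_bound[where B = 1] AE_I2 simp: split_beta')
  also have "\<dots> = (\<integral>s. (char \<mu> (?w * s)) \<bullet> (char \<nu> (?w * s)) \<partial>?N)"
  proof (intro Bochner_Integration.integral_cong refl)
    fix s
    let ?u = "?w * s"
    have i: "integrable ?P (\<lambda>(x, y). iexp (?u * x) * cnj (iexp (?u * y)))"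
    proof (rule P.integrable_const_bound[where B = 1])
      have [measurable]: "cnj \<in> borel_measurable borel"
        by (intro borel_measurable_continuous_onI continuous_intros)
      show "(\<lambda>(x, y). iexp (?u * x) * cnj (iexp (?u * y))) \<in> borel_measurable ?P" by measurable
    qed (auto simp: norm_mult)
    have "cos (?u * (x - y)) = Re (iexp (?u * x) * cnj (iexp (?u * y)))" for x y
    proof -
      have "iexp (?u * x) * cnj (iexp (?u * y)) = iexp (?u * (x - y))"
        by (simp add: exp_cnj exp_add[symmetric] algebra_simps)
      thus ?thesis by (simp add: Re_exp)
    qed
    hence "(\<integral>z. cos (?u * (fst z - snd z)) \<partial>?P) = (\<integral>z. Re ((\<lambda>(x, y). iexp (?u * x) * cnj (iexp (?u * y))) z) \<partial>?P)"
      by (simp add: split_beta')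
    also have "\<dots> = Re (\<integral>z. (\<lambda>(x, y). iexp (?u * x) * cnj (iexp (?u * y))) z \<partial>?P)"
      by (rule integral_Re[OF i])
    also have "(\<integral>z. (\<lambda>(x, y). iexp (?u * x) * cnj (iexp (?u * y))) z \<partial>?P) =
        (\<integral>x. \<integral>y. iexp (?u * x) * cnj (iexp (?u * y)) \<partial>\<nu> \<partial>\<mu>)"
      using mn.integral_fst'[OF i] by simp
    also have "\<dots> = char \<mu> ?u * cnj (char \<nu> ?u)"
      by (simp add: char_def)
    finally show "(\<integral>z. cos (?u * (fst z - snd z)) \<partial>?P) = char \<mu> ?u \<bullet> char \<nu> ?u"
      by (simp add: inner_complex_def)
  qed
  finally show ?thesis .
qed

text \<open>Levy's uniqueness theorem, applied after division by the common mass, which is the value of the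
characteristic functions at \<open>0\<close>.\<close>

lemma finite_borel_eqI_char:
  assumes fin: "finite_borel \<mu>" "finite_borel \<nu>" and eq: "char \<mu> = char \<nu>"
  shows "\<mu> = \<nu>"
proof -
  interpret m: finite_measure \<mu> using fin by (auto dest: finite_borelD)
  interpret n: finite_measure \<nu> using fin by (auto dest: finite_borelD)
  note s = finite_borelD(2)[OF fin(1)] finite_borelD(2)[OF fin(2)]
  note sp = finite_borelD(3)[OF fin(1)] finite_borelD(3)[OF fin(2)]
  note [measurable_cong] = s
  have "char \<mu> 0 = measure \<mu> UNIV" "char \<nu> 0 = measure \<nu> UNIV" by (simp_all add: char_def sp scaleR_conv_of_real)
  hence meq: "measure \<mu> UNIV = measure \<nu> UNIV" using eq by simp
  define c where "c = measure \<mu> UNIV"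
  show ?thesis
  proof (cases "c = 0")
    case True
    have "emeasure \<mu> A = emeasure \<nu> A" if "A \<in> sets \<mu>" for A
    proof -
      have "measure \<mu> A \<le> c" "measure \<nu> A \<le> c"
        using m.bounded_measure[of A] n.bounded_measure[of A] meq sp by (auto simp: c_def)
      hence "measure \<mu> A = 0" "measure \<nu> A = 0" using True by (auto simp: measure_le_0_iff)
      thus ?thesis by (simp add: m.emeasure_eq_measure n.emeasure_eq_measure)
    qed
    thus ?thesis using s by (intro measure_eqI) auto
  next
    case False
    hence c: "c > 0" by (simp add: c_def zero_less_measure_iff less_le)
    have d: "real_distribution (density M (\<lambda>_. ennreal (1 / c)))"
            "char (density M (\<lambda>_. ennreal (1 / c))) = (\<lambda>t. (1 / c) *\<^sub>R char M t)"
      if M: "finite_borel M" "measure M UNIV = c" for M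
    proof -
      interpret M: finite_measure M using M by (auto dest: finite_borelD)
      note [measurable_cong] = finite_borelD(2)[OF M(1)]
      note spM = finite_borelD(3)[OF M(1)]
      have "prob_space (density M (\<lambda>_. ennreal (1 / c)))"
      proof (rule prob_spaceI)
        have "emeasure M UNIV = ennreal c" using M by (simp add: M.emeasure_eq_measure)
        thus "emeasure (density M (\<lambda>_. ennreal (1 / c))) (space (density M (\<lambda>_. ennreal (1 / c)))) = 1"
          using c finite_borelD(2)[OF M(1)] by (simp add: emeasure_density_const spM ennreal_mult[symmetric])
      qed
      thus "real_distribution (density M (\<lambda>_. ennreal (1 / c)))"
        using finite_borelD(2)[OF M(1)] spM by (simp add: real_distribution_def real_distribution_axioms_def)
      show "char (density M (\<lambda>_. ennreal (1 / c))) = (\<lambda>t. (1 / c) *\<^sub>R char M t)"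
        using c by (simp add: char_def fun_eq_iff integral_density)
    qed
    have "density \<mu> (\<lambda>_. ennreal (1 / c)) = density \<nu> (\<lambda>_. ennreal (1 / c))"
      using d[OF fin(1)] d[OF fin(2)] meq eq by (intro Levy_uniqueness) (auto simp: c_def)
    hence "ennreal (1 / c) * emeasure \<mu> A = ennreal (1 / c) * emeasure \<nu> A" if "A \<in> sets borel" for A
      using that s by (metis emeasure_density_const)
    hence "emeasure \<mu> A = emeasure \<nu> A" if "A \<in> sets borel" for A
      using that c by (metis ennreal_mult_cancel_left ennreal_eq_0_iff ennreal_neq_top divide_le_0_1_iff not_le)
    thus ?thesis using s by (intro measure_eqI) auto
  qed
qed

lemma integrable_char_product:
  assumes "finite_borel \<mu>" "finite_borel \<nu>"
  shows "integrable std_normal_distribution (\<lambda>s. (char \<mu> (w * s)) \<bullet> (char \<nu> (w * s)))"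
proof -
  interpret N: real_distribution std_normal_distribution by (rule real_dist_normal_dist)
  note [measurable] = char_measurable_finite[OF assms(1)] char_measurable_finite[OF assms(2)]
  show ?thesis
  proof (rule N.integrable_const_bound[where B = "measure \<mu> UNIV * measure \<nu> UNIV"])
    show "AE s in std_normal_distribution. norm ((char \<mu> (w * s)) \<bullet> (char \<nu> (w * s))) \<le> measure \<mu> UNIV * measure \<nu> UNIV"
    proof (rule AE_I2)
      fix s
      have "norm ((char \<mu> (w * s)) \<bullet> (char \<nu> (w * s))) \<le> norm (char \<mu> (w * s)) * norm (char \<nu> (w * s))"
        by (simp add: Cauchy_Schwarz_ineq2)
      also have "\<dots> \<le> measure \<mu> UNIV * measure \<nu> UNIV"
        by (intro mult_mono norm_char_finite assms) auto
      finally show "norm ((char \<mu> (w * s)) \<bullet> (char \<nu> (w * s))) \<le> measure \<mu> UNIV * measure \<nu> UNIV" .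
    qed
  qed simp
qed

text \<open>The mutual energy of the signed measures \<open>\<mu> - \<mu>'\<close> and \<open>\<nu> - \<nu>'\<close>.\<close>

definition diff_inner :: "real measure \<Rightarrow> real measure \<Rightarrow> real measure \<Rightarrow> real measure \<Rightarrow> real" where
  "diff_inner \<mu> \<mu>' \<nu> \<nu>' = log_inner \<mu> \<nu> - log_inner \<mu> \<nu>' - log_inner \<mu>' \<nu> + log_inner \<mu>' \<nu>'"

text \<open>In the combination of the four integrals the terms with \<open>exp (- t)\<close> cancel, because the differences have
mass \<open>0\<close>; what is left is the Gaussian energy of the differences.\<close>

lemma diff_inner_char:
  assumes fin: "finite_borel \<mu>" "finite_borel \<mu>'" "finite_borel \<nu>" "finite_borel \<nu>'"
    and mass: "measure \<mu> UNIV = measure \<mu>' UNIV" "measure \<nu> UNIV = measure \<nu>' UNIV"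
    and lc: "log_compatible \<mu> \<nu>" "log_compatible \<mu> \<nu>'" "log_compatible \<mu>' \<nu>" "log_compatible \<mu>' \<nu>'"
  defines "c \<equiv> \<lambda>s. char \<mu> s - char \<mu>' s" and "d \<equiv> \<lambda>s. char \<nu> s - char \<nu>' s"
  shows "has_bochner_integral lborel
    (\<lambda>t. indicator {0<..} t * ((\<integral>s. (c (sqrt (2 * t) * s)) \<bullet> (d (sqrt (2 * t) * s)) \<partial>std_normal_distribution) / t))
    (2 * diff_inner \<mu> \<mu>' \<nu> \<nu>')"
proof -
  let ?e = "\<lambda>\<mu> \<nu> t. indicator {0<..} t * ((gauss_energy \<mu> \<nu> t - measure \<mu> UNIV * measure \<nu> UNIV * exp (- t)) / t)"
  have "has_bochner_integral lborel (\<lambda>t. ?e \<mu> \<nu> t - ?e \<mu> \<nu>' t - ?e \<mu>' \<nu> t + ?e \<mu>' \<nu>' t)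
    (2 * log_inner \<mu> \<nu> - 2 * log_inner \<mu> \<nu>' - 2 * log_inner \<mu>' \<nu> + 2 * log_inner \<mu>' \<nu>')"
    by (intro has_bochner_integral_add has_bochner_integral_diff gauss_energy_log_inner fin lc)
  also have "2 * log_inner \<mu> \<nu> - 2 * log_inner \<mu> \<nu>' - 2 * log_inner \<mu>' \<nu> + 2 * log_inner \<mu>' \<nu>' = 2 * diff_inner \<mu> \<mu>' \<nu> \<nu>'"
    by (simp add: diff_inner_def)
  also have "(\<lambda>t. ?e \<mu> \<nu> t - ?e \<mu> \<nu>' t - ?e \<mu>' \<nu> t + ?e \<mu>' \<nu>' t) =
    (\<lambda>t. indicator {0<..} t * ((\<integral>s. (c (sqrt (2 * t) * s)) \<bullet> (d (sqrt (2 * t) * s)) \<partial>std_normal_distribution) / t))"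
  proof (rule ext)
    fix t :: real
    show "?e \<mu> \<nu> t - ?e \<mu> \<nu>' t - ?e \<mu>' \<nu> t + ?e \<mu>' \<nu>' t =
      indicator {0<..} t * ((\<integral>s. (c (sqrt (2 * t) * s)) \<bullet> (d (sqrt (2 * t) * s)) \<partial>std_normal_distribution) / t)"
    proof (cases "t > 0")
      case True
      let ?w = "sqrt (2 * t)"
      let ?r = "\<lambda>\<mu> \<nu> s. (char \<mu> (?w * s)) \<bullet> (char \<nu> (?w * s))"
      have "(c (?w * s)) \<bullet> (d (?w * s)) = ?r \<mu> \<nu> s - ?r \<mu> \<nu>' s - ?r \<mu>' \<nu> s + ?r \<mu>' \<nu>' s" for s
        by (simp add: c_def d_def inner_diff_left inner_diff_right)
      hence "(\<integral>s. (c (?w * s)) \<bullet> (d (?w * s)) \<partial>std_normal_distribution) =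
        (\<integral>s. ?r \<mu> \<nu> s - ?r \<mu> \<nu>' s - ?r \<mu>' \<nu> s + ?r \<mu>' \<nu>' s \<partial>std_normal_distribution)" by presburger
      also have "\<dots> = (\<integral>s. ?r \<mu> \<nu> s \<partial>std_normal_distribution) - (\<integral>s. ?r \<mu> \<nu>' s \<partial>std_normal_distribution)
         - (\<integral>s. ?r \<mu>' \<nu> s \<partial>std_normal_distribution) + (\<integral>s. ?r \<mu>' \<nu>' s \<partial>std_normal_distribution)"
        by (intro has_bochner_integral_integral_eq has_bochner_integral_add has_bochner_integral_diff
            has_bochner_integral_integrable integrable_char_product fin)
      also have "\<dots> = gauss_energy \<mu> \<nu> t - gauss_energy \<mu> \<nu>' t - gauss_energy \<mu>' \<nu> t + gauss_energy \<mu>' \<nu>' t"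
        using fin True by (simp add: gauss_energy_char)
      finally show ?thesis using True mass by (simp add: diff_divide_distrib add_divide_distrib)
    qed simp
  qed
  finally show ?thesis .
qed

text \<open>The Cartan matrix of type \<open>A\<close>, written as a sum of squares; the two boundary terms make it definite.\<close>

lemma tridiagonal_form:
  fixes c :: "nat \<Rightarrow> complex"
  shows "(\<Sum>j<Suc n. (norm (c j))\<^sup>2) - (\<Sum>j<n. (c j) \<bullet> (c (j + 1)))
    = ((norm (c 0))\<^sup>2 + (norm (c n))\<^sup>2 + (\<Sum>j<n. (norm (c j - c (j + 1)))\<^sup>2)) / 2"
proof (induction n)
  case (Suc n)
  have "(norm (c n - c (Suc n)))\<^sup>2 = (norm (c n))\<^sup>2 + (norm (c (Suc n)))\<^sup>2 - 2 * (c n \<bullet> c (Suc n))"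
    by (simp add: power2_norm_eq_inner inner_diff_left inner_diff_right inner_commute)
  with Suc show ?case by (simp add: field_simps)
qed simp

lemma tridiagonal_form_nonneg:
  fixes c :: "nat \<Rightarrow> complex"
  assumes "r \<ge> 1"
  shows "(\<Sum>j<r. (c j) \<bullet> (c j)) - (\<Sum>j<r - 1. (c j) \<bullet> (c (j + 1))) \<ge> 0"
    and "(\<Sum>j<r. (c j) \<bullet> (c j)) - (\<Sum>j<r - 1. (c j) \<bullet> (c (j + 1))) = 0 \<Longrightarrow> j < r \<Longrightarrow> c j = 0"
proof -
  obtain n where n: "r = Suc n" using assms by (cases r) auto
  let ?S = "\<Sum>j<n. (norm (c j - c (j + 1)))\<^sup>2"
  have e: "(\<Sum>j<r. (c j) \<bullet> (c j)) - (\<Sum>j<r - 1. (c j) \<bullet> (c (j + 1)))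
     = ((norm (c 0))\<^sup>2 + (norm (c n))\<^sup>2 + ?S) / 2"
    using tridiagonal_form[of c n] n by (simp add: power2_norm_eq_inner)
  have S: "?S \<ge> 0" by (intro sum_nonneg) auto
  show "(\<Sum>j<r. (c j) \<bullet> (c j)) - (\<Sum>j<r - 1. (c j) \<bullet> (c (j + 1))) \<ge> 0"
    unfolding e using S by simp
  assume "(\<Sum>j<r. (c j) \<bullet> (c j)) - (\<Sum>j<r - 1. (c j) \<bullet> (c (j + 1))) = 0" and "j < r"
  hence z: "(norm (c 0))\<^sup>2 + (norm (c n))\<^sup>2 + ?S = 0" unfolding e by simp
  have "(norm (c 0))\<^sup>2 = 0" "?S = 0"
    using z S zero_le_power2[of "norm (c 0)"] zero_le_power2[of "norm (c n)"] by linarith+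
  hence "c 0 = 0" and "\<forall>j\<in>{..<n}. (norm (c j - c (j + 1)))\<^sup>2 = 0"
    by (auto simp: sum_nonneg_eq_0_iff)
  hence step: "c (Suc j) = c j" if "j < n" for j using that by auto
  have "c j = 0" if "j \<le> n" for j using that
    by (induction j) (use \<open>c 0 = 0\<close> step in auto)
  thus "c j = 0" using \<open>j < r\<close> n by simp
qed

lemma AE_continuous_zero:
  fixes h :: "real \<Rightarrow> real"
  assumes "continuous_on UNIV h" "AE x in lborel. h x = 0"
  shows "h x = 0"
proof (rule ccontr)
  assume "h x \<noteq> 0"
  have op: "open {x. h x \<noteq> 0}" using assms(1) by (intro open_Collect_neq continuous_on_const) auto
  hence "{x. h x \<noteq> 0} \<in> null_sets lborel"
    using assms(2) borel_open[OF op] by (simp add: AE_iff_null)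
  hence "negligible {x. h x \<noteq> 0}"
    using null_sets_completionI negligible_iff_null_sets by blast
  thus False using op open_not_negligible \<open>h x \<noteq> 0\<close> by blast
qed

text \<open>By \<open>diff_inner_char\<close> the form \<open>Q\<close> is an integral over \<open>t > 0\<close> of Gaussian averages of the tridiagonal form in
the differences of the characteristic functions. If it vanishes, then so does the average for some \<open>t\<close>.
The integrand is nonnegative and continuous, so it is zero everywhere, and a single \<open>t\<close> already reaches
all arguments of the characteristic functions.\<close>

proposition nikishin_form_pos_def:
  fixes \<mu> \<nu> :: "nat \<Rightarrow> real measure"
  assumes r: "r \<ge> 1"
    and fin: "\<And>j. j < r \<Longrightarrow> finite_borel (\<mu> j)" "\<And>j. j < r \<Longrightarrow> finite_borel (\<nu> j)"
    and mass: "\<And>j. j < r \<Longrightarrow> measure (\<mu> j) UNIV = measure (\<nu> j) UNIV"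
    and lc: "\<And>i j. i < r \<Longrightarrow> j < r \<Longrightarrow> log_compatible (\<mu> i) (\<mu> j)"
            "\<And>i j. i < r \<Longrightarrow> j < r \<Longrightarrow> log_compatible (\<mu> i) (\<nu> j)"
            "\<And>i j. i < r \<Longrightarrow> j < r \<Longrightarrow> log_compatible (\<nu> i) (\<mu> j)"
            "\<And>i j. i < r \<Longrightarrow> j < r \<Longrightarrow> log_compatible (\<nu> i) (\<nu> j)"
  defines "Q \<equiv> (\<Sum>j<r. diff_inner (\<mu> j) (\<nu> j) (\<mu> j) (\<nu> j)) - (\<Sum>j<r - 1. diff_inner (\<mu> j) (\<nu> j) (\<mu> (j + 1)) (\<nu> (j + 1)))"
  shows "Q \<ge> 0" and "Q = 0 \<Longrightarrow> j < r \<Longrightarrow> \<mu> j = \<nu> j"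
proof -
  define c where "c j s = char (\<mu> j) s - char (\<nu> j) s" for j s
  define q where "q s = (\<Sum>j<r. (c j s) \<bullet> (c j s)) - (\<Sum>j<r - 1. (c j s) \<bullet> (c (j + 1) s))" for s
  define J where "J t = (\<integral>s. q (sqrt (2 * t) * s) \<partial>std_normal_distribution)" for t
  interpret N: real_distribution std_normal_distribution by (rule real_dist_normal_dist)
  have q_nonneg: "q s \<ge> 0" for s unfolding q_def by (rule tridiagonal_form_nonneg[OF r])
  have cint: "integrable std_normal_distribution (\<lambda>s. (c i (w * s)) \<bullet> (c j (w * s)))" if "i < r" "j < r" for i j w
  proof -
    have "(\<lambda>s. (c i (w * s)) \<bullet> (c j (w * s))) = (\<lambda>s. (char (\<mu> i) (w * s)) \<bullet> (char (\<mu> j) (w * s))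
      - (char (\<mu> i) (w * s)) \<bullet> (char (\<nu> j) (w * s)) - (char (\<nu> i) (w * s)) \<bullet> (char (\<mu> j) (w * s))
      + (char (\<nu> i) (w * s)) \<bullet> (char (\<nu> j) (w * s)))"
      by (rule ext) (simp add: c_def inner_diff_left inner_diff_right)
    thus ?thesis using fin that
      by (auto intro!: Bochner_Integration.integrable_add Bochner_Integration.integrable_diff integrable_char_product)
  qed
  have q_int: "integrable std_normal_distribution (\<lambda>s. q (w * s))" for w
    unfolding q_def using cint
    by (intro Bochner_Integration.integrable_diff Bochner_Integration.integrable_sum) auto
  have J_eq: "J t = (\<Sum>j<r. \<integral>s. (c j (sqrt (2 * t) * s)) \<bullet> (c j (sqrt (2 * t) * s)) \<partial>std_normal_distribution)
      - (\<Sum>j<r - 1. \<integral>s. (c j (sqrt (2 * t) * s)) \<bullet> (c (j + 1) (sqrt (2 * t) * s)) \<partial>std_normal_distribution)" for t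
    unfolding J_def q_def using cint
    by (intro has_bochner_integral_integral_eq has_bochner_integral_diff has_bochner_integral_sum
        has_bochner_integral_integrable) auto
  have "has_bochner_integral lborel (\<lambda>t. (\<Sum>j<r. indicator {0<..} t * ((\<integral>s. (c j (sqrt (2 * t) * s)) \<bullet> (c j (sqrt (2 * t) * s)) \<partial>std_normal_distribution) / t))
      - (\<Sum>j<r - 1. indicator {0<..} t * ((\<integral>s. (c j (sqrt (2 * t) * s)) \<bullet> (c (j + 1) (sqrt (2 * t) * s)) \<partial>std_normal_distribution) / t)))
     ((\<Sum>j<r. 2 * diff_inner (\<mu> j) (\<nu> j) (\<mu> j) (\<nu> j)) - (\<Sum>j<r - 1. 2 * diff_inner (\<mu> j) (\<nu> j) (\<mu> (j + 1)) (\<nu> (j + 1))))"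
    unfolding c_def
    by (intro has_bochner_integral_diff has_bochner_integral_sum diff_inner_char fin mass lc) auto
  also have "(\<Sum>j<r. 2 * diff_inner (\<mu> j) (\<nu> j) (\<mu> j) (\<nu> j)) - (\<Sum>j<r - 1. 2 * diff_inner (\<mu> j) (\<nu> j) (\<mu> (j + 1)) (\<nu> (j + 1))) = 2 * Q"
    by (simp add: Q_def sum_distrib_left[symmetric])
  also have "(\<lambda>t. (\<Sum>j<r. indicator {0<..} t * ((\<integral>s. (c j (sqrt (2 * t) * s)) \<bullet> (c j (sqrt (2 * t) * s)) \<partial>std_normal_distribution) / t))
      - (\<Sum>j<r - 1. indicator {0<..} t * ((\<integral>s. (c j (sqrt (2 * t) * s)) \<bullet> (c (j + 1) (sqrt (2 * t) * s)) \<partial>std_normal_distribution) / t)))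
      = (\<lambda>t. indicator {0<..} t * (J t / t))"
    unfolding J_eq by (simp add: sum_distrib_left sum_divide_distrib diff_divide_distrib right_diff_distrib)
  finally have hb: "has_bochner_integral lborel (\<lambda>t. indicator {0<..} t * (J t / t)) (2 * Q)" .
  have J_nonneg: "J t \<ge> 0" for t unfolding J_def by (intro integral_nonneg_AE AE_I2 q_nonneg)
  have nn: "indicator {0<..} t * (J t / t) \<ge> 0" for t using J_nonneg by (simp add: indicator_def)
  have "0 \<le> (LBINT t. indicator {0<..} t * (J t / t))" by (intro integral_nonneg_AE AE_I2 nn)
  hence "0 \<le> 2 * Q" unfolding has_bochner_integral_integral_eq[OF hb] .
  thus "Q \<ge> 0" by simp
  assume "Q = 0" and j: "j < r"
  hence "AE t in lborel. indicator {0<..} t * (J t / t) = 0"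
    using hb nn integral_nonneg_eq_0_iff_AE[of lborel "\<lambda>t. indicator {0<..} t * (J t / t)"]
    by (simp add: has_bochner_integral_iff)
  hence "AE t in lborel. t > 0 \<longrightarrow> J t = 0" by eventually_elim (auto simp: indicator_def)
  then obtain t where t: "t > 0" "J t = 0"
  proof -
    assume *: "AE t in lborel. t > 0 \<longrightarrow> J t = 0"
    have "\<exists>t>0. J t = 0"
    proof (rule ccontr)
      assume "\<not> (\<exists>t>0. J t = 0)"
      with * have "AE t::real in lborel. \<not> (0 < t \<and> t < 1)" by (auto elim: eventually_mono)
      hence "{0<..<1::real} \<in> null_sets lborel" by (subst (asm) AE_iff_null) (auto simp: greaterThanLessThan_def greaterThan_def lessThan_def Int_def)
      thus False by (simp add: null_sets_def)
    qed
    thus ?thesis using that by blast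
  qed
  let ?w = "sqrt (2 * t)"
  have "AE s in std_normal_distribution. q (?w * s) = 0"
    using t(2) integral_nonneg_eq_0_iff_AE[OF q_int[of ?w]] q_nonneg by (simp add: J_def)
  hence "AE s in lborel. q (?w * s) = 0"
    by (subst (asm) AE_density) (auto simp: normal_density_pos)
  moreover have cc: "continuous_on UNIV (\<lambda>s. char M (?w * s))" if "finite_borel M" for M
    by (rule continuous_on_compose2[OF continuous_char_finite[OF that]]) (auto intro!: continuous_intros)
  have "continuous_on UNIV (\<lambda>s. q (?w * s))"
    unfolding q_def c_def by (intro continuous_intros cc) (use fin in auto)
  ultimately have "q (?w * s) = 0" for s using AE_continuous_zero[of "\<lambda>s. q (?w * s)"] by blast
  \<comment> \<open>The scaling by \<open>?w > 0\<close> is onto, so every argument is reached.\<close>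
  from this[of "s / ?w" for s] have "q s = 0" for s using t by simp
  hence "c j s = 0" for s using tridiagonal_form_nonneg(2)[OF r, of "\<lambda>j. c j s" j] j unfolding q_def by blast
  hence "char (\<mu> j) = char (\<nu> j)" by (auto simp: c_def)
  thus "\<mu> j = \<nu> j" using fin j by (intro finite_borel_eqI_char) auto
qed

section \<open>Measures of finite logarithmic energy\<close>

lemma log_kernel_eq: "x \<noteq> y \<Longrightarrow> log_kernel x y = ereal (- ln \<bar>x - y\<bar>)"
  by (simp add: log_kernel_def ln_div)

lemma finite_log_energy_iff:
  assumes fin: "finite_borel \<mu>"
  shows "finite_log_energy \<mu> \<longleftrightarrow> log_compatible \<mu> \<mu>"
proof -
  note [measurable_cong] = finite_borel_pair(2)[OF fin fin]
  let ?P = "\<mu> \<Otimes>\<^sub>M \<mu>"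
  let ?F = "\<lambda>z::real \<times> real. if fst z = snd z then \<infinity> else ennreal \<bar>ln \<bar>fst z - snd z\<bar>\<bar>"
  have F: "(case z of (x, y) \<Rightarrow> e2ennreal \<bar>log_kernel x y\<bar>) = ?F z" for z
    by (cases z) (auto simp: log_kernel_eq, simp add: log_kernel_def)
  have Fm: "?F \<in> borel_measurable ?P" by measurable
  have FLE: "finite_log_energy \<mu> \<longleftrightarrow> (\<integral>\<^sup>+z. ?F z \<partial>?P) < \<infinity>"
    unfolding finite_log_energy_def F ..
  show ?thesis
  proof
    assume "finite_log_energy \<mu>"
    hence fi: "(\<integral>\<^sup>+z. ?F z \<partial>?P) < \<infinity>" using FLE by simp
    hence "AE z in ?P. ?F z \<noteq> \<infinity>" using Fm by (intro nn_integral_PInf_AE) auto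
    hence ae: "AE z in ?P. fst z \<noteq> snd z" by eventually_elim (auto split: if_splits)
    have "(\<integral>\<^sup>+z. ennreal (norm (ln \<bar>fst z - snd z\<bar>)) \<partial>?P) = (\<integral>\<^sup>+z. ?F z \<partial>?P)"
      by (intro nn_integral_cong_AE) (use ae in \<open>eventually_elim, auto\<close>)
    hence "integrable ?P (\<lambda>z. ln \<bar>fst z - snd z\<bar>)" using fi by (intro integrableI_bounded) auto
    with ae show "log_compatible \<mu> \<mu>" by (simp add: log_compatible_def)
  next
    assume lc: "log_compatible \<mu> \<mu>"
    hence ae: "AE z in ?P. fst z \<noteq> snd z" by (simp add: log_compatible_def)
    have "(\<integral>\<^sup>+z. ?F z \<partial>?P) = (\<integral>\<^sup>+z. ennreal (norm (ln \<bar>fst z - snd z\<bar>)) \<partial>?P)"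
      by (intro nn_integral_cong_AE) (use ae in \<open>eventually_elim, auto\<close>)
    also have "\<dots> < \<infinity>" using lc by (auto simp: log_compatible_def integrable_iff_bounded)
    finally show "finite_log_energy \<mu>" using FLE by simp
  qed
qed

lemma no_atoms:
  assumes fin: "finite_borel \<mu>" and lc: "log_compatible \<mu> \<mu>"
  shows "emeasure \<mu> {x} = 0"
proof -
  interpret finite_measure \<mu> using finite_borelD[OF fin] by simp
  note s = finite_borelD(2)[OF fin] and sp = finite_borelD(3)[OF fin]
  note [measurable_cong] = finite_borel_pair(2)[OF fin fin]
  have "AE z in \<mu> \<Otimes>\<^sub>M \<mu>. z \<notin> {x} \<times> {x}"
    using lc unfolding log_compatible_def by (auto elim: eventually_mono)
  moreover have m: "{x} \<times> {x} \<in> sets (\<mu> \<Otimes>\<^sub>M \<mu>)" using s by (intro pair_measureI) auto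
  ultimately have "emeasure (\<mu> \<Otimes>\<^sub>M \<mu>) ({x} \<times> {x}) = 0"
    using AE_iff_null_sets[OF m] by (simp add: null_sets_def)
  moreover have "emeasure (\<mu> \<Otimes>\<^sub>M \<mu>) ({x} \<times> {x}) = emeasure \<mu> {x} * emeasure \<mu> {x}"
    using s by (intro emeasure_pair_measure_Times) auto
  ultimately show ?thesis by simp
qed

lemma AE_off_diagonal:
  assumes fin: "finite_borel \<mu>" "finite_borel \<nu>" and at: "\<And>x. emeasure \<nu> {x} = 0"
  shows "AE z in \<mu> \<Otimes>\<^sub>M \<nu>. fst z \<noteq> snd z"
proof -
  interpret pair_sigma_finite \<mu> \<nu> by (rule finite_borel_pair(4)[OF fin])
  note [measurable_cong] = finite_borel_pair(2)[OF fin] finite_borelD(2)[OF fin(1)] finite_borelD(2)[OF fin(2)]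
  show ?thesis
  proof (rule AE_pair_measure)
    show "AE x in \<mu>. AE y in \<nu>. fst (x, y) \<noteq> snd (x, y)"
    proof (rule AE_I2)
      fix x
      have "{x} \<in> null_sets \<nu>" using at[of x] finite_borelD(2)[OF fin(2)] by auto
      thus "AE y in \<nu>. fst (x, y) \<noteq> snd (x, y)" by (rule AE_I') auto
    qed
  qed measurable
qed

text \<open>For almost every \<open>x\<close> the function \<open>ln \<bar>x - y\<bar>\<close> is integrable in \<open>y\<close>, and for large \<open>y\<close> it is comparable with
\<open>ln (1 + \<bar>y\<bar>)\<close>.\<close>

lemma log_moment:
  assumes fin: "finite_borel \<mu>" and lc: "log_compatible \<mu> \<mu>"
  shows "integrable \<mu> (\<lambda>x. ln (1 + \<bar>x\<bar>))"
proof -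
  interpret finite_measure \<mu> using finite_borelD[OF fin] by simp
  interpret pair_sigma_finite \<mu> \<mu> ..
  note [measurable_cong] = finite_borelD(2)[OF fin]
  have ae: "AE x in \<mu>. integrable \<mu> (\<lambda>y. ln \<bar>x - y\<bar>)"
    using AE_integrable_fst[of "\<lambda>x y. ln \<bar>x - y\<bar>"] lc by (simp add: log_compatible_def split_beta')
  show ?thesis
  proof (cases "\<exists>x. integrable \<mu> (\<lambda>y. ln \<bar>x - y\<bar>)")
    case False
    with ae have "AE x in \<mu>. False" by simp
    hence "AE x in \<mu>. (0::real) = ln (1 + \<bar>x\<bar>)" by (rule eventually_mono) simp
    thus ?thesis by (rule integrable_cong_AE_imp[of \<mu> "\<lambda>_. 0 :: real", rotated 2]) auto
  next
    case True
    then obtain x where x: "integrable \<mu> (\<lambda>y. ln \<bar>x - y\<bar>)" by blast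
    show ?thesis
    proof (rule Bochner_Integration.integrable_bound)
      show "integrable \<mu> (\<lambda>y. ln (1 + \<bar>x\<bar>) + ln 2 + \<bar>ln \<bar>x - y\<bar>\<bar>)" using x by simp
      show "AE y in \<mu>. norm (ln (1 + \<bar>y\<bar>)) \<le> norm (ln (1 + \<bar>x\<bar>) + ln 2 + \<bar>ln \<bar>x - y\<bar>\<bar>)"
      proof (rule AE_I2)
        fix y :: real
        have a: "ln (1 + \<bar>x\<bar>) \<ge> 0" "ln (1 + \<bar>y\<bar>) \<ge> 0" "ln (2::real) \<ge> 0" by (auto simp: ln_ge_zero)
        have "\<bar>y\<bar> \<le> \<bar>x\<bar> + \<bar>x - y\<bar>" using abs_triangle_ineq4[of x "x - y"] by simp
        hence "1 + \<bar>y\<bar> \<le> 1 + (\<bar>x\<bar> + \<bar>x - y\<bar> + \<bar>x\<bar> * \<bar>x - y\<bar>)" by (simp add: add_increasing2)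
        also have "\<dots> = (1 + \<bar>x\<bar>) * (1 + \<bar>x - y\<bar>)" by (simp only: distrib_left distrib_right mult_1_left mult_1_right add.assoc)
        finally have "ln (1 + \<bar>y\<bar>) \<le> ln ((1 + \<bar>x\<bar>) * (1 + \<bar>x - y\<bar>))"
          by (subst ln_le_cancel_iff) (auto intro: mult_pos_pos)
        also have "\<dots> = ln (1 + \<bar>x\<bar>) + ln (1 + \<bar>x - y\<bar>)" by (intro ln_mult_pos) auto
        also have "ln (1 + \<bar>x - y\<bar>) \<le> ln 2 + \<bar>ln \<bar>x - y\<bar>\<bar>"
        proof (cases "\<bar>x - y\<bar> \<le> 1")
          case True
          hence "ln (1 + \<bar>x - y\<bar>) \<le> ln 2" by (subst ln_le_cancel_iff) auto
          thus ?thesis by linarith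
        next
          case False
          hence "ln (1 + \<bar>x - y\<bar>) \<le> ln (2 * \<bar>x - y\<bar>)" by (subst ln_le_cancel_iff) auto
          also have "\<dots> = ln 2 + ln \<bar>x - y\<bar>" using False by (intro ln_mult_pos) auto
          finally show ?thesis by linarith
        qed
        finally show "norm (ln (1 + \<bar>y\<bar>)) \<le> norm (ln (1 + \<bar>x\<bar>) + ln 2 + \<bar>ln \<bar>x - y\<bar>\<bar>)" using a by simp
      qed
    qed simp
  qed
qed

text \<open>The part \<open>t \<ge> 1\<close> of the Gaussian superposition without the subtracted exponential. It is positive and has
the same singularity at \<open>d = 0\<close> as \<open>- 2 * ln \<bar>d\<bar>\<close>, so it can stand for the singular part of the kernel.\<close>

definition gauss_tail :: "real \<Rightarrow> ennreal" where
  "gauss_tail d = (\<integral>\<^sup>+t. ennreal (indicator {1..} t * (exp (- t * d\<^sup>2) / t)) \<partial>lborel)"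

lemma gauss_tail_le:
  assumes "d \<noteq> 0"
  shows "gauss_tail d \<le> ennreal (2 * \<bar>ln \<bar>d\<bar>\<bar>) + 1"
proof -
  have "(\<integral>\<^sup>+t. ennreal (exp (- t)) * indicator {0..} t \<partial>lborel) = ennreal (0 - (- exp (- 0)))"
    by (rule nn_integral_FTC_atLeast) (auto intro!: derivative_eq_intros, real_asymp)
  moreover have "ennreal (indicator {0..} t * exp (- t)) = ennreal (exp (- t)) * indicator {0..} t" for t :: real
    by (auto split: split_indicator)
  ultimately have e: "(\<integral>\<^sup>+t. ennreal (indicator {0..} t * exp (- t)) \<partial>lborel) = 1" by simp
  have "gauss_tail d \<le> (\<integral>\<^sup>+t. ennreal \<bar>gauss_diff d t\<bar> + ennreal (indicator {0..} t * exp (- t)) \<partial>lborel)"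
    unfolding gauss_tail_def
  proof (intro nn_integral_mono)
    fix t :: real
    show "ennreal (indicator {1..} t * (exp (- t * d\<^sup>2) / t)) \<le> ennreal \<bar>gauss_diff d t\<bar> + ennreal (indicator {0..} t * exp (- t))"
    proof (cases "t \<ge> 1")
      case True
      have "exp (- t * d\<^sup>2) / t = (exp (- t * d\<^sup>2) - exp (- t)) / t + exp (- t) / t" by (simp add: diff_divide_distrib)
      also have "\<dots> \<le> \<bar>(exp (- t * d\<^sup>2) - exp (- t)) / t\<bar> + exp (- t)"
        using True by (intro add_mono abs_ge_self) (simp add: divide_le_eq)
      finally show ?thesis using True by (simp add: gauss_diff_def ennreal_plus[symmetric] del: ennreal_plus)
    qed simp
  qed
  also have "\<dots> = ennreal (2 * \<bar>ln \<bar>d\<bar>\<bar>) + 1"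
    using nn_integral_gauss_diff[OF assms] e
    by (subst nn_integral_add) (auto simp: gauss_diff_def)
  finally show ?thesis .
qed

lemma log_le_gauss_tail:
  assumes "d \<noteq> 0" "\<bar>d\<bar> \<le> 1"
  shows "ennreal (2 * \<bar>ln \<bar>d\<bar>\<bar>) \<le> gauss_tail d + 1"
proof -
  have "ennreal (2 * \<bar>ln \<bar>d\<bar>\<bar>) = (\<integral>\<^sup>+t. ennreal \<bar>gauss_diff d t\<bar> \<partial>lborel)"
    using nn_integral_gauss_diff[OF assms(1)] by simp
  also have "\<dots> \<le> (\<integral>\<^sup>+t. ennreal (indicator {1..} t * (exp (- t * d\<^sup>2) / t)) + indicator {0..1} t \<partial>lborel)"
  proof (intro nn_integral_mono)
    fix t :: real
    have d1: "d\<^sup>2 \<le> 1" using assms by (simp add: abs_square_le_1)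
    show "ennreal \<bar>gauss_diff d t\<bar> \<le> ennreal (indicator {1..} t * (exp (- t * d\<^sup>2) / t)) + indicator {0..1} t"
    proof (cases "t > 0")
      case True
      have td: "t * d\<^sup>2 \<le> t" using True d1 by (simp add: mult_left_le)
      have abs: "\<bar>gauss_diff d t\<bar> = (exp (- t * d\<^sup>2) - exp (- t)) / t" using True td by (simp add: gauss_diff_def)
      show ?thesis
      proof (cases "t < 1")
        case True': True
        have "exp (- t * d\<^sup>2) \<le> 1" using True by simp
        moreover have "1 - t \<le> exp (- t)" using exp_ge_add_one_self[of "- t"] by simp
        ultimately have "exp (- t * d\<^sup>2) - exp (- t) \<le> 1 * t" by linarith
        hence "(exp (- t * d\<^sup>2) - exp (- t)) / t \<le> 1" using True by (simp only: pos_divide_le_eq)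
        thus ?thesis using True True' abs by simp
      next
        case False
        have "(exp (- t * d\<^sup>2) - exp (- t)) / t \<le> exp (- t * d\<^sup>2) / t" using True by (intro divide_right_mono) auto
        hence "ennreal \<bar>gauss_diff d t\<bar> \<le> ennreal (indicator {1..} t * (exp (- t * d\<^sup>2) / t))"
          using False abs by (intro ennreal_leI) simp
        thus ?thesis by (simp add: add_increasing2)
      qed
    qed (simp add: gauss_diff_def)
  qed
  also have "\<dots> = gauss_tail d + 1"
    unfolding gauss_tail_def by (subst nn_integral_add) auto
  finally show ?thesis .
qed

lemma nn_integral_gauss_tail:
  assumes fin: "finite_borel \<mu>" "finite_borel \<nu>"
  shows "(\<integral>\<^sup>+z. gauss_tail (fst z - snd z) \<partial>(\<mu> \<Otimes>\<^sub>M \<nu>)) =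
    (\<integral>\<^sup>+t. ennreal (indicator {1..} t * (gauss_energy \<mu> \<nu> t / t)) \<partial>lborel)"
proof -
  note [measurable_cong] = finite_borel_pair(2)[OF fin]
  let ?P = "\<mu> \<Otimes>\<^sub>M \<nu>"
  interpret P: finite_measure ?P by (rule finite_borel_pair(1)[OF fin])
  interpret PL: pair_sigma_finite ?P "lborel :: real measure" ..
  have "(\<integral>\<^sup>+z. gauss_tail (fst z - snd z) \<partial>?P) =
     (\<integral>\<^sup>+t. \<integral>\<^sup>+z. ennreal (indicator {1..} t * (exp (- t * (fst z - snd z)\<^sup>2) / t)) \<partial>?P \<partial>lborel)"
    unfolding gauss_tail_def by (rule PL.Fubini'[symmetric]) measurable
  also have "\<dots> = (\<integral>\<^sup>+t. ennreal (indicator {1..} t * (gauss_energy \<mu> \<nu> t / t)) \<partial>lborel)"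
  proof (intro nn_integral_cong)
    fix t :: real
    show "(\<integral>\<^sup>+z. ennreal (indicator {1..} t * (exp (- t * (fst z - snd z)\<^sup>2) / t)) \<partial>?P) = ennreal (indicator {1..} t * (gauss_energy \<mu> \<nu> t / t))"
    proof (cases "t \<ge> 1")
      case True
      have "integrable ?P (\<lambda>z. exp (- t * (fst z - snd z)\<^sup>2) / t)"
        using True by (intro integrable_divide P.integrable_const_bound[where B = 1]) auto
      from nn_integral_eq_integral[OF this] show ?thesis using True by (simp add: gauss_energy_def)
    qed simp
  qed
  finally show ?thesis .
qed

lemma gauss_energy_nonneg: "gauss_energy \<mu> \<nu> t \<ge> 0"
  unfolding gauss_energy_def by (intro integral_nonneg_AE) auto

text \<open>The Gaussian kernel is positive definite: the difference of the two sides is the Gaussian energy of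
\<open>\<mu> - \<nu>\<close>.\<close>

lemma gauss_energy_cross:
  assumes fin: "finite_borel \<mu>" "finite_borel \<nu>" and t: "t > 0"
  shows "2 * gauss_energy \<mu> \<nu> t \<le> gauss_energy \<mu> \<mu> t + gauss_energy \<nu> \<nu> t"
proof -
  let ?w = "sqrt (2 * t)" and ?N = std_normal_distribution
  have "2 * gauss_energy \<mu> \<nu> t = (\<integral>s. 2 * (char \<mu> (?w * s) \<bullet> char \<nu> (?w * s)) \<partial>?N)"
    using gauss_energy_char[OF fin t] by simp
  also have "\<dots> \<le> (\<integral>s. char \<mu> (?w * s) \<bullet> char \<mu> (?w * s) + char \<nu> (?w * s) \<bullet> char \<nu> (?w * s) \<partial>?N)"
  proof (rule integral_mono)
    fix s
    have "0 \<le> (char \<mu> (?w * s) - char \<nu> (?w * s)) \<bullet> (char \<mu> (?w * s) - char \<nu> (?w * s))" by (rule inner_ge_zero)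
    thus "2 * (char \<mu> (?w * s) \<bullet> char \<nu> (?w * s)) \<le> char \<mu> (?w * s) \<bullet> char \<mu> (?w * s) + char \<nu> (?w * s) \<bullet> char \<nu> (?w * s)"
      by (simp add: inner_diff_left inner_diff_right inner_commute)
  qed (use integrable_char_product fin in \<open>auto intro!: Bochner_Integration.integrable_add\<close>)
  also have "\<dots> = gauss_energy \<mu> \<mu> t + gauss_energy \<nu> \<nu> t"
    using integrable_char_product fin t by (simp add: gauss_energy_char)
  finally show ?thesis .
qed

lemma gauss_tail_finite:
  assumes fin: "finite_borel \<mu>" and lc: "log_compatible \<mu> \<mu>"
  shows "(\<integral>\<^sup>+z. gauss_tail (fst z - snd z) \<partial>(\<mu> \<Otimes>\<^sub>M \<mu>)) < \<infinity>"
proof -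
  let ?P = "\<mu> \<Otimes>\<^sub>M \<mu>"
  note [measurable_cong] = finite_borel_pair(2)[OF fin fin]
  interpret P: finite_measure ?P by (rule finite_borel_pair(1)[OF fin fin])
  have "(\<integral>\<^sup>+z. gauss_tail (fst z - snd z) \<partial>?P) \<le> (\<integral>\<^sup>+z. ennreal (2 * \<bar>ln \<bar>fst z - snd z\<bar>\<bar> + 1) \<partial>?P)"
  proof (rule nn_integral_mono_AE)
    have "AE z in ?P. fst z \<noteq> snd z" using lc by (simp add: log_compatible_def)
    thus "AE z in ?P. gauss_tail (fst z - snd z) \<le> ennreal (2 * \<bar>ln \<bar>fst z - snd z\<bar>\<bar> + 1)"
      by eventually_elim (use gauss_tail_le in \<open>auto simp: ennreal_plus\<close>)
  qed
  also have "\<dots> = ennreal (\<integral>z. 2 * \<bar>ln \<bar>fst z - snd z\<bar>\<bar> + 1 \<partial>?P)"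
    using lc by (intro nn_integral_eq_integral) (auto simp: log_compatible_def)
  finally show ?thesis by (rule order.strict_trans1) simp
qed

lemma integrable_fst_pair:
  fixes f :: "real \<Rightarrow> real"
  assumes fin: "finite_borel \<mu>" "finite_borel \<nu>" and f: "integrable \<mu> f"
  shows "integrable (\<mu> \<Otimes>\<^sub>M \<nu>) (\<lambda>z. f (fst z))"
proof -
  interpret n: finite_measure \<nu> using finite_borelD[OF fin(2)] by simp
  interpret pair_sigma_finite \<mu> \<nu> by (rule finite_borel_pair(4)[OF fin])
  note [measurable] = borel_measurable_integrable[OF f]
  show ?thesis using f by (intro Fubini_integrable) auto
qed

lemma integrable_snd_pair:
  fixes f :: "real \<Rightarrow> real"
  assumes fin: "finite_borel \<mu>" "finite_borel \<nu>" and f: "integrable \<nu> f"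
  shows "integrable (\<mu> \<Otimes>\<^sub>M \<nu>) (\<lambda>z. f (snd z))"
proof -
  interpret m: finite_measure \<mu> using finite_borelD[OF fin(1)] by simp
  interpret pair_sigma_finite \<mu> \<nu> by (rule finite_borel_pair(4)[OF fin])
  note [measurable] = borel_measurable_integrable[OF f]
  show ?thesis using f by (intro Fubini_integrable) auto
qed

text \<open>Near the diagonal the kernel is controlled by \<open>gauss_tail\<close>, for which positive definiteness bounds the
mutual energy by the two self-energies. Away from the diagonal it is controlled by the logarithmic moments.\<close>

proposition log_compatible_cross:
  assumes fin: "finite_borel \<mu>" "finite_borel \<nu>"
    and lc: "log_compatible \<mu> \<mu>" "log_compatible \<nu> \<nu>"
  shows "log_compatible \<mu> \<nu>"
proof -
  let ?P = "\<mu> \<Otimes>\<^sub>M \<nu>"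
  note [measurable_cong] = finite_borel_pair(2)[OF fin] finite_borelD(2)[OF fin(1)] finite_borelD(2)[OF fin(2)]
  interpret P: finite_measure ?P by (rule finite_borel_pair(1)[OF fin])
  interpret m: finite_measure \<mu> using finite_borelD[OF fin(1)] by simp
  interpret n: finite_measure \<nu> using finite_borelD[OF fin(2)] by simp
  interpret mn: pair_sigma_finite \<mu> \<nu> ..
  have ae: "AE z in ?P. fst z \<noteq> snd z" by (intro AE_off_diagonal fin no_atoms lc)
  have "(\<integral>\<^sup>+z. gauss_tail (fst z - snd z) \<partial>?P) + (\<integral>\<^sup>+z. gauss_tail (fst z - snd z) \<partial>?P) \<le>
     (\<integral>\<^sup>+z. gauss_tail (fst z - snd z) \<partial>(\<mu> \<Otimes>\<^sub>M \<mu>)) + (\<integral>\<^sup>+z. gauss_tail (fst z - snd z) \<partial>(\<nu> \<Otimes>\<^sub>M \<nu>))"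
    unfolding nn_integral_gauss_tail[OF fin] nn_integral_gauss_tail[OF fin(1) fin(1)] nn_integral_gauss_tail[OF fin(2) fin(2)]
  proof -
    have [measurable]: "gauss_energy \<alpha> \<beta> \<in> borel_measurable borel" if "finite_borel \<alpha>" "finite_borel \<beta>" for \<alpha> \<beta>
    proof -
      note [measurable_cong] = finite_borel_pair(2)[OF that]
      interpret finite_measure "\<alpha> \<Otimes>\<^sub>M \<beta>" by (rule finite_borel_pair(1)[OF that])
      show ?thesis unfolding gauss_energy_def by measurable
    qed
    note [measurable] = this[OF fin] this[OF fin(1) fin(1)] this[OF fin(2) fin(2)]
    let ?e = "\<lambda>\<alpha> \<beta> t. ennreal (indicator {1..} t * (gauss_energy \<alpha> \<beta> t / t))"
    have "?e \<mu> \<nu> t + ?e \<mu> \<nu> t \<le> ?e \<mu> \<mu> t + ?e \<nu> \<nu> t" for t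
    proof (cases "t \<ge> 1")
      case True
      hence "gauss_energy \<mu> \<nu> t / t + gauss_energy \<mu> \<nu> t / t \<le> gauss_energy \<mu> \<mu> t / t + gauss_energy \<nu> \<nu> t / t"
        using gauss_energy_cross[OF fin, of t] by (simp add: field_simps)
      thus ?thesis using True gauss_energy_nonneg by (simp add: ennreal_plus[symmetric] del: ennreal_plus)
    qed simp
    hence "(\<integral>\<^sup>+t. ?e \<mu> \<nu> t + ?e \<mu> \<nu> t \<partial>lborel) \<le> (\<integral>\<^sup>+t. ?e \<mu> \<mu> t + ?e \<nu> \<nu> t \<partial>lborel)"
      by (intro nn_integral_mono)
    thus "(\<integral>\<^sup>+t. ?e \<mu> \<nu> t \<partial>lborel) + (\<integral>\<^sup>+t. ?e \<mu> \<nu> t \<partial>lborel) \<le> (\<integral>\<^sup>+t. ?e \<mu> \<mu> t \<partial>lborel) + (\<integral>\<^sup>+t. ?e \<nu> \<nu> t \<partial>lborel)"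
      by (subst (asm) (1 2) nn_integral_add) auto
  qed
  also have "\<dots> < \<infinity>" using gauss_tail_finite fin lc by simp
  finally have tail: "(\<integral>\<^sup>+z. gauss_tail (fst z - snd z) \<partial>?P) < \<infinity>" by (simp add: less_top)
  let ?m = "\<lambda>z. ln (1 + \<bar>fst z\<bar>) + ln (1 + \<bar>snd z\<bar>)"
  have mom: "integrable ?P ?m"
  proof (intro Bochner_Integration.integrable_add)
    show "integrable ?P (\<lambda>z. ln (1 + \<bar>fst z\<bar>))" by (intro integrable_fst_pair fin log_moment lc)
    show "integrable ?P (\<lambda>z. ln (1 + \<bar>snd z\<bar>))" by (intro integrable_snd_pair fin log_moment lc)
  qed
  have "(\<integral>\<^sup>+z. ennreal (norm (ln \<bar>fst z - snd z\<bar>)) \<partial>?P) \<le> (\<integral>\<^sup>+z. (gauss_tail (fst z - snd z) + 1) + ennreal (?m z) \<partial>?P)"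
  proof (rule nn_integral_mono_AE, use ae in eventually_elim)
    case (elim z)
    let ?d = "fst z - snd z"
    have m0: "ln (1 + \<bar>fst z\<bar>) \<ge> 0" "ln (1 + \<bar>snd z\<bar>) \<ge> 0" by (auto simp: ln_ge_zero)
    show ?case
    proof (cases "\<bar>?d\<bar> \<le> 1")
      case True
      have "ennreal (norm (ln \<bar>?d\<bar>)) \<le> ennreal (2 * \<bar>ln \<bar>?d\<bar>\<bar>)" by (intro ennreal_leI) simp
      also have "\<dots> \<le> gauss_tail ?d + 1" using elim True by (intro log_le_gauss_tail) auto
      finally show ?thesis by (simp add: add_increasing2)
    next
      case False
      have "\<bar>?d\<bar> \<le> \<bar>fst z\<bar> + \<bar>snd z\<bar>" by (rule abs_triangle_ineq4)
      also have "\<dots> \<le> (1 + \<bar>fst z\<bar>) * (1 + \<bar>snd z\<bar>)" by (simp add: algebra_simps)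
      finally have "ln \<bar>?d\<bar> \<le> ln ((1 + \<bar>fst z\<bar>) * (1 + \<bar>snd z\<bar>))" using False
        by (subst ln_le_cancel_iff) auto
      also have "\<dots> = ?m z" by (intro ln_mult_pos) auto
      finally have "ennreal (norm (ln \<bar>?d\<bar>)) \<le> ennreal (?m z)" using False by (intro ennreal_leI) (auto simp: ln_ge_zero abs_of_nonneg)
      thus ?thesis by (simp add: add_increasing)
    qed
  qed
  also have "\<dots> = (\<integral>\<^sup>+z. gauss_tail (fst z - snd z) \<partial>?P) + emeasure ?P (space ?P) + (\<integral>\<^sup>+z. ennreal (?m z) \<partial>?P)"
    unfolding gauss_tail_def by (subst nn_integral_add, simp_all)+
  also have "\<dots> < \<infinity>" using tail P.emeasure_finite mom
    by (auto simp: less_top[symmetric] integrable_iff_bounded ln_ge_zero)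
  finally have "integrable ?P (\<lambda>z. ln \<bar>fst z - snd z\<bar>)" by (intro integrableI_bounded) auto
  with ae show ?thesis by (simp add: log_compatible_def)
qed

lemma log_inner_commute:
  assumes fin: "finite_borel \<mu>" "finite_borel \<nu>"
  shows "log_inner \<mu> \<nu> = log_inner \<nu> \<mu>"
proof -
  interpret pair_sigma_finite \<mu> \<nu> by (rule finite_borel_pair(4)[OF fin])
  note [measurable_cong] = finite_borel_pair(2)[OF fin] finite_borel_pair(2)[OF fin(2,1)]
  have "(\<integral>(x, y). ln \<bar>y - x\<bar> \<partial>(\<nu> \<Otimes>\<^sub>M \<mu>)) = (\<integral>z. ln \<bar>fst z - snd z\<bar> \<partial>(\<mu> \<Otimes>\<^sub>M \<nu>))"
    using integral_product_swap[of "\<lambda>z. ln \<bar>fst z - snd z\<bar>"] by (simp add: split_beta')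
  thus ?thesis by (simp add: log_inner_def split_beta' abs_minus_commute)
qed

lemma ereal_integral_real:
  assumes i: "integrable M g" and ae: "AE x in M. f x = ereal (g x)"
  shows "ereal_integral M f = ereal (integral\<^sup>L M g)"
proof -
  have "(\<integral>\<^sup>+x. e2ennreal (f x) \<partial>M) = (\<integral>\<^sup>+x. ennreal (g x) \<partial>M)"
    "(\<integral>\<^sup>+x. e2ennreal (- f x) \<partial>M) = (\<integral>\<^sup>+x. ennreal (- g x) \<partial>M)"
    by (intro nn_integral_cong_AE; use ae in \<open>eventually_elim, simp\<close>)+
  moreover have "(\<integral>\<^sup>+x. ennreal (g x) \<partial>M) \<noteq> \<infinity>" "(\<integral>\<^sup>+x. ennreal (- g x) \<partial>M) \<noteq> \<infinity>"
    using i unfolding real_integrable_def by auto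
  ultimately show ?thesis unfolding ereal_integral_def using real_lebesgue_integral_def[OF i]
    by (cases "\<integral>\<^sup>+x. ennreal (g x) \<partial>M"; cases "\<integral>\<^sup>+x. ennreal (- g x) \<partial>M") (auto simp: top_ennreal.rep_eq)
qed

lemma mutual_energy_log_inner:
  assumes "log_compatible \<mu> \<nu>"
  shows "mutual_energy \<mu> \<nu> = ereal (log_inner \<mu> \<nu>)"
proof -
  have "mutual_energy \<mu> \<nu> = ereal (\<integral>z. - ln \<bar>fst z - snd z\<bar> \<partial>(\<mu> \<Otimes>\<^sub>M \<nu>))"
    unfolding mutual_energy_def
  proof (rule ereal_integral_real)
    show "integrable (\<mu> \<Otimes>\<^sub>M \<nu>) (\<lambda>z. - ln \<bar>fst z - snd z\<bar>)" using assms by (simp add: log_compatible_def)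
    have "AE z in \<mu> \<Otimes>\<^sub>M \<nu>. fst z \<noteq> snd z" using assms by (simp add: log_compatible_def)
    thus "AE z in \<mu> \<Otimes>\<^sub>M \<nu>. (case z of (x, y) \<Rightarrow> log_kernel x y) = ereal (- ln \<bar>fst z - snd z\<bar>)"
      by eventually_elim (auto simp: log_kernel_eq)
  qed
  thus ?thesis by (simp add: log_inner_def)
qed

section \<open>Swept measures\<close>

definition sweep_measure :: "nat \<Rightarrow> nat \<Rightarrow> real measure" where
  "sweep_measure r j = density lborel (\<lambda>v. ennreal (sweep_density r j v))"

text \<open>The image on the \<open>j\<close>-th half-line of \<open>X * exp W\<close> with independent \<open>X\<close>, \<open>W\<close>, that is, a multiplicative
convolution.\<close>

definition swept :: "nat \<Rightarrow> nat \<Rightarrow> real measure \<Rightarrow> real measure" where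
  "swept r j \<mu> = distr (\<mu> \<Otimes>\<^sub>M sweep_measure r j) borel (\<lambda>z. (- 1) ^ j * (fst z * exp (snd z)))"

text \<open>Open half-lines, because the logarithmic coordinate is used on them. A measure of finite energy does not
charge the origin.\<close>

definition on_side :: "nat \<Rightarrow> real measure \<Rightarrow> bool" where
  "on_side j \<mu> \<longleftrightarrow> (AE x in \<mu>. (- 1) ^ j * x > 0)"

lemma abs_max_shift: "\<bar>max a (b + v)\<bar> \<le> \<bar>max a b\<bar> + \<bar>v\<bar>" for a b v :: real
  by (auto simp: max_def abs_if)

text \<open>The size of \<open>ln \<bar>p - q\<bar>\<close> is separated into the scale \<open>max (ln p) (ln q)\<close>, which is controlled by logarithmic
moments, and a nonnegative singular part that depends on \<open>ln p - ln q\<close> only.\<close>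

lemma ln_abs_diff_bound:
  assumes "p > 0" "q > 0" "p \<noteq> q"
  shows "\<bar>ln \<bar>p - q\<bar>\<bar> \<le> \<bar>max (ln p) (ln q)\<bar> + (\<bar>ln p - ln q\<bar> / 2 - log_cosh 0 (ln p - ln q))"
    and "\<bar>max (ln p) (ln q)\<bar> \<le> \<bar>ln \<bar>p - q\<bar>\<bar> + ln (1 + p) + ln (1 + q)"
proof -
  have e: "ln \<bar>p - q\<bar> = max (ln p) (ln q) - (\<bar>ln p - ln q\<bar> / 2 - log_cosh 0 (ln p - ln q))"
    using ln_diff_log_cosh[of q p] assms by (auto simp: max_def abs_if field_simps)
  have le: "ln \<bar>p - q\<bar> \<le> max (ln p) (ln q)"
  proof -
    have "\<bar>p - q\<bar> \<le> max p q" using assms by auto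
    hence "ln \<bar>p - q\<bar> \<le> ln (max p q)" using assms by (subst ln_le_cancel_iff) auto
    also have "ln (max p q) = max (ln p) (ln q)" using assms by (auto simp: max_def)
    finally show ?thesis .
  qed
  show "\<bar>ln \<bar>p - q\<bar>\<bar> \<le> \<bar>max (ln p) (ln q)\<bar> + (\<bar>ln p - ln q\<bar> / 2 - log_cosh 0 (ln p - ln q))"
    using e le by linarith
  have "ln p \<le> ln (1 + p)" "ln q \<le> ln (1 + q)" "0 \<le> ln (1 + p)" "0 \<le> ln (1 + q)"
    using assms by (auto simp: ln_ge_zero)
  thus "\<bar>max (ln p) (ln q)\<bar> \<le> \<bar>ln \<bar>p - q\<bar>\<bar> + ln (1 + p) + ln (1 + q)"
    using le by (auto simp: max_def abs_if split: if_splits)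
qed

context
  fixes r j :: nat
  assumes j: "1 \<le> j" "j < r"
begin

lemma finite_borel_sweep: "finite_borel (sweep_measure r j)"
  and measure_sweep: "measure (sweep_measure r j) UNIV = 1 - j / r"
proof -
  note [measurable] = measurable_sweep_density[OF j]
  have c: "1 - real j / r \<ge> 0" using j by (simp add: field_simps)
  have "emeasure (sweep_measure r j) UNIV = (\<integral>\<^sup>+v. ennreal (sweep_density r j v) \<partial>lborel)"
    by (simp add: sweep_measure_def emeasure_density)
  also have "\<dots> = ennreal (1 - j / r)"
    using sweep_density_mass[OF j] sweep_density_nonneg[OF j]
    by (subst nn_integral_eq_integral) (auto simp: has_bochner_integral_iff)
  finally have e: "emeasure (sweep_measure r j) UNIV = ennreal (1 - j / r)" .
  have "space (sweep_measure r j) = UNIV" by (simp add: sweep_measure_def)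
  thus "finite_borel (sweep_measure r j)" using e
    by (auto simp: finite_borel_def sweep_measure_def intro!: finite_measureI)
  show "measure (sweep_measure r j) UNIV = 1 - j / r" using e c by (simp add: measure_def)
qed

lemma integrable_sweep_iff:
  assumes "f \<in> borel_measurable borel"
  shows "integrable (sweep_measure r j) f \<longleftrightarrow> integrable lborel (\<lambda>v. f v * sweep_density r j v)"
    and "integral\<^sup>L (sweep_measure r j) f = (LBINT v. f v * sweep_density r j v)"
  using assms measurable_sweep_density[OF j] sweep_density_nonneg[OF j]
  by (auto simp: sweep_measure_def integrable_density integral_density mult.commute)

text \<open>Sweeping smooths the singularity. The singular part of \<open>ln_abs_diff_bound\<close> is nonnegative, so its integral
is evaluated without absolute values, by \<open>sweep_log_transform\<close>: the result \<open>sheet_log\<close> has no singularity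
and differs from its asymptote, a multiple of \<open>\<bar>w\<bar>\<close>, by a bounded amount. The first moment of the density
accounts for the rest.\<close>

lemma sweep_kernel_bound:
  obtains K where "K \<ge> 0"
    "\<And>x y. x > 0 \<Longrightarrow> y > 0 \<Longrightarrow>
      (\<integral>\<^sup>+v. ennreal \<bar>ln \<bar>y - x * exp v\<bar>\<bar> \<partial>sweep_measure r j) \<le> ennreal (K + \<bar>max (ln y) (ln x)\<bar>)"
proof -
  note [measurable] = measurable_sweep_density[OF j]
  define \<Theta> where "\<Theta> = (\<lambda>l. sheet_angle r j l 0)"
  have "\<exists>C. C \<ge> 0 \<and> (\<forall>s. \<bar>log_cosh (\<Theta> l) s - \<bar>s\<bar> / 2\<bar> \<le> C)" if "l < r - j" for l
    using log_cosh_bound[OF sheet_angle_cos_less[OF j that, of 0]] unfolding \<Theta>_def by (metis pi_ge_zero zero_le_mult_iff zero_le_numeral order_refl)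
  then obtain C where C: "\<And>l. l < r - j \<Longrightarrow> C l \<ge> 0" "\<And>l s. l < r - j \<Longrightarrow> \<bar>log_cosh (\<Theta> l) s - \<bar>s\<bar> / 2\<bar> \<le> C l"
    by metis
  \<comment> \<open>The first moment enters once from the scale and once, halved, from \<open>\<bar>w - v\<bar> / 2\<close>.\<close>
  define M where "M = (LBINT v. \<bar>v\<bar> * sweep_density r j v)"
  define K where "K = 2 * M + (\<Sum>l<r - j. C l)"
  have M0: "M \<ge> 0" unfolding M_def using sweep_density_nonneg[OF j] by (intro integral_nonneg_AE) auto
  have K0: "K \<ge> 0" unfolding K_def using M0 C(1) by (auto intro!: add_nonneg_nonneg sum_nonneg)
  have Mi: "integrable lborel (\<lambda>v. \<bar>v\<bar> * sweep_density r j v)" by (rule sweep_density_first_moment[OF j])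
  have Si: "integrable lborel (sweep_density r j)" "integral\<^sup>L lborel (sweep_density r j) = 1 - j / r"
    using sweep_density_mass[OF j] by (auto simp: has_bochner_integral_iff)
  show ?thesis
  proof (rule that[OF K0])
    fix x y :: real assume xy: "x > 0" "y > 0"
    define m where "m = \<bar>max (ln y) (ln x)\<bar>"
    define w where "w = ln y - ln x"
    let ?h = "\<lambda>v. \<bar>w - v\<bar> / 2 - log_cosh 0 (w - v)"
    let ?g = "\<lambda>v. (m + \<bar>v\<bar> + ?h v) * sweep_density r j v"
    have i1: "has_bochner_integral lborel (\<lambda>v. log_cosh 0 (w - v) * sweep_density r j v) (sheet_log r j 0 w)"
      by (rule sweep_log_transform[OF j]) auto
    have i2: "integrable lborel (\<lambda>v. \<bar>w - v\<bar> / 2 * sweep_density r j v)"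
      by (rule sweep_integrable_bound[OF j, of _ "\<bar>w\<bar> / 2" "1 / 2"]) (auto simp: field_simps)
    have gi: "integrable lborel ?g" using i1 i2 Mi Si by (simp add: distrib_right left_diff_distrib has_bochner_integral_iff)
    have "(LBINT v. ?g v) = m * (1 - j / r) + M + ((LBINT v. \<bar>w - v\<bar> / 2 * sweep_density r j v) - sheet_log r j 0 w)"
      using i1 i2 Mi Si by (simp add: distrib_right left_diff_distrib has_bochner_integral_iff M_def)
    also have "m * (1 - j / r) \<le> m" using j by (simp add: m_def mult_left_le)
    also have "(LBINT v. \<bar>w - v\<bar> / 2 * sweep_density r j v) \<le> (LBINT v. \<bar>w\<bar> / 2 * sweep_density r j v + (\<bar>v\<bar> * sweep_density r j v) / 2)"
    proof (rule integral_mono[OF i2])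
      show "integrable lborel (\<lambda>v. \<bar>w\<bar> / 2 * sweep_density r j v + (\<bar>v\<bar> * sweep_density r j v) / 2)" using Mi Si by simp
      fix v
      have "\<bar>w - v\<bar> / 2 \<le> \<bar>w\<bar> / 2 + \<bar>v\<bar> / 2" using abs_triangle_ineq4[of w v] by (simp add: field_simps)
      from mult_right_mono[OF this sweep_density_nonneg[OF j]]
      show "\<bar>w - v\<bar> / 2 * sweep_density r j v \<le> \<bar>w\<bar> / 2 * sweep_density r j v + (\<bar>v\<bar> * sweep_density r j v) / 2"
        by (simp add: algebra_simps)
    qed
    also have "\<dots> = \<bar>w\<bar> / 2 * (1 - j / r) + M / 2" using Mi Si by (simp add: M_def)
    finally have 1: "(LBINT v. ?g v) \<le> m + M + (\<bar>w\<bar> / 2 * (1 - j / r) + M / 2 - sheet_log r j 0 w)" by simp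
    have "(\<Sum>l<r - j. \<bar>w / r\<bar> / 2 - C l) \<le> sheet_log r j 0 w"
      unfolding sheet_log_def[OF j] \<Theta>_def[symmetric]
    proof (intro sum_mono)
      fix l assume "l \<in> {..<r - j}"
      thus "\<bar>w / r\<bar> / 2 - C l \<le> log_cosh (sheet_angle r j l 0) (w / r)"
        using C(2)[of l "w / r"] unfolding \<Theta>_def by (simp add: abs_le_iff)
    qed
    moreover have "(\<Sum>l<r - j. \<bar>w / r\<bar> / 2 - C l) = \<bar>w\<bar> / 2 * (1 - j / r) - (\<Sum>l<r - j. C l)"
    proof -
      have "(\<Sum>l<r - j. \<bar>w / r\<bar> / 2 - C l) = real (r - j) * (\<bar>w / r\<bar> / 2) - (\<Sum>l<r - j. C l)"
        by (simp add: sum_subtractf)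
      also have "real (r - j) * (\<bar>w / r\<bar> / 2) = \<bar>w\<bar> / 2 * (1 - j / r)"
        using j by (simp add: of_nat_diff field_simps)
      finally show ?thesis .
    qed
    ultimately have 2: "(LBINT v. ?g v) \<le> K + m" using 1 M0 by (simp add: K_def)
    have "(\<integral>\<^sup>+v. ennreal \<bar>ln \<bar>y - x * exp v\<bar>\<bar> \<partial>sweep_measure r j) = (\<integral>\<^sup>+v. ennreal (sweep_density r j v) * ennreal \<bar>ln \<bar>y - x * exp v\<bar>\<bar> \<partial>lborel)"
      unfolding sweep_measure_def by (subst nn_integral_density) auto
    also have "\<dots> \<le> (\<integral>\<^sup>+v. ennreal (?g v) \<partial>lborel)"
    proof (rule nn_integral_mono_AE)
      have "AE v in lborel. v \<noteq> w" by (rule AE_lborel_singleton)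
      thus "AE v in lborel. ennreal (sweep_density r j v) * ennreal \<bar>ln \<bar>y - x * exp v\<bar>\<bar> \<le> ennreal (?g v)"
      proof eventually_elim
        case (elim v)
        have ne: "y \<noteq> x * exp v"
        proof
          assume "y = x * exp v"
          hence "ln y = ln x + v" using xy by (simp add: ln_mult)
          thus False using elim by (simp add: w_def)
        qed
        have l: "ln (x * exp v) = ln x + v" using xy by (simp add: ln_mult)
        have "\<bar>ln \<bar>y - x * exp v\<bar>\<bar> \<le> \<bar>max (ln y) (ln x + v)\<bar> + (\<bar>ln y - (ln x + v)\<bar> / 2 - log_cosh 0 (ln y - (ln x + v)))"
          using ln_abs_diff_bound(1)[of y "x * exp v"] xy ne unfolding l by simp
        also have "ln y - (ln x + v) = w - v" by (simp add: w_def)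
        also have "\<bar>max (ln y) (ln x + v)\<bar> \<le> m + \<bar>v\<bar>" unfolding m_def by (rule abs_max_shift)
        finally have "\<bar>ln \<bar>y - x * exp v\<bar>\<bar> \<le> m + \<bar>v\<bar> + ?h v" by simp
        from mult_right_mono[OF this sweep_density_nonneg[OF j, of v]]
        show ?case using sweep_density_nonneg[OF j, of v]
          by (simp add: ennreal_mult[symmetric] ennreal_leI mult.commute)
      qed
    qed
    also have "\<dots> = ennreal (LBINT v. ?g v)"
    proof (rule nn_integral_eq_integral[OF gi])
      have "AE v in lborel. v \<noteq> w" by (rule AE_lborel_singleton)
      thus "AE v in lborel. 0 \<le> ?g v"
      proof eventually_elim
        case (elim v)
        have "log_cosh 0 (w - v) \<le> \<bar>w - v\<bar> / 2"
        proof -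
          have "2 * cosh (w - v) - 2 * cos 0 \<le> exp \<bar>w - v\<bar>"
          proof -
            have "exp (- \<bar>w - v\<bar>) \<le> 1" by simp
            moreover have "2 * cosh (w - v) = exp \<bar>w - v\<bar> + exp (- \<bar>w - v\<bar>)" by (auto simp: cosh_field_def abs_if)
            ultimately show ?thesis unfolding cos_zero by linarith
          qed
          moreover have "0 < 2 * cosh (w - v) - 2 * cos 0" using cosh_minus_cos_pos[of 0 "w - v"] elim by auto
          ultimately have "ln (2 * cosh (w - v) - 2 * cos 0) \<le> ln (exp \<bar>w - v\<bar>)" by (subst ln_le_cancel_iff) auto
          thus ?thesis by (simp add: log_cosh_def)
        qed
        thus ?case using sweep_density_nonneg[OF j, of v] by (intro mult_nonneg_nonneg) (auto simp: m_def)
      qed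
    qed
    also have "\<dots> \<le> ennreal (K + m)" using 2 by (rule ennreal_leI)
    finally show "(\<integral>\<^sup>+v. ennreal \<bar>ln \<bar>y - x * exp v\<bar>\<bar> \<partial>sweep_measure r j) \<le> ennreal (K + \<bar>max (ln y) (ln x)\<bar>)"
      unfolding m_def .
  qed
qed

context
  fixes \<mu> :: "real measure"
  assumes fin: "finite_borel \<mu>" and pos: "AE x in \<mu>. x > 0"
begin

lemma swept_map_measurable [measurable]:
  "(\<lambda>z. (- 1) ^ j * (fst z * exp (snd z))) \<in> borel_measurable (\<mu> \<Otimes>\<^sub>M sweep_measure r j)"
proof -
  note [measurable_cong] = finite_borel_pair(2)[OF fin finite_borel_sweep]
  show ?thesis by measurable
qed

lemma finite_borel_swept: "finite_borel (swept r j \<mu>)"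
proof -
  interpret finite_measure "\<mu> \<Otimes>\<^sub>M sweep_measure r j" by (rule finite_borel_pair(1)[OF fin finite_borel_sweep])
  show ?thesis unfolding swept_def finite_borel_def by (auto intro!: finite_measure_distr)
qed

lemma measure_swept: "measure (swept r j \<mu>) UNIV = (1 - j / r) * measure \<mu> UNIV"
  using finite_borel_pair(3)[OF fin finite_borel_sweep] measure_sweep
  by (simp add: swept_def measure_distr)

lemma AE_pair_pos: "AE z in \<mu> \<Otimes>\<^sub>M sweep_measure r j. fst z > 0"
proof -
  note [measurable_cong] = finite_borel_pair(2)[OF fin finite_borel_sweep] finite_borelD(2)[OF fin]
  interpret pair_sigma_finite \<mu> "sweep_measure r j" by (rule finite_borel_pair(4)[OF fin finite_borel_sweep])
  show ?thesis
  proof (rule AE_pair_measure)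
    show "AE x in \<mu>. AE y in sweep_measure r j. fst (x, y) > 0" using pos by eventually_elim simp
  qed measurable
qed

lemma on_side_swept: "on_side j (swept r j \<mu>)"
  unfolding on_side_def swept_def
proof (subst AE_distr_iff)
  show "AE z in \<mu> \<Otimes>\<^sub>M sweep_measure r j. (- 1) ^ j * ((- 1) ^ j * (fst z * exp (snd z))) > 0"
    using AE_pair_pos by eventually_elim (simp add: mult.assoc[symmetric] power_mult_distrib[symmetric] flip: power_add)
qed measurable

lemma nn_integral_swept:
  assumes [measurable]: "f \<in> borel_measurable borel"
  shows "(\<integral>\<^sup>+t. f t \<partial>swept r j \<mu>) = (\<integral>\<^sup>+x. \<integral>\<^sup>+v. f ((- 1) ^ j * (x * exp v)) \<partial>sweep_measure r j \<partial>\<mu>)"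
proof -
  interpret n: finite_measure "sweep_measure r j" using finite_borelD[OF finite_borel_sweep] by simp
  note [measurable_cong] = finite_borel_pair(2)[OF fin finite_borel_sweep]
  have "(\<integral>\<^sup>+t. f t \<partial>swept r j \<mu>) = (\<integral>\<^sup>+z. f ((- 1) ^ j * (fst z * exp (snd z))) \<partial>(\<mu> \<Otimes>\<^sub>M sweep_measure r j))"
    unfolding swept_def by (subst nn_integral_distr) auto
  also have "\<dots> = (\<integral>\<^sup>+x. \<integral>\<^sup>+v. f ((- 1) ^ j * (x * exp v)) \<partial>sweep_measure r j \<partial>\<mu>)"
    by (subst n.nn_integral_fst[symmetric]) auto
  finally show ?thesis .
qed

text \<open>Two applications of \<open>nn_integral_swept\<close> reduce the energy to \<open>\<mu>\<close>: the inner one is bounded by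
\<open>sweep_kernel_bound\<close> in terms of the scale, and sweeping the other variable shifts the scale by \<open>\<bar>v\<bar>\<close>, which
has a finite mean. The scale itself is integrable because the energy and the logarithmic moment of \<open>\<mu>\<close> are
finite.\<close>

lemma log_compatible_swept:
  assumes lc: "log_compatible \<mu> \<mu>"
  shows "log_compatible (swept r j \<mu>) (swept r j \<mu>)"
proof -
  let ?S = "sweep_measure r j" and ?\<beta> = "swept r j \<mu>" and ?s = "(- 1 :: real) ^ j"
  interpret m: finite_measure \<mu> using finite_borelD[OF fin] by simp
  interpret S: finite_measure ?S using finite_borelD[OF finite_borel_sweep] by simp
  interpret b: finite_measure ?\<beta> using finite_borelD[OF finite_borel_swept] by simp
  interpret mm: pair_sigma_finite \<mu> \<mu> ..
  note [measurable_cong] = finite_borelD(2)[OF fin] finite_borelD(2)[OF finite_borel_sweep] finite_borelD(2)[OF finite_borel_swept]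
  obtain K where K: "K \<ge> 0" "\<And>x y. x > 0 \<Longrightarrow> y > 0 \<Longrightarrow>
      (\<integral>\<^sup>+v. ennreal \<bar>ln \<bar>y - x * exp v\<bar>\<bar> \<partial>?S) \<le> ennreal (K + \<bar>max (ln y) (ln x)\<bar>)"
    using sweep_kernel_bound by blast
  have s2: "?s * ?s = 1" by (simp flip: power_mult_distrib)
  have abs_s: "\<bar>?s * a\<bar> = \<bar>a\<bar>" for a by (simp add: abs_mult)
  have diff_s: "\<bar>?s * a - ?s * b\<bar> = \<bar>a - b\<bar>" for a b
    using abs_s[of "a - b"] by (simp add: right_diff_distrib)
  have at: "emeasure ?\<beta> {t} = 0" for t
  proof -
    have "emeasure ?\<beta> {t} = (\<integral>\<^sup>+y. indicator {t} y \<partial>?\<beta>)" by simp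
    also have "\<dots> = (\<integral>\<^sup>+x. \<integral>\<^sup>+v. indicator {t} (?s * (x * exp v)) \<partial>?S \<partial>\<mu>)"
      by (rule nn_integral_swept) simp
    also have "\<dots> = (\<integral>\<^sup>+x. 0 \<partial>\<mu>)"
    proof (rule nn_integral_cong_AE, use pos in eventually_elim)
      case (elim x)
      have ns: "AE v in ?S. v \<noteq> ln (?s * t / x)"
        unfolding sweep_measure_def using measurable_sweep_density[OF j] AE_lborel_singleton[of "ln (?s * t / x)"]
        by (subst AE_density) auto
      have "AE v in ?S. (indicator {t} (?s * (x * exp v)) :: ennreal) = 0"
        using ns
      proof eventually_elim
        case (elim v)
        have "?s * (x * exp v) \<noteq> t"
        proof
          assume "?s * (x * exp v) = t"
          hence "?s * t = x * exp v" using s2 by (metis mult.assoc mult_1)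
          hence "exp v = ?s * t / x" using \<open>x > 0\<close> by (simp add: field_simps)
          thus False using elim by (metis ln_exp)
        qed
        thus ?case by simp
      qed
      thus ?case by (simp add: nn_integral_0_iff_AE)
    qed
    finally show ?thesis by simp
  qed
  have ae: "AE z in ?\<beta> \<Otimes>\<^sub>M ?\<beta>. fst z \<noteq> snd z" by (intro AE_off_diagonal finite_borel_swept at)
  have inner: "(\<integral>\<^sup>+t'. ennreal \<bar>ln \<bar>t - t'\<bar>\<bar> \<partial>?\<beta>) \<le> (\<integral>\<^sup>+x. ennreal (K + \<bar>max (ln (?s * t)) (ln x)\<bar>) \<partial>\<mu>)" if "?s * t > 0" for t
  proof -
    have "(\<integral>\<^sup>+t'. ennreal \<bar>ln \<bar>t - t'\<bar>\<bar> \<partial>?\<beta>) = (\<integral>\<^sup>+x. \<integral>\<^sup>+v. ennreal \<bar>ln \<bar>t - ?s * (x * exp v)\<bar>\<bar> \<partial>?S \<partial>\<mu>)"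
      by (rule nn_integral_swept) simp
    also have "\<dots> \<le> (\<integral>\<^sup>+x. ennreal (K + \<bar>max (ln (?s * t)) (ln x)\<bar>) \<partial>\<mu>)"
    proof (rule nn_integral_mono_AE, use pos in eventually_elim)
      case (elim x)
      have "t = ?s * (?s * t)" using s2 by (metis mult.assoc mult_1)
      hence "\<bar>t - ?s * (x * exp v)\<bar> = \<bar>?s * t - x * exp v\<bar>" for v using diff_s[of "?s * t" "x * exp v"] by simp
      thus ?case using K(2)[OF elim that] by simp
    qed
    finally show ?thesis .
  qed
  have mlog: "integrable (\<mu> \<Otimes>\<^sub>M \<mu>) (\<lambda>z. \<bar>max (ln (fst z)) (ln (snd z))\<bar>)"
  proof (rule Bochner_Integration.integrable_bound)
    show "integrable (\<mu> \<Otimes>\<^sub>M \<mu>) (\<lambda>z. \<bar>ln \<bar>fst z - snd z\<bar>\<bar> + ln (1 + \<bar>fst z\<bar>) + ln (1 + \<bar>snd z\<bar>))"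
      using lc integrable_fst_pair[OF fin fin log_moment[OF fin lc]] integrable_snd_pair[OF fin fin log_moment[OF fin lc]]
      by (auto simp: log_compatible_def)
    have p1: "AE z in \<mu> \<Otimes>\<^sub>M \<mu>. fst z > 0"
      by (rule mm.AE_pair_measure) (use pos in auto)
    have p2: "AE z in \<mu> \<Otimes>\<^sub>M \<mu>. snd z > 0"
      by (rule mm.AE_pair_measure) (use pos in auto)
    have p3: "AE z in \<mu> \<Otimes>\<^sub>M \<mu>. fst z \<noteq> snd z" using lc by (simp add: log_compatible_def)
    show "AE z in \<mu> \<Otimes>\<^sub>M \<mu>. norm \<bar>max (ln (fst z)) (ln (snd z))\<bar> \<le> norm (\<bar>ln \<bar>fst z - snd z\<bar>\<bar> + ln (1 + \<bar>fst z\<bar>) + ln (1 + \<bar>snd z\<bar>))"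
      using p1 p2 p3
    proof eventually_elim
      case (elim z)
      thus ?case using ln_abs_diff_bound(2)[of "fst z" "snd z"] by simp
    qed
  qed measurable
  define W where "W = (\<integral>\<^sup>+x'. \<integral>\<^sup>+x. ennreal \<bar>max (ln x') (ln x)\<bar> \<partial>\<mu> \<partial>\<mu>)"
  have W: "W < \<infinity>"
  proof -
    have "W = (\<integral>\<^sup>+z. ennreal \<bar>max (ln (fst z)) (ln (snd z))\<bar> \<partial>(\<mu> \<Otimes>\<^sub>M \<mu>))"
      unfolding W_def by (subst m.nn_integral_fst[symmetric]) auto
    thus ?thesis using mlog by (simp add: integrable_iff_bounded)
  qed
  define M where "M = (\<integral>\<^sup>+v. ennreal \<bar>v\<bar> \<partial>?S)"
  have M: "M < \<infinity>"
  proof -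
    have "integrable ?S (\<lambda>v. \<bar>v\<bar>)" using integrable_sweep_iff(1)[of abs] sweep_density_first_moment[OF j] by simp
    thus ?thesis by (simp add: M_def integrable_iff_bounded)
  qed
  let ?m = "emeasure \<mu> UNIV" and ?c = "emeasure ?S UNIV"
  have sp: "space \<mu> = UNIV" "space ?S = UNIV" using finite_borelD fin finite_borel_sweep by auto
  have "(\<integral>\<^sup>+z. ennreal (norm (ln \<bar>fst z - snd z\<bar>)) \<partial>(?\<beta> \<Otimes>\<^sub>M ?\<beta>)) = (\<integral>\<^sup>+t. \<integral>\<^sup>+t'. ennreal \<bar>ln \<bar>t - t'\<bar>\<bar> \<partial>?\<beta> \<partial>?\<beta>)"
    by (subst b.nn_integral_fst[symmetric]) auto
  also have "\<dots> \<le> (\<integral>\<^sup>+t. \<integral>\<^sup>+x. ennreal (K + \<bar>max (ln (?s * t)) (ln x)\<bar>) \<partial>\<mu> \<partial>?\<beta>)"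
    using on_side_swept inner unfolding on_side_def
    by (intro nn_integral_mono_AE) (auto elim!: eventually_mono)
  also have "\<dots> = (\<integral>\<^sup>+x'. \<integral>\<^sup>+v'. \<integral>\<^sup>+x. ennreal (K + \<bar>max (ln (?s * (?s * (x' * exp v')))) (ln x)\<bar>) \<partial>\<mu> \<partial>?S \<partial>\<mu>)"
    by (rule nn_integral_swept) measurable
  also have "\<dots> \<le> (\<integral>\<^sup>+x'. \<integral>\<^sup>+v'. \<integral>\<^sup>+x. (ennreal K + ennreal \<bar>v'\<bar>) + ennreal \<bar>max (ln x') (ln x)\<bar> \<partial>\<mu> \<partial>?S \<partial>\<mu>)"
  proof (rule nn_integral_mono_AE, use pos in eventually_elim)
    case (elim x')
    show ?case
    proof (intro nn_integral_mono)
      fix v' x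
      have "ln (?s * (?s * (x' * exp v'))) = ln x' + v'" using s2 elim by (simp add: mult.assoc[symmetric] ln_mult)
      moreover have "\<bar>max (ln x' + v') (ln x)\<bar> \<le> \<bar>max (ln x') (ln x)\<bar> + \<bar>v'\<bar>"
        using abs_max_shift[of "ln x" "ln x'" v'] by (simp add: max.commute)
      ultimately have "K + \<bar>max (ln (?s * (?s * (x' * exp v')))) (ln x)\<bar> \<le> (K + \<bar>v'\<bar>) + \<bar>max (ln x') (ln x)\<bar>" by simp
      hence "ennreal (K + \<bar>max (ln (?s * (?s * (x' * exp v')))) (ln x)\<bar>) \<le> ennreal ((K + \<bar>v'\<bar>) + \<bar>max (ln x') (ln x)\<bar>)" by (rule ennreal_leI)
      thus "ennreal (K + \<bar>max (ln (?s * (?s * (x' * exp v')))) (ln x)\<bar>) \<le> (ennreal K + ennreal \<bar>v'\<bar>) + ennreal \<bar>max (ln x') (ln x)\<bar>"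
        using K(1) by (simp add: ennreal_plus)
    qed
  qed
  also have "\<dots> = (ennreal K * ?c + M) * ?m * ?m + W * ?c"
  proof -
    have inn: "(\<integral>\<^sup>+v'. \<integral>\<^sup>+x. (ennreal K + ennreal \<bar>v'\<bar>) + ennreal \<bar>max (ln x') (ln x)\<bar> \<partial>\<mu> \<partial>?S)
      = (ennreal K * ?c + M) * ?m + (\<integral>\<^sup>+x. ennreal \<bar>max (ln x') (ln x)\<bar> \<partial>\<mu>) * ?c" for x'
      by (simp add: nn_integral_add nn_integral_multc nn_integral_const sp M_def[symmetric])
    show ?thesis unfolding inn by (simp add: nn_integral_add nn_integral_multc sp W_def)
  qed
  also have "\<dots> < \<infinity>" using W M m.emeasure_finite S.emeasure_finite
    by (auto simp: ennreal_mult_less_top less_top[symmetric] sp ennreal_mult_eq_top_iff)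
  finally have "integrable (?\<beta> \<Otimes>\<^sub>M ?\<beta>) (\<lambda>z. ln \<bar>fst z - snd z\<bar>)" by (intro integrableI_bounded) auto
  with ae show ?thesis by (simp add: log_compatible_def)
qed

end

end

section \<open>Optimal completion of a given first component\<close>

lemma swept_potential_measurable [measurable]:
  "(\<lambda>x. swept_potential r j e x y) \<in> borel_measurable borel"
  unfolding swept_potential_def by measurable

lemma integral_sweep_log:
  assumes j: "1 \<le> j" "j < r" and x: "x > 0" and y: "(- 1) ^ i * y > 0"
  shows "(\<integral>v. ln \<bar>y - (- 1) ^ j * (x * exp v)\<bar> \<partial>sweep_measure r j) =
    swept_potential r j (if even (i + j) then 0 else 1) x \<bar>y\<bar>"
proof -
  have y': "\<bar>y\<bar> > 0" using y by auto
  have ay: "y = (- 1) ^ i * \<bar>y\<bar>" using y by (cases "even i") auto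
  have "(\<integral>v. ln \<bar>y - (- 1) ^ j * (x * exp v)\<bar> \<partial>sweep_measure r j)
      = (LBINT v. ln \<bar>y - (- 1) ^ j * (x * exp v)\<bar> * sweep_density r j v)"
    by (rule integrable_sweep_iff(2)[OF j]) measurable
  also have "\<dots> = swept_potential r j (if even (i + j) then 0 else 1) x \<bar>y\<bar>"
  proof (cases "even (i + j)")
    case True
    hence "\<bar>y - (- 1) ^ j * (x * exp v)\<bar> = \<bar>\<bar>y\<bar> - x * exp v\<bar>" for v
      by (subst ay) (auto simp: even_add)
    thus ?thesis using swept_potential_same_side[OF j x y'] True by (simp add: has_bochner_integral_iff)
  next
    case False
    hence "\<bar>y - (- 1) ^ j * (x * exp v)\<bar> = \<bar>y\<bar> + x * exp v" for v
      using mult_pos_pos[OF x exp_gt_zero, of v] y by (cases "even i") auto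
    thus ?thesis using swept_potential_opposite_side[OF j x y'] False by (simp add: has_bochner_integral_iff)
  qed
  finally show ?thesis .
qed

definition vector_log_energy :: "nat \<Rightarrow> (nat \<Rightarrow> real measure) \<Rightarrow> real" where
  "vector_log_energy r m = (\<Sum>j<r. log_inner (m j) (m j)) - (\<Sum>j<r - 1. log_inner (m j) (m (j + 1)))"

text \<open>The candidate for the optimal vector with first component \<open>\<mu>\<close>.\<close>

definition lift :: "nat \<Rightarrow> real measure \<Rightarrow> nat \<Rightarrow> real measure" where
  "lift r \<mu> j = (if j = 0 then \<mu> else swept r j \<mu>)"

locale lifted_measure =
  fixes r :: nat and \<mu> :: "real measure"
  assumes r: "r \<ge> 1" and fin: "finite_borel \<mu>" and pos: "AE x in \<mu>. x > 0" and lc: "log_compatible \<mu> \<mu>"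
begin

lemma finite_borel_lift: "j < r \<Longrightarrow> finite_borel (lift r \<mu> j)"
  using finite_borel_swept[of j r, OF _ _ fin pos] fin by (auto simp: lift_def)

lemma log_compatible_lift: "j < r \<Longrightarrow> log_compatible (lift r \<mu> j) (lift r \<mu> j)"
  using log_compatible_swept[of j r, OF _ _ fin pos lc] lc by (auto simp: lift_def)

lemma on_side_lift: "j < r \<Longrightarrow> on_side j (lift r \<mu> j)"
  using on_side_swept[of j r, OF _ _ fin pos] pos by (auto simp: lift_def on_side_def)

lemma measure_lift: "j < r \<Longrightarrow> measure (lift r \<mu> j) UNIV = (1 - j / r) * measure \<mu> UNIV"
  using measure_swept[of j r, OF _ _ fin pos] by (auto simp: lift_def)

text \<open>As in \<open>swept_potential\<close>, the argument \<open>e\<close> tells on which side of the origin the point \<open>y\<close> lies relative to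
the \<open>j\<close>-th half-line.\<close>

definition lift_potential :: "nat \<Rightarrow> nat \<Rightarrow> real \<Rightarrow> real" where
  "lift_potential j e y = (\<integral>x. swept_potential r j e x \<bar>y\<bar> \<partial>\<mu>)"

text \<open>Fubini's theorem, with \<open>integral_sweep_log\<close> for the innermost integral. For \<open>j = 0\<close> nothing is swept, and the
explicit formula is the potential of \<open>\<mu>\<close> only on the opposite half-line; hence the last assumption.\<close>

lemma log_inner_lift:
  assumes j: "j < r" and \<alpha>: "finite_borel \<alpha>" "log_compatible \<alpha> \<alpha>" "on_side i \<alpha>"
    and e: "e = (if even (i + j) then 0 else 1 :: nat)" and j0: "j = 0 \<Longrightarrow> odd i"
  shows "has_bochner_integral \<alpha> (lift_potential j e) (- log_inner \<alpha> (lift r \<mu> j))"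
    and "AE y in \<alpha>. integrable \<mu> (\<lambda>x. swept_potential r j e x \<bar>y\<bar>)"
proof -
  let ?\<beta> = "lift r \<mu> j"
  note f\<beta> = finite_borel_lift[OF j]
  interpret ab: pair_sigma_finite \<alpha> ?\<beta> by (rule finite_borel_pair(4)[OF \<alpha>(1) f\<beta>])
  interpret m: finite_measure \<mu> using finite_borelD[OF fin] by simp
  note [measurable_cong] = finite_borelD(2)[OF \<alpha>(1)] finite_borelD(2)[OF fin]
  have lcab: "log_compatible \<alpha> ?\<beta>" by (rule log_compatible_cross[OF \<alpha>(1) f\<beta> \<alpha>(2) log_compatible_lift[OF j]])
  hence int: "integrable (\<alpha> \<Otimes>\<^sub>M ?\<beta>) (\<lambda>(y, t). ln \<bar>y - t\<bar>)" by (simp add: log_compatible_def split_beta')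
  have aey: "AE y in \<alpha>. integrable ?\<beta> (\<lambda>t. ln \<bar>y - t\<bar>)" using ab.AE_integrable_fst[OF int] by simp
  have inner: "integrable \<mu> (\<lambda>x. swept_potential r j e x \<bar>y\<bar>) \<and> (\<integral>t. ln \<bar>y - t\<bar> \<partial>?\<beta>) = lift_potential j e y"
    if y: "integrable ?\<beta> (\<lambda>t. ln \<bar>y - t\<bar>)" "(- 1) ^ i * y > 0" for y
  proof (cases "j = 0")
    case True
    have e1: "e = 1" using e j0 True by simp
    have y0: "y < 0" using y(2) j0[OF True] by simp
    have eq: "AE x in \<mu>. ln \<bar>y - x\<bar> = swept_potential r j e x \<bar>y\<bar>"
      using pos
    proof eventually_elim
      case (elim x)
      thus ?case using swept_potential_zero[OF r, of x "\<bar>y\<bar>"] y0 e1 True by (simp add: abs_if algebra_simps)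
    qed
    have i: "integrable \<mu> (\<lambda>x. ln \<bar>y - x\<bar>)" using y(1) True by (simp add: lift_def)
    have "integrable \<mu> (\<lambda>x. swept_potential r j e x \<bar>y\<bar>)"
      by (rule integrable_cong_AE_imp[OF i _ eq]) measurable
    moreover have "(\<integral>t. ln \<bar>y - t\<bar> \<partial>\<mu>) = lift_potential j e y"
      unfolding lift_potential_def by (rule integral_cong_AE) (use eq in auto)
    ultimately show ?thesis using True by (simp add: lift_def)
  next
    case False
    hence j': "1 \<le> j" "j < r" using j by auto
    let ?S = "sweep_measure r j" and ?g = "\<lambda>z. (- 1) ^ j * (fst z * exp (snd z))"
    note fS = finite_borel_sweep[OF j']
    interpret ms: pair_sigma_finite \<mu> ?S by (rule finite_borel_pair(4)[OF fin fS])
    note [measurable_cong] = finite_borel_pair(2)[OF fin fS]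
    have gm: "?g \<in> borel_measurable (\<mu> \<Otimes>\<^sub>M ?S)" by measurable
    have \<beta>: "?\<beta> = distr (\<mu> \<Otimes>\<^sub>M ?S) borel ?g" using False by (simp add: lift_def swept_def)
    have i2: "integrable (\<mu> \<Otimes>\<^sub>M ?S) (\<lambda>(x, v). ln \<bar>y - (- 1) ^ j * (x * exp v)\<bar>)"
      using y(1) unfolding \<beta> by (subst (asm) integrable_distr_eq[OF gm]) (auto simp: split_beta')
    have "(\<integral>t. ln \<bar>y - t\<bar> \<partial>?\<beta>) = (\<integral>z. ln \<bar>y - ?g z\<bar> \<partial>(\<mu> \<Otimes>\<^sub>M ?S))"
      unfolding \<beta> by (rule integral_distr[OF gm]) simp
    also have "\<dots> = (\<integral>x. \<integral>v. ln \<bar>y - (- 1) ^ j * (x * exp v)\<bar> \<partial>?S \<partial>\<mu>)"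
      using ms.integral_fst'[OF i2] by (simp add: split_beta')
    finally have I: "(\<integral>t. ln \<bar>y - t\<bar> \<partial>?\<beta>) = (\<integral>x. \<integral>v. ln \<bar>y - (- 1) ^ j * (x * exp v)\<bar> \<partial>?S \<partial>\<mu>)" .
    have i3: "integrable \<mu> (\<lambda>x. \<integral>v. ln \<bar>y - (- 1) ^ j * (x * exp v)\<bar> \<partial>?S)"
      using ms.integrable_fst'[OF i2] by simp
    have eq: "AE x in \<mu>. (\<integral>v. ln \<bar>y - (- 1) ^ j * (x * exp v)\<bar> \<partial>?S) = swept_potential r j e x \<bar>y\<bar>"
      using pos by eventually_elim (use integral_sweep_log[OF j' _ y(2)] e in auto)
    have "integrable \<mu> (\<lambda>x. swept_potential r j e x \<bar>y\<bar>)"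
      by (rule integrable_cong_AE_imp[OF i3 _ eq]) measurable
    moreover have "(\<integral>t. ln \<bar>y - t\<bar> \<partial>?\<beta>) = lift_potential j e y"
      unfolding I lift_potential_def
      by (rule integral_cong_AE) (use eq borel_measurable_integrable[OF i3] in auto)
    ultimately show ?thesis by simp
  qed
  have side: "AE y in \<alpha>. (- 1) ^ i * y > 0" using \<alpha>(3) by (simp add: on_side_def)
  show "AE y in \<alpha>. integrable \<mu> (\<lambda>x. swept_potential r j e x \<bar>y\<bar>)"
    using aey side by eventually_elim (use inner in auto)
  have ae: "AE y in \<alpha>. (\<integral>t. ln \<bar>y - t\<bar> \<partial>?\<beta>) = lift_potential j e y"
    using aey side by eventually_elim (use inner in auto)
  have i4: "integrable \<alpha> (\<lambda>y. \<integral>t. ln \<bar>y - t\<bar> \<partial>?\<beta>)" using ab.integrable_fst'[OF int] by simp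
  have [measurable]: "lift_potential j e \<in> borel_measurable borel"
    unfolding lift_potential_def swept_potential_def by measurable
  have i5: "integrable \<alpha> (lift_potential j e)" by (rule integrable_cong_AE_imp[OF i4 _ ae]) measurable
  have "integral\<^sup>L \<alpha> (lift_potential j e) = (\<integral>y. \<integral>t. ln \<bar>y - t\<bar> \<partial>?\<beta> \<partial>\<alpha>)"
    by (rule integral_cong_AE) (use ae i4 in \<open>auto elim: eventually_mono\<close>)
  also have "\<dots> = - log_inner \<alpha> ?\<beta>"
    using ab.integral_fst'[OF int] by (simp add: log_inner_def split_beta')
  finally show "has_bochner_integral \<alpha> (lift_potential j e) (- log_inner \<alpha> (lift r \<mu> j))"
    using i5 by (simp add: has_bochner_integral_iff)
qed

text \<open>The Euler--Lagrange equation, integrated against an arbitrary measure on the \<open>j\<close>-th half-line. For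
\<open>j + 1 = r\<close> the last term is missing because the formula for the potential gives \<open>0\<close> at the index \<open>r\<close>.\<close>

lemma lift_balance:
  assumes j: "1 \<le> j" "j < r" and \<alpha>: "finite_borel \<alpha>" "log_compatible \<alpha> \<alpha>" "on_side j \<alpha>"
  shows "2 * log_inner \<alpha> (lift r \<mu> j) =
    log_inner \<alpha> (lift r \<mu> (j - 1)) + (if j + 1 < r then log_inner \<alpha> (lift r \<mu> (j + 1)) else 0)"
proof -
  let ?p = "lift_potential"
  have 0: "has_bochner_integral \<alpha> (?p j 0) (- log_inner \<alpha> (lift r \<mu> j))"
    "AE y in \<alpha>. integrable \<mu> (\<lambda>x. swept_potential r j 0 x \<bar>y\<bar>)"
    by (rule log_inner_lift[OF j(2) \<alpha>]; use j in simp)+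
  have m: "has_bochner_integral \<alpha> (?p (j - 1) 1) (- log_inner \<alpha> (lift r \<mu> (j - 1)))"
    "AE y in \<alpha>. integrable \<mu> (\<lambda>x. swept_potential r (j - 1) 1 x \<bar>y\<bar>)"
    using j by (auto intro!: log_inner_lift[OF _ \<alpha>])
  have p: "has_bochner_integral \<alpha> (?p (j + 1) 1) (- (if j + 1 < r then log_inner \<alpha> (lift r \<mu> (j + 1)) else 0))
     \<and> (AE y in \<alpha>. integrable \<mu> (\<lambda>x. swept_potential r (j + 1) 1 x \<bar>y\<bar>))"
  proof (cases "j + 1 < r")
    case True
    show ?thesis unfolding if_P[OF True] by (intro conjI; rule log_inner_lift[OF True \<alpha>]; simp)
  next
    case False
    hence "j + 1 = r" using j by simp
    hence "swept_potential r (j + 1) 1 x y = 0" for x y using swept_potential_top[of r 1 x y] r by simp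
    thus ?thesis using False by (simp add: lift_potential_def[abs_def] has_bochner_integral_zero)
  qed
  note p1 = conjunct1[OF p] and p2 = conjunct2[OF p]
  have ae: "AE y in \<alpha>. 2 * ?p j 0 y = ?p (j - 1) 1 y + ?p (j + 1) 1 y"
    using 0(2) m(2) p2
  proof eventually_elim
    case (elim y)
    have "2 * ?p j 0 y = (\<integral>x. 2 * swept_potential r j 0 x \<bar>y\<bar> \<partial>\<mu>)" by (simp add: lift_potential_def)
    also have "\<dots> = (\<integral>x. swept_potential r (j - 1) 1 x \<bar>y\<bar> + swept_potential r (j + 1) 1 x \<bar>y\<bar> \<partial>\<mu>)"
      unfolding swept_potential_balance[OF j] ..
    also have "\<dots> = ?p (j - 1) 1 y + ?p (j + 1) 1 y"
      using elim(2,3) by (simp add: lift_potential_def)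
    finally show ?case .
  qed
  have "(\<integral>y. 2 * ?p j 0 y \<partial>\<alpha>) = (\<integral>y. ?p (j - 1) 1 y + ?p (j + 1) 1 y \<partial>\<alpha>)"
    by (rule integral_cong_AE) (use ae 0(1) m(1) p1 in \<open>auto simp: has_bochner_integral_iff\<close>)
  thus ?thesis using 0(1) m(1) p1 by (simp add: has_bochner_integral_iff)
qed

definition root_inner :: real where
  "root_inner = - (\<integral>z. ln \<bar>root r (fst z) - root r (snd z)\<bar> \<partial>(\<mu> \<Otimes>\<^sub>M \<mu>))"

text \<open>With \<open>a > b > 0\<close> the roots, \<open>a ^ r - b ^ r\<close> lies between \<open>(a - b) * a ^ (r - 1)\<close> and \<open>r\<close> times this number.\<close>

lemma ln_root_diff_bound:
  assumes xy: "x > 0" "y > 0" "x \<noteq> y"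
  shows "\<bar>ln \<bar>root r x - root r y\<bar>\<bar> \<le> \<bar>ln \<bar>x - y\<bar>\<bar> + ln r + \<bar>max (ln x) (ln y)\<bar>"
  using xy
proof (induction x y rule: linorder_wlog)
  case (sym x y)
  thus ?case by (simp add: abs_minus_commute max.commute)
next
  case (le y x)
  define a b where "a = root r x" and "b = root r y"
  have r0: "r > 0" using r by simp
  have ab: "b > 0" "a > b" "x = a ^ r" "y = b ^ r" using le r0 by (auto simp: a_def b_def)
  have d: "x - y > 0" using le by simp
  have sum: "x - y = (a - b) * (\<Sum>i<r. b ^ (r - Suc i) * a ^ i)"
    unfolding ab(3,4) by (rule power_diff_sumr2)
  have "b ^ (r - Suc i) * a ^ i \<le> a ^ (r - 1)" if "i < r" for i
  proof -
    have "b ^ (r - Suc i) * a ^ i \<le> a ^ (r - Suc i) * a ^ i" using ab by (intro mult_right_mono power_mono) auto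
    also have "\<dots> = a ^ (r - 1)" using that by (simp flip: power_add)
    finally show ?thesis .
  qed
  hence "(\<Sum>i<r. b ^ (r - Suc i) * a ^ i) \<le> (\<Sum>i<r. a ^ (r - 1))" by (intro sum_mono) auto
  hence up: "x - y \<le> (a - b) * (r * a ^ (r - 1))" unfolding sum using ab by (intro mult_left_mono) auto
  have "b ^ (r - Suc (r - 1)) * a ^ (r - 1) \<le> (\<Sum>i<r. b ^ (r - Suc i) * a ^ i)"
    using ab r0 by (intro member_le_sum) auto
  hence lo: "(a - b) * a ^ (r - 1) \<le> x - y" unfolding sum using ab r0 by (intro mult_left_mono) auto
  have lp: "ln (a ^ (r - 1)) = (r - 1) * ln a" using ab by (simp add: ln_realpow)
  have lx: "ln x = r * ln a" using ab by (simp add: ln_realpow)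
  have "ln (x - y) \<le> ln ((a - b) * (r * a ^ (r - 1)))" using up d ab r0 by (subst ln_le_cancel_iff) auto
  also have "\<dots> = ln (a - b) + (ln r + (r - 1) * ln a)" using ab r0 lp by (simp add: ln_mult_pos)
  finally have 1: "ln (x - y) \<le> ln (a - b) + (ln r + (r - 1) * ln a)" .
  have "ln ((a - b) * a ^ (r - 1)) \<le> ln (x - y)" using lo d ab by (subst ln_le_cancel_iff) auto
  hence 2: "ln (a - b) + (r - 1) * ln a \<le> ln (x - y)" using ab lp by (simp add: ln_mult_pos)
  have 3: "\<bar>(r - 1) * ln a\<bar> \<le> \<bar>ln x\<bar>" unfolding lx abs_mult by (intro mult_right_mono) auto
  have "max (ln x) (ln y) = ln x" using le by simp
  moreover have "ln r \<ge> 0" using r by simp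
  ultimately have "\<bar>ln (a - b)\<bar> \<le> \<bar>ln (x - y)\<bar> + ln r + \<bar>ln x\<bar>" using 1 2 3 by linarith
  moreover have "\<bar>root r y - root r x\<bar> = a - b" "\<bar>y - x\<bar> = x - y"
    unfolding a_def[symmetric] b_def[symmetric] using ab(2) d by simp_all
  ultimately show ?case using \<open>max (ln x) (ln y) = ln x\<close> by (simp add: max.commute)
qed

lemma AE_pair_good: "AE z in \<mu> \<Otimes>\<^sub>M \<mu>. fst z > 0 \<and> snd z > 0 \<and> fst z \<noteq> snd z"
proof -
  interpret mm: pair_sigma_finite \<mu> \<mu> by (rule finite_borel_pair(4)[OF fin fin])
  note [measurable_cong] = finite_borelD(2)[OF fin]
  have "AE z in \<mu> \<Otimes>\<^sub>M \<mu>. fst z > 0" by (rule mm.AE_pair_measure) (use pos in auto)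
  moreover have "AE z in \<mu> \<Otimes>\<^sub>M \<mu>. snd z > 0" by (rule mm.AE_pair_measure) (use pos in auto)
  moreover have "AE z in \<mu> \<Otimes>\<^sub>M \<mu>. fst z \<noteq> snd z" using lc by (simp add: log_compatible_def)
  ultimately show ?thesis by eventually_elim simp
qed

lemma integrable_root_log: "integrable (\<mu> \<Otimes>\<^sub>M \<mu>) (\<lambda>z. ln \<bar>root r (fst z) - root r (snd z)\<bar>)"
proof -
  note [measurable_cong] = finite_borelD(2)[OF fin]
  interpret P: finite_measure "\<mu> \<Otimes>\<^sub>M \<mu>" by (rule finite_borel_pair(1)[OF fin fin])
  have [measurable]: "root r \<in> borel_measurable borel" by (intro borel_measurable_continuous_onI continuous_intros)
  show ?thesis
  proof (rule Bochner_Integration.integrable_bound)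
    show "integrable (\<mu> \<Otimes>\<^sub>M \<mu>) (\<lambda>z. 2 * \<bar>ln \<bar>fst z - snd z\<bar>\<bar> + ln r + ln (1 + \<bar>fst z\<bar>) + ln (1 + \<bar>snd z\<bar>))"
      using lc integrable_fst_pair[OF fin fin log_moment[OF fin lc]] integrable_snd_pair[OF fin fin log_moment[OF fin lc]]
      by (auto simp: log_compatible_def)
    show "AE z in \<mu> \<Otimes>\<^sub>M \<mu>. norm (ln \<bar>root r (fst z) - root r (snd z)\<bar>) \<le> norm (2 * \<bar>ln \<bar>fst z - snd z\<bar>\<bar> + ln r + ln (1 + \<bar>fst z\<bar>) + ln (1 + \<bar>snd z\<bar>))"
      using AE_pair_good
    proof eventually_elim
      case (elim z)
      have "\<bar>ln \<bar>root r (fst z) - root r (snd z)\<bar>\<bar> \<le> 2 * \<bar>ln \<bar>fst z - snd z\<bar>\<bar> + ln r + ln (1 + fst z) + ln (1 + snd z)"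
        using ln_root_diff_bound[of "fst z" "snd z"] ln_abs_diff_bound(2)[of "fst z" "snd z"] elim by simp
      thus ?case using elim by simp
    qed
  qed measurable
qed

text \<open>The integrated form of \<open>swept_potential_one\<close>; it introduces the \<open>r\<close>-th roots.\<close>

lemma log_inner_first_lift:
  assumes "r \<ge> 2"
  shows "log_inner \<mu> (lift r \<mu> 1) = log_inner \<mu> \<mu> - root_inner"
proof -
  interpret mm: pair_sigma_finite \<mu> \<mu> by (rule finite_borel_pair(4)[OF fin fin])
  note [measurable_cong] = finite_borelD(2)[OF fin]
  have [measurable]: "root r \<in> borel_measurable borel" by (intro borel_measurable_continuous_onI continuous_intros)
  have h: "has_bochner_integral \<mu> (lift_potential 1 1) (- log_inner \<mu> (lift r \<mu> 1))"
    by (rule log_inner_lift[where i = 0]) (use assms fin lc pos in \<open>auto simp: on_side_def\<close>)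
  let ?d = "\<lambda>(y, x). ln \<bar>y - x\<bar> - ln \<bar>root r y - root r x\<bar>"
  have i: "integrable (\<mu> \<Otimes>\<^sub>M \<mu>) ?d"
    using lc integrable_root_log by (auto simp: log_compatible_def split_beta')
  have "AE y in \<mu>. AE x in \<mu>. x \<noteq> y"
  proof (rule AE_I2)
    fix y
    have "{y} \<in> null_sets \<mu>" using no_atoms[OF fin lc, of y] by (simp add: null_sets_def finite_borelD(2)[OF fin])
    thus "AE x in \<mu>. x \<noteq> y" by (rule AE_I') auto
  qed
  hence ae: "AE y in \<mu>. lift_potential 1 1 y = (\<integral>x. ln \<bar>y - x\<bar> - ln \<bar>root r y - root r x\<bar> \<partial>\<mu>)"
    using pos
  proof eventually_elim
    case (elim y)
    show ?case unfolding lift_potential_def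
    proof (rule integral_cong_AE)
      show "AE x in \<mu>. swept_potential r 1 1 x \<bar>y\<bar> = ln \<bar>y - x\<bar> - ln \<bar>root r y - root r x\<bar>"
        using elim(1) pos by eventually_elim (use elim(2) swept_potential_one[OF r] in auto)
    qed measurable
  qed
  have "- log_inner \<mu> (lift r \<mu> 1) = (\<integral>y. lift_potential 1 1 y \<partial>\<mu>)" using h by (simp add: has_bochner_integral_iff)
  also have "\<dots> = (\<integral>y. \<integral>x. ?d (y, x) \<partial>\<mu> \<partial>\<mu>)"
    by (rule integral_cong_AE) (use h ae mm.integrable_fst'[OF i] in \<open>auto simp: has_bochner_integral_iff\<close>)
  also have "\<dots> = (\<integral>z. ?d z \<partial>(\<mu> \<Otimes>\<^sub>M \<mu>))" by (rule mm.integral_fst'[OF i])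
  also have "\<dots> = - log_inner \<mu> \<mu> + root_inner"
    using lc integrable_root_log by (simp add: log_inner_def root_inner_def log_compatible_def split_beta')
  finally show ?thesis by simp
qed

text \<open>The linear part of the functional at the lift. Summing the balance equations of the components \<open>m 1\<close>, ...,
\<open>m (r - 1)\<close> cancels all their terms; what is left involves the first component only, and so the value
does not depend on the other components of \<open>m\<close>.\<close>

lemma lift_cross_energy:
  assumes m: "\<And>j. j < r \<Longrightarrow> finite_borel (m j)" "\<And>j. j < r \<Longrightarrow> log_compatible (m j) (m j)"
      "\<And>j. j < r \<Longrightarrow> on_side j (m j)" and m0: "m 0 = \<mu>"
  shows "2 * (\<Sum>j<r. log_inner (m j) (lift r \<mu> j))
      - (\<Sum>j<r - 1. log_inner (m j) (lift r \<mu> (j + 1)) + log_inner (lift r \<mu> j) (m (j + 1)))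
    = log_inner \<mu> \<mu> + root_inner"
proof -
  obtain n where n: "r = Suc n" using r by (cases r) auto
  define A where "A j = log_inner (m j) (lift r \<mu> j)" for j
  define B where "B j = log_inner (m j) (lift r \<mu> (j + 1))" for j
  define C where "C j = log_inner (m (j + 1)) (lift r \<mu> j)" for j
  have C: "log_inner (lift r \<mu> j) (m (j + 1)) = C j" if "j < n" for j
    unfolding C_def using that n by (intro log_inner_commute finite_borel_lift m) auto
  have EL: "2 * A (Suc i) = C i + (if Suc i < n then B (Suc i) else 0)" if "i < n" for i
    using lift_balance[of "Suc i" "m (Suc i)"] that n m by (auto simp: A_def B_def C_def)
  have A0: "A 0 = log_inner \<mu> \<mu>" by (simp add: A_def m0 lift_def)
  \<comment> \<open>The equation of index \<open>Suc i\<close> contributes \<open>B (Suc i)\<close>; only \<open>B 0\<close> is left over, since no equation holds for the first component.\<close>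
  have shift: "B 0 + (\<Sum>i<n. if Suc i < n then B (Suc i) else 0) = (\<Sum>i<n. B i)" if n0: "n > 0"
  proof -
    obtain k where k: "n = Suc k" using n0 by (cases n) auto
    have "(\<Sum>i<Suc k. if Suc i < Suc k then B (Suc i) else 0) = (\<Sum>i<k. B (Suc i))" by simp
    thus ?thesis unfolding k sum.lessThan_Suc_shift[of B k] by simp
  qed
  have "2 * (\<Sum>j<r. A j) = 2 * A 0 + (\<Sum>i<n. 2 * A (Suc i))"
    unfolding n sum.lessThan_Suc_shift by (simp add: sum_distrib_left)
  also have "(\<Sum>i<n. 2 * A (Suc i)) = (\<Sum>i<n. C i) + (\<Sum>i<n. if Suc i < n then B (Suc i) else 0)"
    unfolding sum.distrib[symmetric] by (intro sum.cong refl EL) auto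
  finally have S: "2 * (\<Sum>j<r. A j) = 2 * A 0 + ((\<Sum>i<n. C i) + (\<Sum>i<n. if Suc i < n then B (Suc i) else 0))" .
  have "(\<Sum>j<r - 1. log_inner (m j) (lift r \<mu> (j + 1)) + log_inner (lift r \<mu> j) (m (j + 1))) = (\<Sum>i<n. B i) + (\<Sum>i<n. C i)"
    unfolding sum.distrib[symmetric] using n C by (intro sum.cong) (auto simp: B_def)
  moreover have "2 * A 0 + (\<Sum>i<n. if Suc i < n then B (Suc i) else 0) - (\<Sum>i<n. B i) = log_inner \<mu> \<mu> + root_inner"
  proof (cases "n = 0")
    case True
    hence "r = 1" using n by simp
    have "root_inner = - (\<integral>z. ln \<bar>root r (fst z) - root r (snd z)\<bar> \<partial>(\<mu> \<Otimes>\<^sub>M \<mu>))"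
      by (rule root_inner_def)
    also have "\<dots> = log_inner \<mu> \<mu>" using \<open>r = 1\<close> by (simp add: log_inner_def)
    finally have "root_inner = log_inner \<mu> \<mu>" .
    thus ?thesis using True A0 by simp
  next
    case False
    hence "B 0 = log_inner \<mu> \<mu> - root_inner" using log_inner_first_lift n by (simp add: B_def m0)
    thus ?thesis using shift False A0 by simp
  qed
  ultimately show ?thesis using S unfolding A_def[symmetric] by simp
qed

text \<open>For \<open>m = lift r \<mu>\<close> the linear part is twice the quadratic form itself.\<close>

proposition vector_log_energy_lift:
  "vector_log_energy r (lift r \<mu>) = (log_inner \<mu> \<mu> + root_inner) / 2"
proof -
  have "2 * vector_log_energy r (lift r \<mu>) = log_inner \<mu> \<mu> + root_inner"
    unfolding vector_log_energy_def
    using lift_cross_energy[of "lift r \<mu>"] finite_borel_lift log_compatible_lift on_side_lift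
    by (simp add: lift_def[of r \<mu> 0] sum_distrib_left right_diff_distrib)
  thus ?thesis by simp
qed

text \<open>Completing the square at the lift: by \<open>lift_cross_energy\<close> the linear terms do not depend on \<open>m\<close>, so the
energy of \<open>m\<close> exceeds that of the lift by the positive definite form \<open>Q\<close> of the difference.\<close>

proposition vector_log_energy_ge:
  assumes m: "\<And>j. j < r \<Longrightarrow> finite_borel (m j)" "\<And>j. j < r \<Longrightarrow> log_compatible (m j) (m j)"
      "\<And>j. j < r \<Longrightarrow> on_side j (m j)" and m0: "m 0 = \<mu>"
    and mass: "\<And>j. j < r \<Longrightarrow> measure (m j) UNIV = (1 - j / r) * measure \<mu> UNIV"
  shows "(log_inner \<mu> \<mu> + root_inner) / 2 \<le> vector_log_energy r m"
    and "vector_log_energy r m = (log_inner \<mu> \<mu> + root_inner) / 2 \<Longrightarrow> j < r \<Longrightarrow> m j = lift r \<mu> j"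
proof -
  let ?L = "lift r \<mu>"
  define Q where "Q = (\<Sum>j<r. diff_inner (m j) (?L j) (m j) (?L j)) - (\<Sum>j<r - 1. diff_inner (m j) (?L j) (m (j + 1)) (?L (j + 1)))"
  have QQ: "Q = vector_log_energy r m - (log_inner \<mu> \<mu> + root_inner) / 2"
  proof -
    have "(\<Sum>j<r. diff_inner (m j) (?L j) (m j) (?L j)) =
       (\<Sum>j<r. log_inner (m j) (m j) + log_inner (?L j) (?L j) - 2 * log_inner (m j) (?L j))"
      by (intro sum.cong refl) (auto simp: diff_inner_def log_inner_commute[OF finite_borel_lift m(1)])
    moreover have "(\<Sum>j<r - 1. diff_inner (m j) (?L j) (m (j + 1)) (?L (j + 1))) =
       (\<Sum>j<r - 1. log_inner (m j) (m (j + 1)) + log_inner (?L j) (?L (j + 1)) - (log_inner (m j) (?L (j + 1)) + log_inner (?L j) (m (j + 1))))"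
      by (intro sum.cong refl) (auto simp: diff_inner_def)
    ultimately have "Q = vector_log_energy r m + vector_log_energy r ?L -
      (2 * (\<Sum>j<r. log_inner (m j) (?L j)) - (\<Sum>j<r - 1. log_inner (m j) (?L (j + 1)) + log_inner (?L j) (m (j + 1))))"
      unfolding Q_def vector_log_energy_def by (simp add: sum.distrib sum_subtractf sum_distrib_left)
    hence "Q = vector_log_energy r m + (log_inner \<mu> \<mu> + root_inner) / 2 - (log_inner \<mu> \<mu> + root_inner)"
      by (simp only: lift_cross_energy[OF m m0] vector_log_energy_lift)
    thus ?thesis by (simp add: field_simps)
  qed
  have ms: "measure (m j) UNIV = measure (?L j) UNIV" if "j < r" for j using mass measure_lift that by simp
  have c: "log_compatible (m i) (m j)" "log_compatible (m i) (?L j)" "log_compatible (?L i) (m j)"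
      "log_compatible (?L i) (?L j)" if "i < r" "j < r" for i j
    by (rule log_compatible_cross; use that m finite_borel_lift log_compatible_lift in simp)+
  note pd = nikishin_form_pos_def[where \<mu> = m and \<nu> = ?L, OF r m(1) finite_borel_lift ms c, folded Q_def]
  have "Q \<ge> 0" by (rule pd(1))
  moreover have "Q = 0 \<Longrightarrow> j < r \<Longrightarrow> m j = ?L j" for j by (rule pd(2))
  ultimately show "(log_inner \<mu> \<mu> + root_inner) / 2 \<le> vector_log_energy r m"
    "vector_log_energy r m = (log_inner \<mu> \<mu> + root_inner) / 2 \<Longrightarrow> j < r \<Longrightarrow> m j = lift r \<mu> j"
    unfolding QQ by auto
qed

end

section \<open>The scalar functional and the existence of its minimizers\<close>

text \<open>The complement of the support is a union of open null sets, and by Lindelof's theorem countably many of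
them suffice.\<close>

lemma AE_measure_support:
  fixes \<mu> :: "real measure"
  assumes s: "sets \<mu> = sets borel"
  shows "AE x in \<mu>. x \<in> measure_support \<mu>"
proof -
  define F where "F = {U :: real set. open U \<and> emeasure \<mu> U = 0}"
  obtain F' where F': "F' \<subseteq> F" "countable F'" "\<Union>F' = \<Union>F"
    using Lindelof[of F] by (auto simp: F_def)
  have "AE x in \<mu>. \<forall>U\<in>F'. x \<notin> U"
  proof (rule AE_ball_countable[THEN iffD2, OF F'(2)], intro ballI)
    fix U assume "U \<in> F'"
    hence "U \<in> null_sets \<mu>" using F'(1) s by (auto simp: F_def null_sets_def)
    thus "AE x in \<mu>. x \<notin> U" by (rule AE_not_in)
  qed
  thus ?thesis
  proof eventually_elim
    case (elim x)
    hence "x \<notin> \<Union>F" using F'(3) by auto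
    thus ?case by (auto simp: measure_support_def F_def zero_less_iff_neq_zero)
  qed
qed

lemma measure_support_subset_iff:
  fixes \<mu> :: "real measure"
  assumes s: "sets \<mu> = sets borel" and C: "closed C"
  shows "measure_support \<mu> \<subseteq> C \<longleftrightarrow> (AE x in \<mu>. x \<in> C)"
proof
  assume "measure_support \<mu> \<subseteq> C"
  thus "AE x in \<mu>. x \<in> C" using AE_measure_support[OF s] by (auto elim: eventually_mono)
next
  assume ae: "AE x in \<mu>. x \<in> C"
  have "emeasure \<mu> (- C) = 0"
    using ae C s by (subst (asm) AE_iff_measurable[of "- C"]) (auto simp: sets_eq_imp_space_eq[OF s])
  moreover have "open (- C)" using C by (rule open_Compl)
  ultimately show "measure_support \<mu> \<subseteq> C" unfolding measure_support_def by auto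
qed

lemma closed_measure_support: "closed (measure_support \<mu>)"
proof -
  have "- measure_support \<mu> = \<Union>{U. open U \<and> emeasure \<mu> U = 0}"
    by (auto simp: measure_support_def zero_less_iff_neq_zero)
  thus ?thesis by (simp add: closed_def open_Union)
qed

definition half_prob :: "real measure \<Rightarrow> bool" where
  "half_prob \<mu> \<longleftrightarrow> prob_space \<mu> \<and> sets \<mu> = sets borel \<and> (AE x in \<mu>. 0 \<le> x)"

lemma half_line_prob_iff: "half_line_prob \<mu> \<longleftrightarrow> half_prob \<mu>"
  using measure_support_subset_iff[of \<mu> "{0..}"] by (auto simp: half_line_prob_def half_prob_def)

lemma half_probD:
  assumes "half_prob \<mu>"
  shows "prob_space \<mu>" "sets \<mu> = sets borel" "AE x in \<mu>. 0 \<le> x" "finite_borel \<mu>" "measure \<mu> UNIV = 1" "space \<mu> = UNIV"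
proof -
  show *: "prob_space \<mu>" "sets \<mu> = sets borel" "AE x in \<mu>. 0 \<le> x" using assms by (auto simp: half_prob_def)
  interpret prob_space \<mu> by fact
  show "finite_borel \<mu>" using * by (auto simp: finite_borel_def) unfold_locales
  show "space \<mu> = UNIV" using sets_eq_imp_space_eq[OF *(2)] by simp
  thus "measure \<mu> UNIV = 1" using prob_space by simp
qed

lemma ln_diff_le:
  fixes a b x y :: real
  assumes "0 \<le> a" "0 \<le> b" "a \<noteq> b" "a\<^sup>2 \<le> 1 + x\<^sup>2" "b\<^sup>2 \<le> 1 + y\<^sup>2"
  shows "ln \<bar>a - b\<bar> \<le> (ln (1 + x\<^sup>2) + ln (1 + y\<^sup>2)) / 2"
proof -
  have p: "1 + x\<^sup>2 \<ge> 1" "1 + y\<^sup>2 \<ge> 1" by auto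
  hence p1: "0 < 1 + x\<^sup>2" "0 < 1 + y\<^sup>2" by linarith+
  note p0 = p1 mult_pos_pos[OF p1]
  have "\<bar>a - b\<bar>\<^sup>2 \<le> (max a b)\<^sup>2" using assms by (intro power_mono) auto
  also have "\<dots> \<le> (1 + x\<^sup>2) * (1 + y\<^sup>2)"
    using assms(4,5) mult_mono[OF assms(4) p(2)] mult_mono[OF p(1) assms(5)] by (auto simp: max_def)
  finally have "\<bar>a - b\<bar>\<^sup>2 \<le> (1 + x\<^sup>2) * (1 + y\<^sup>2)" .
  hence "ln (\<bar>a - b\<bar>\<^sup>2) \<le> ln ((1 + x\<^sup>2) * (1 + y\<^sup>2))" using assms p p0 by (subst ln_le_cancel_iff) auto
  also have "\<dots> = ln (1 + x\<^sup>2) + ln (1 + y\<^sup>2)" using p1 by (rule ln_mult_pos)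
  also have "ln (\<bar>a - b\<bar>\<^sup>2) = 2 * ln \<bar>a - b\<bar>" using assms by (subst ln_realpow) auto
  finally have "ln \<bar>a - b\<bar> * 2 \<le> ln (1 + x\<^sup>2) + ln (1 + y\<^sup>2)" by (simp only: mult.commute)
  thus ?thesis by (subst pos_le_divide_eq) simp_all
qed

locale external_field =
  fixes r :: nat and V :: "real \<Rightarrow> real"
  assumes r: "r \<ge> 1" and V_cont: "continuous_on {0..} V"
    and V_growth: "filterlim (\<lambda>x. V x - ln (1 + x\<^sup>2)) at_top at_top"
begin

text \<open>\<open>V\<close> is continuous on the half-line only; this extension is continuous everywhere and has the same integrals
against measures on the half-line.\<close>

definition field :: "real \<Rightarrow> real" where "field x = V (max 0 x)"

lemma field_eq: "0 \<le> x \<Longrightarrow> field x = V x"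
  by (simp add: field_def)

lemma continuous_field: "continuous_on UNIV field"
  unfolding field_def[abs_def] by (intro continuous_on_compose2[OF V_cont] continuous_intros) auto

lemma field_measurable [measurable]: "field \<in> borel_measurable borel"
  using continuous_field by (rule borel_measurable_continuous_onI)

lemma continuous_root_r: "continuous_on UNIV (root r)"
  by (intro continuous_intros)

lemma root_r_measurable [measurable]: "root r \<in> borel_measurable borel"
  using continuous_root_r by (rule borel_measurable_continuous_onI)

lemma field_lower_bound: "\<exists>M\<ge>0. \<forall>x\<ge>0. V x - ln (1 + x\<^sup>2) \<ge> - M"
proof -
  obtain T where T: "\<And>x. x \<ge> T \<Longrightarrow> V x - ln (1 + x\<^sup>2) \<ge> 0"
    using V_growth unfolding filterlim_at_top eventually_at_top_linorder by blast
  have "compact {0..max 0 T}" by simp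
  moreover have "continuous_on {0..max 0 T} (\<lambda>x. V x - ln (1 + x\<^sup>2))"
    by (intro continuous_intros continuous_on_subset[OF V_cont]) (auto simp: add_pos_nonneg less_imp_neq[symmetric])
  ultimately obtain x0 where x0: "\<forall>x\<in>{0..max 0 T}. V x0 - ln (1 + x0\<^sup>2) \<le> V x - ln (1 + x\<^sup>2)"
    using continuous_attains_inf[of "{0..max 0 T}" "\<lambda>x. V x - ln (1 + x\<^sup>2)"] by force
  have "V x - ln (1 + x\<^sup>2) \<ge> - \<bar>V x0 - ln (1 + x0\<^sup>2)\<bar>" if "x \<ge> 0" for x
    using x0[rule_format, of x] T[of x] that by (cases "x \<le> T") (auto simp: abs_if)
  thus ?thesis by (intro exI[of _ "\<bar>V x0 - ln (1 + x0\<^sup>2)\<bar>"]) auto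
qed

definition field_bound :: real where
  "field_bound = (SOME M. M \<ge> 0 \<and> (\<forall>x\<ge>0. V x - ln (1 + x\<^sup>2) \<ge> - M))"

lemma field_bound: "field_bound \<ge> 0" "x \<ge> 0 \<Longrightarrow> V x - ln (1 + x\<^sup>2) \<ge> - field_bound"
  using someI_ex[of "\<lambda>M. M \<ge> 0 \<and> (\<forall>x\<ge>0. V x - ln (1 + x\<^sup>2) \<ge> - M)"] field_lower_bound
  by (auto simp: field_bound_def)

text \<open>The excess of the field over the minimal growth \<open>ln (1 + x\<^sup>2)\<close>, shifted so that it is nonnegative.\<close>

definition excess :: "real \<Rightarrow> real" where
  "excess x = field x - ln (1 + x\<^sup>2) + field_bound"

lemma excess_measurable [measurable]: "excess \<in> borel_measurable borel"
  unfolding excess_def[abs_def] by measurable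

lemma excess_nonneg: "x \<ge> 0 \<Longrightarrow> excess x \<ge> 0"
  using field_bound(2)[of x] by (simp add: excess_def field_eq)

lemma excess_large: "\<exists>R\<ge>0. \<forall>x>R. excess x \<ge> B"
proof -
  obtain T where "\<And>x. x \<ge> T \<Longrightarrow> V x - ln (1 + x\<^sup>2) \<ge> B"
    using V_growth unfolding filterlim_at_top eventually_at_top_linorder by blast
  hence "excess x \<ge> B" if "x > max 0 T" for x
    using that field_bound(1) by (simp add: excess_def field_eq add_increasing2)
  thus ?thesis by (intro exI[of _ "max 0 T"]) auto
qed

definition field_kernel :: "real \<Rightarrow> real \<Rightarrow> real" where
  "field_kernel x y = - ln \<bar>x - y\<bar> / 2 - ln \<bar>root r x - root r y\<bar> / 2 + field x / 2 + field y / 2"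

text \<open>The shift makes the kernel nonnegative on the half-line, so that energies become integrals with values in
\<open>[0, \<infinity>]\<close>.\<close>

definition shifted_kernel :: "real \<Rightarrow> real \<Rightarrow> ennreal" where
  "shifted_kernel x y = (if x = y then \<infinity> else ennreal (field_kernel x y + field_bound))"

lemma field_kernel_measurable [measurable]: "(\<lambda>z. field_kernel (fst z) (snd z)) \<in> borel_measurable (borel \<Otimes>\<^sub>M borel)"
  unfolding field_kernel_def by measurable

lemma shifted_kernel_measurable [measurable]: "(\<lambda>z. shifted_kernel (fst z) (snd z)) \<in> borel_measurable (borel \<Otimes>\<^sub>M borel)"
  unfolding shifted_kernel_def field_kernel_def by measurable

lemma root_sq_le:
  assumes "0 \<le> x"
  shows "(root r x)\<^sup>2 \<le> 1 + x\<^sup>2"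
proof (cases "x \<le> 1")
  case True
  hence "root r x \<le> 1" using r assms by simp
  hence "(root r x)\<^sup>2 \<le> 1" using r assms by (simp add: power_le_one)
  thus ?thesis by (simp add: add_increasing2)
next
  case False
  have "root r x \<le> root 1 x" using r False by (intro real_root_decreasing) auto
  hence "(root r x)\<^sup>2 \<le> x\<^sup>2" using r assms by (intro power_mono) auto
  thus ?thesis by simp
qed

text \<open>The growth \<open>ln (1 + x\<^sup>2)\<close> is what compensates two logarithmic kernels of weight \<open>1 / 2\<close> each: both
\<open>\<bar>x - y\<bar>\<^sup>2\<close> and \<open>\<bar>root r x - root r y\<bar>\<^sup>2\<close> are at most \<open>(1 + x\<^sup>2) * (1 + y\<^sup>2)\<close>.\<close>

lemma field_kernel_ge:
  assumes "0 \<le> x" "0 \<le> y" "x \<noteq> y"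
  shows "field_kernel x y + field_bound \<ge> (excess x + excess y) / 2"
proof -
  have "root r x \<noteq> root r y" using assms r by simp
  hence "ln \<bar>root r x - root r y\<bar> \<le> (ln (1 + x\<^sup>2) + ln (1 + y\<^sup>2)) / 2"
    using assms r by (intro ln_diff_le root_sq_le) auto
  moreover have "ln \<bar>x - y\<bar> \<le> (ln (1 + x\<^sup>2) + ln (1 + y\<^sup>2)) / 2" using assms by (intro ln_diff_le) auto
  ultimately show ?thesis by (simp add: field_kernel_def excess_def field_simps)
qed

lemma shifted_kernel_ge:
  assumes "0 \<le> x" "0 \<le> y"
  shows "shifted_kernel x y \<ge> ennreal ((excess x + excess y) / 2)"
  using field_kernel_ge[OF assms] by (simp add: shifted_kernel_def ennreal_leI)

lemma field_kernel_nonneg: "0 \<le> x \<Longrightarrow> 0 \<le> y \<Longrightarrow> x \<noteq> y \<Longrightarrow> 0 \<le> field_kernel x y + field_bound"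
  using field_kernel_ge[of x y] excess_nonneg[of x] excess_nonneg[of y] by simp

definition energy :: "real measure \<Rightarrow> ennreal" where
  "energy \<mu> = (\<integral>\<^sup>+z. shifted_kernel (fst z) (snd z) \<partial>(\<mu> \<Otimes>\<^sub>M \<mu>))"

lemma AE_pair_nonneg:
  assumes "half_prob \<mu>" "half_prob \<nu>"
  shows "AE z in \<mu> \<Otimes>\<^sub>M \<nu>. 0 \<le> fst z \<and> 0 \<le> snd z"
proof -
  note m = half_probD[OF assms(1)] and n = half_probD[OF assms(2)]
  interpret pair_sigma_finite \<mu> \<nu> by (rule finite_borel_pair(4)[OF m(4) n(4)])
  note [measurable_cong] = m(2) n(2)
  show ?thesis
  proof (rule AE_pair_measure)
    show "AE x in \<mu>. AE y in \<nu>. 0 \<le> fst (x, y) \<and> 0 \<le> snd (x, y)"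
      using m(3) by eventually_elim (use n(3) in auto)
  qed measurable
qed

text \<open>The negative part of the unshifted kernel is bounded by \<open>field_bound\<close>, so its integral is finite and the
constant can be moved out of the difference of the two integrals.\<close>

lemma scalar_energy_eq:
  assumes "half_prob \<mu>"
  shows "scalar_energy r V \<mu> = enn2ereal (energy \<mu>) - ereal field_bound"
proof -
  note m = half_probD[OF assms]
  interpret prob_space \<mu> by (rule m(1))
  interpret P: pair_prob_space \<mu> \<mu> ..
  note [measurable_cong] = finite_borel_pair(2)[OF m(4) m(4)]
  let ?P = "\<mu> \<Otimes>\<^sub>M \<mu>" and ?M = field_bound
  let ?f = "\<lambda>(x, y). ereal (1/2) * log_kernel x y + ereal (1/2) * log_kernel (root r x) (root r y)
               + ereal (1/2 * V x) + ereal (1/2 * V y)"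
  let ?p = "\<lambda>z::real \<times> real. if fst z = snd z then \<infinity> else ennreal (field_kernel (fst z) (snd z))"
  let ?q = "\<lambda>z::real \<times> real. if fst z = snd z then 0 else ennreal (- field_kernel (fst z) (snd z))"
  have f: "?f z = (if fst z = snd z then \<infinity> else ereal (field_kernel (fst z) (snd z)))" if "0 \<le> fst z \<and> 0 \<le> snd z" for z
  proof (cases "fst z = snd z")
    case True
    thus ?thesis by (cases z) (simp add: log_kernel_def)
  next
    case False
    hence "root r (fst z) \<noteq> root r (snd z)" using r by simp
    thus ?thesis using False that by (cases z) (simp add: log_kernel_eq field_kernel_def field_eq)
  qed
  have nn: "AE z in ?P. 0 \<le> fst z \<and> 0 \<le> snd z" by (rule AE_pair_nonneg[OF assms assms])
  have A: "(\<integral>\<^sup>+z. e2ennreal (?f z) \<partial>?P) = (\<integral>\<^sup>+z. ?p z \<partial>?P)"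
    by (intro nn_integral_cong_AE, use nn in eventually_elim) (simp only: f, auto)
  have B: "(\<integral>\<^sup>+z. e2ennreal (- ?f z) \<partial>?P) = (\<integral>\<^sup>+z. ?q z \<partial>?P)"
    by (intro nn_integral_cong_AE, use nn in eventually_elim) (simp only: f, auto simp: e2ennreal_neg)
  have "(\<integral>\<^sup>+z. ?p z \<partial>?P) + ennreal ?M = (\<integral>\<^sup>+z. ?p z + ennreal ?M \<partial>?P)"
    by (subst nn_integral_add) (auto simp: P.emeasure_space_1)
  also have "\<dots> = (\<integral>\<^sup>+z. shifted_kernel (fst z) (snd z) + ?q z \<partial>?P)"
  proof (intro nn_integral_cong_AE, use nn in eventually_elim)
    case (elim z)
    show ?case
    proof (cases "fst z = snd z")
      case False
      define k where "k = field_kernel (fst z) (snd z)"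
      have k: "0 \<le> k + ?M" using field_kernel_nonneg[of "fst z" "snd z"] elim False by (simp add: k_def)
      have "ennreal k + ennreal ?M = ennreal (k + ?M) + ennreal (- k)"
        using k field_bound(1)
        by (cases "k \<ge> 0") (auto simp: ennreal_neg ennreal_plus[symmetric] simp del: ennreal_plus)
      thus ?thesis using False by (simp add: shifted_kernel_def k_def)
    qed (simp add: shifted_kernel_def)
  qed
  also have "\<dots> = energy \<mu> + (\<integral>\<^sup>+z. ?q z \<partial>?P)"
    unfolding energy_def by (rule nn_integral_add) measurable
  finally have eq: "(\<integral>\<^sup>+z. ?p z \<partial>?P) + ennreal ?M = energy \<mu> + (\<integral>\<^sup>+z. ?q z \<partial>?P)" .
  have "(\<integral>\<^sup>+z. ?q z \<partial>?P) \<le> (\<integral>\<^sup>+z. ennreal ?M \<partial>?P)"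
  proof (intro nn_integral_mono_AE, use nn in eventually_elim)
    case (elim z)
    thus ?case using field_kernel_nonneg[of "fst z" "snd z"] by (auto intro!: ennreal_leI)
  qed
  also have "\<dots> = ennreal ?M" by (simp add: P.emeasure_space_1)
  finally have qf: "(\<integral>\<^sup>+z. ?q z \<partial>?P) \<le> ennreal ?M" .
  then obtain b where b: "b \<ge> 0" "(\<integral>\<^sup>+z. ?q z \<partial>?P) = ennreal b"
    by (cases "\<integral>\<^sup>+z. ?q z \<partial>?P") (auto simp: top_unique)
  show ?thesis unfolding scalar_energy_def ereal_integral_def A B b(2)
    using eq[unfolded b(2)] b(1) field_bound(1)
    by (cases "\<integral>\<^sup>+z. ?p z \<partial>?P"; cases "energy \<mu>")
       (auto simp: ennreal_plus[symmetric] top_ennreal.rep_eq simp del: ennreal_plus)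
qed

lemma energy_le_iff:
  assumes "half_prob \<mu>" "half_prob \<nu>"
  shows "scalar_energy r V \<mu> \<le> scalar_energy r V \<nu> \<longleftrightarrow> energy \<mu> \<le> energy \<nu>"
  unfolding scalar_energy_eq[OF assms(1)] scalar_energy_eq[OF assms(2)]
  by (cases "energy \<mu>"; cases "energy \<nu>") (auto simp: top_ennreal.rep_eq ennreal_le_iff top_unique)

lemma is_arg_min_scalar_iff:
  "is_arg_min (scalar_energy r V) half_line_prob \<mu> \<longleftrightarrow> half_prob \<mu> \<and> (\<forall>\<nu>. half_prob \<nu> \<longrightarrow> energy \<mu> \<le> energy \<nu>)"
  unfolding is_arg_min_linorder half_line_prob_iff using energy_le_iff by auto

lemma field_tendsto: "Z \<longlonglongrightarrow> z \<Longrightarrow> (\<lambda>n. field (Z n)) \<longlonglongrightarrow> field z"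
  using continuous_field by (simp add: continuous_on_eq_continuous_at isCont_tendsto_compose)

lemma root_tendsto: "Z \<longlonglongrightarrow> z \<Longrightarrow> (\<lambda>n. root r (Z n)) \<longlonglongrightarrow> root r z"
  using continuous_root_r by (simp add: continuous_on_eq_continuous_at isCont_tendsto_compose)

text \<open>Continuity of the kernel with values in \<open>[0, \<infinity>]\<close>. On the diagonal the term \<open>- ln \<bar>x - y\<bar> / 2\<close> tends to
infinity, while the other terms stay bounded below.\<close>

lemma shifted_kernel_tendsto:
  assumes X: "X \<longlonglongrightarrow> x" "\<And>n. 0 \<le> X n" and Y: "Y \<longlonglongrightarrow> y" "\<And>n. 0 \<le> Y n"
  shows "(\<lambda>n. shifted_kernel (X n) (Y n)) \<longlonglongrightarrow> shifted_kernel x y"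
proof (cases "x = y")
  case False
  have xy: "0 \<le> x" "0 \<le> y" using X Y by (auto intro: LIMSEQ_le_const)
  have ne: "\<forall>\<^sub>F n in sequentially. X n \<noteq> Y n"
  proof -
    have "(\<lambda>n. X n - Y n) \<longlonglongrightarrow> x - y" by (intro tendsto_intros X Y)
    hence "\<forall>\<^sub>F n in sequentially. X n - Y n \<noteq> 0" using False by (intro tendsto_imp_eventually_ne) auto
    thus ?thesis by eventually_elim auto
  qed
  have "root r x \<noteq> root r y" using False r by simp
  hence "(\<lambda>n. ennreal (field_kernel (X n) (Y n) + field_bound)) \<longlonglongrightarrow> ennreal (field_kernel x y + field_bound)"
    unfolding field_kernel_def using False by (intro tendsto_intros tendsto_ennrealI field_tendsto root_tendsto X Y) auto
  thus ?thesis
    using False ne by (simp add: shifted_kernel_def) (rule Lim_transform_eventually, auto elim: eventually_mono)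
next
  case True
  let ?g = "\<lambda>n. - ln (1 + root r (X n) + root r (Y n)) / 2 + field (X n) / 2 + field (Y n) / 2 + field_bound"
  have xy: "0 \<le> x" "0 \<le> y" using X Y by (auto intro: LIMSEQ_le_const)
  have "1 + root r x + root r y > 0" using xy r by (simp add: add_pos_nonneg)
  hence "?g \<longlonglongrightarrow> - ln (1 + root r x + root r y) / 2 + field x / 2 + field y / 2 + field_bound"
    by (intro tendsto_intros field_tendsto root_tendsto X Y) auto
  then obtain G where G: "\<And>n. \<bar>?g n\<bar> \<le> G"
    using convergent_imp_Bseq[of ?g] by (auto simp: convergent_def Bseq_def)
  have d: "(\<lambda>n. \<bar>X n - Y n\<bar>) \<longlonglongrightarrow> 0" using tendsto_diff[OF X(1) Y(1)] True by (auto simp: tendsto_rabs_zero_iff)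
  have "(\<lambda>n. shifted_kernel (X n) (Y n)) \<longlonglongrightarrow> \<infinity>"
  proof (rule tendsto_sandwich[OF _ _ _ tendsto_const])
    let ?l = "\<lambda>n. if \<bar>X n - Y n\<bar> = 0 then top else ennreal (- ln \<bar>X n - Y n\<bar> / 2 - G)"
    show "\<forall>\<^sub>F n in sequentially. ?l n \<le> shifted_kernel (X n) (Y n)"
    proof (intro always_eventually allI)
      fix n
      show "?l n \<le> shifted_kernel (X n) (Y n)"
      proof (cases "X n = Y n")
        case False
        hence rn: "root r (X n) \<noteq> root r (Y n)" using r by simp
        have "0 \<le> root r (X n)" "0 \<le> root r (Y n)" using X Y r by auto
        hence "\<bar>root r (X n) - root r (Y n)\<bar> \<le> 1 + root r (X n) + root r (Y n)" by (auto simp: abs_if)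
        hence "ln \<bar>root r (X n) - root r (Y n)\<bar> \<le> ln (1 + root r (X n) + root r (Y n))"
          using rn by (subst ln_le_cancel_iff) auto
        hence "- ln \<bar>X n - Y n\<bar> / 2 - G \<le> field_kernel (X n) (Y n) + field_bound"
          using G[of n] unfolding field_kernel_def by (simp add: abs_le_iff)
        thus ?thesis using False by (simp add: shifted_kernel_def ennreal_leI)
      qed (simp add: shifted_kernel_def)
    qed
    show "\<forall>\<^sub>F n in sequentially. shifted_kernel (X n) (Y n) \<le> \<infinity>" by simp
    show "?l \<longlonglongrightarrow> \<infinity>"
      unfolding infinity_ennreal_def tendsto_top_iff_ennreal
    proof (intro allI impI)
      fix b :: real assume b: "0 \<le> b"
      have "\<forall>\<^sub>F n in sequentially. \<bar>X n - Y n\<bar> < exp (- 2 * (b + G + 1))"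
        using d by (intro order_tendstoD(2)[OF d]) auto
      thus "\<forall>\<^sub>F n in sequentially. ennreal b < ?l n"
      proof eventually_elim
        case (elim n)
        show ?case
        proof (cases "\<bar>X n - Y n\<bar> = 0")
          case False
          have "ln \<bar>X n - Y n\<bar> < ln (exp (- 2 * (b + G + 1)))" using elim False by (subst ln_less_cancel_iff) auto
          hence "b < - ln \<bar>X n - Y n\<bar> / 2 - G" by simp
          thus ?thesis using False b by (simp add: ennreal_lessI)
        qed simp
      qed
    qed
  qed
  thus ?thesis using True by (simp add: shifted_kernel_def)
qed

lemma energy_ge_excess:
  assumes "half_prob \<mu>"
  shows "(\<integral>\<^sup>+x. ennreal (excess x / 2) \<partial>\<mu>) \<le> energy \<mu>"
proof -
  note m = half_probD[OF assms]
  interpret prob_space \<mu> by (rule m(1))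
  note [measurable_cong] = m(2) finite_borel_pair(2)[OF m(4) m(4)]
  have "(\<integral>\<^sup>+x. ennreal (excess x / 2) \<partial>\<mu>) = (\<integral>\<^sup>+x. \<integral>\<^sup>+y. ennreal (excess x / 2) \<partial>\<mu> \<partial>\<mu>)"
    by (simp add: emeasure_space_1)
  also have "\<dots> = (\<integral>\<^sup>+z. ennreal (excess (fst z) / 2) \<partial>(\<mu> \<Otimes>\<^sub>M \<mu>))"
    by (subst nn_integral_fst[symmetric]) auto
  also have "\<dots> \<le> energy \<mu>"
    unfolding energy_def
  proof (rule nn_integral_mono_AE, use AE_pair_nonneg[OF assms assms] in eventually_elim)
    case (elim z)
    have "ennreal (excess (fst z) / 2) \<le> ennreal ((excess (fst z) + excess (snd z)) / 2)"
      using elim excess_nonneg[of "snd z"] by (intro ennreal_leI) simp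
    also have "\<dots> \<le> shifted_kernel (fst z) (snd z)" using elim by (intro shifted_kernel_ge) auto
    finally show ?case .
  qed
  finally show ?thesis .
qed

text \<open>The energy bounds the integral of the excess, which is large far out; so by Markov's inequality little mass
is there.\<close>

lemma tight_of_bounded_energy:
  assumes \<mu>: "\<And>n. half_prob (\<mu> n)" and C: "C \<ge> 0" "\<And>n. energy (\<mu> n) \<le> ennreal C"
  shows "tight \<mu>"
  unfolding tight_def
proof (intro conjI allI impI)
  fix n
  show "real_distribution (\<mu> n)" using half_probD[OF \<mu>]
    by (simp add: real_distribution_def real_distribution_axioms_def)
next
  fix \<epsilon> :: real assume \<epsilon>: "\<epsilon> > 0"
  \<comment> \<open>With this threshold Markov's inequality leaves mass at most \<open>\<epsilon> / 2\<close> beyond \<open>R\<close>.\<close>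
  define B where "B = 2 * (C + 1) * (2 / \<epsilon>)"
  have B: "B > 0" using C \<epsilon> by (simp add: B_def)
  obtain R where R: "R \<ge> 0" "\<And>x. x > R \<Longrightarrow> excess x \<ge> B" using excess_large by blast
  show "\<exists>a b. a < b \<and> (\<forall>n. measure (\<mu> n) {a<..b} > 1 - \<epsilon>)"
  proof (rule exI[of _ "-1"], rule exI[of _ R], intro conjI allI)
    show "- 1 < R" using R by simp
    fix n
    note m = half_probD[OF \<mu>[of n]]
    interpret prob_space "\<mu> n" by (rule m(1))
    note [measurable_cong] = m(2)
    have sR: "{R<..} \<in> sets (\<mu> n)" using m(2) by simp
    have "ennreal (B / 2) * emeasure (\<mu> n) {R<..} = (\<integral>\<^sup>+x. ennreal (B / 2) * indicator {R<..} x \<partial>\<mu> n)"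
      using sR by (rule nn_integral_cmult_indicator[symmetric])
    also have "\<dots> \<le> (\<integral>\<^sup>+x. ennreal (excess x / 2) \<partial>\<mu> n)"
      using R(2) by (intro nn_integral_mono) (auto split: split_indicator intro!: ennreal_leI)
    also have "\<dots> \<le> ennreal C" using energy_ge_excess[OF \<mu>] C(2) order_trans by blast
    finally have "ennreal (B / 2 * measure (\<mu> n) {R<..}) \<le> ennreal C"
      using B by (subst ennreal_mult) (simp_all add: emeasure_eq_measure)
    hence "B / 2 * measure (\<mu> n) {R<..} \<le> C" using C(1) by simp
    moreover have "B / 2 = (C + 1) * (2 / \<epsilon>)" using \<epsilon> by (simp add: B_def field_simps)
    ultimately have "(C + 1) * (2 / \<epsilon>) * measure (\<mu> n) {R<..} \<le> C" by simp
    hence "(C + 1) * measure (\<mu> n) {R<..} \<le> C * \<epsilon> / 2" using \<epsilon> by (simp add: field_simps)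
    also have "\<dots> \<le> (C + 1) * (\<epsilon> / 2)" using \<epsilon> by (simp add: algebra_simps)
    finally have small: "measure (\<mu> n) {R<..} \<le> \<epsilon> / 2" using C(1) by (simp add: mult_le_cancel_left)
    have "measure (\<mu> n) {-1<..R} = measure (\<mu> n) (space (\<mu> n) - {R<..})"
    proof (rule finite_measure_eq_AE)
      show "AE x in \<mu> n. x \<in> {- 1<..R} \<longleftrightarrow> x \<in> space (\<mu> n) - {R<..}"
        using m(3) by eventually_elim (auto simp: m(6))
    qed measurable
    also have "\<dots> = 1 - measure (\<mu> n) {R<..}" using sR by (rule prob_compl)
    finally show "measure (\<mu> n) {-1<..R} > 1 - \<epsilon>" using small \<epsilon> by simp
  qed
qed

text \<open>The direct method. A minimizing sequence is tight and has a weakly convergent subsequence. Skorohod's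
representation replaces weak convergence by pointwise convergence of random variables, and Fatou's lemma,
with the continuity of the kernel, shows that the energy of the limit is not larger than the infimum.\<close>

proposition energy_attained: "\<exists>\<mu>. half_prob \<mu> \<and> (\<forall>\<nu>. half_prob \<nu> \<longrightarrow> energy \<mu> \<le> energy \<nu>)"
proof -
  define I where "I = (INF \<nu>\<in>Collect half_prob. energy \<nu>)"
  have ret: "half_prob (return borel 0)"
    by (auto simp: half_prob_def AE_return intro!: prob_space_return)
  show ?thesis
  proof (cases "I = \<infinity>")
    case True
    hence "energy \<nu> = \<infinity>" if "half_prob \<nu>" for \<nu>
      using INF_lower[of \<nu> "Collect half_prob" energy] that unfolding I_def by (simp add: top_unique)
    thus ?thesis using ret by auto
  next
    case False
    have "\<exists>\<nu>. half_prob \<nu> \<and> energy \<nu> < I + ennreal (1 / Suc n)" for n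
    proof -
      have "I < I + ennreal (1 / Suc n)" using False by (cases I) (auto simp: ennreal_plus[symmetric] ennreal_less_iff simp del: ennreal_plus)
      thus ?thesis unfolding I_def by (subst (asm) INF_less_iff) auto
    qed
    then obtain \<mu> where \<mu>: "\<And>n. half_prob (\<mu> n)" "\<And>n. energy (\<mu> n) < I + ennreal (1 / Suc n)" by metis
    obtain i where i: "i \<ge> 0" "I = ennreal i" using False by (cases I) auto
    have bd: "energy (\<mu> n) \<le> ennreal (i + 1)" for n
    proof -
      have "I + ennreal (1 / Suc n) \<le> ennreal (i + 1)" using i by (simp add: ennreal_plus[symmetric] del: ennreal_plus)
      thus ?thesis using \<mu>(2)[of n] by (meson less_imp_le order_trans)
    qed
    have "tight \<mu>" using \<mu>(1) bd i(1) by (intro tight_of_bounded_energy[where C = "i + 1"]) auto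
    then obtain s M where s: "strict_mono s" "real_distribution M" "weak_conv_m (\<mu> \<circ> id \<circ> s) M"
      using tight_imp_convergent_subsubsequence[of \<mu> id] by (auto simp: strict_mono_id)
    define \<nu> where "\<nu> n = \<mu> (s n)" for n
    have \<nu>: "half_prob (\<nu> n)" for n using \<mu> by (simp add: \<nu>_def)
    have \<nu>rd: "real_distribution (\<nu> n)" for n using half_probD[OF \<nu>]
      by (simp add: real_distribution_def real_distribution_axioms_def)
    have wc: "weak_conv_m \<nu> M" using s(3) by (simp add: \<nu>_def[abs_def] comp_def)
    interpret M: real_distribution M by (rule s(2))
    obtain \<Omega> :: "real measure" and Y :: "nat \<Rightarrow> real \<Rightarrow> real" and Z :: "real \<Rightarrow> real" where
      sk: "prob_space \<Omega>" "\<forall>n. Y n \<in> borel_measurable \<Omega>" "\<forall>n. distr \<Omega> borel (Y n) = \<nu> n"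
      "Z \<in> measurable \<Omega> lborel" "distr \<Omega> borel Z = M" "\<forall>x\<in>space \<Omega>. (\<lambda>n. Y n x) \<longlonglongrightarrow> Z x"
      using Skorohod[OF \<nu>rd s(2) wc] by blast
    have \<Omega>: "prob_space \<Omega>" "\<And>n. Y n \<in> borel_measurable \<Omega>" "\<And>n. distr \<Omega> borel (Y n) = \<nu> n"
      "Z \<in> borel_measurable \<Omega>" "distr \<Omega> borel Z = M" "\<And>x. x \<in> space \<Omega> \<Longrightarrow> (\<lambda>n. Y n x) \<longlonglongrightarrow> Z x"
      using sk by auto
    interpret O: prob_space \<Omega> by (rule \<Omega>(1))
    interpret OO: pair_prob_space \<Omega> \<Omega> ..
    note [measurable] = \<Omega>(2,4)
    have Ypos: "AE x in \<Omega>. 0 \<le> Y n x" for n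
      using half_probD(3)[OF \<nu>[of n]] unfolding \<Omega>(3)[symmetric] by (subst (asm) AE_distr_iff) auto
    have Yall: "AE x in \<Omega>. x \<in> space \<Omega> \<and> (\<forall>n. 0 \<le> Y n x)" using Ypos by (simp add: AE_all_countable)
    have Zpos: "AE x in \<Omega>. 0 \<le> Z x"
      using Yall by eventually_elim (use LIMSEQ_le_const[OF \<Omega>(6), of _ 0] in auto)
    have Mh: "half_prob M"
      using Zpos M.prob_space_axioms unfolding half_prob_def \<Omega>(5)[symmetric] by (subst AE_distr_iff) auto
    have en: "energy (distr \<Omega> borel X) = (\<integral>\<^sup>+z. shifted_kernel (X (fst z)) (X (snd z)) \<partial>(\<Omega> \<Otimes>\<^sub>M \<Omega>))"
      if [measurable]: "X \<in> borel_measurable \<Omega>" for X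
    proof -
      interpret D: prob_space "distr \<Omega> borel X" by (rule O.prob_space_distr) simp
      have "distr \<Omega> borel X \<Otimes>\<^sub>M distr \<Omega> borel X = distr (\<Omega> \<Otimes>\<^sub>M \<Omega>) (borel \<Otimes>\<^sub>M borel) (\<lambda>(x, y). (X x, X y))"
        by (rule pair_measure_distr) (auto intro: D.sigma_finite_measure_axioms)
      thus ?thesis unfolding energy_def by (simp add: nn_integral_distr split_beta')
    qed
    have all2: "AE z in \<Omega> \<Otimes>\<^sub>M \<Omega>. (fst z \<in> space \<Omega> \<and> (\<forall>n. 0 \<le> Y n (fst z))) \<and> (snd z \<in> space \<Omega> \<and> (\<forall>n. 0 \<le> Y n (snd z)))"
      by (rule OO.AE_pair_measure) (measurable, use Yall in \<open>eventually_elim, use Yall in auto\<close>)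
    have "energy M = (\<integral>\<^sup>+z. shifted_kernel (Z (fst z)) (Z (snd z)) \<partial>(\<Omega> \<Otimes>\<^sub>M \<Omega>))"
      using en[OF \<Omega>(4)] by (simp add: \<Omega>(5))
    also have "\<dots> = (\<integral>\<^sup>+z. liminf (\<lambda>n. shifted_kernel (Y n (fst z)) (Y n (snd z))) \<partial>(\<Omega> \<Otimes>\<^sub>M \<Omega>))"
    proof (rule nn_integral_cong_AE, use all2 in eventually_elim)
      case (elim z)
      hence "(\<lambda>n. shifted_kernel (Y n (fst z)) (Y n (snd z))) \<longlonglongrightarrow> shifted_kernel (Z (fst z)) (Z (snd z))"
        by (intro shifted_kernel_tendsto \<Omega>(6)) auto
      thus ?case using lim_imp_Liminf[OF sequentially_bot] by metis
    qed
    also have "\<dots> \<le> liminf (\<lambda>n. \<integral>\<^sup>+z. shifted_kernel (Y n (fst z)) (Y n (snd z)) \<partial>(\<Omega> \<Otimes>\<^sub>M \<Omega>))"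
    proof (rule nn_integral_liminf)
      fix n
      show "(\<lambda>z. shifted_kernel (Y n (fst z)) (Y n (snd z))) \<in> borel_measurable (\<Omega> \<Otimes>\<^sub>M \<Omega>)"
        using measurable_compose[OF _ shifted_kernel_measurable, of "\<lambda>z. (Y n (fst z), Y n (snd z))" "\<Omega> \<Otimes>\<^sub>M \<Omega>"] by simp
    qed
    also have "\<dots> = liminf (\<lambda>n. energy (\<nu> n))" using en[OF \<Omega>(2)] by (simp add: \<Omega>(3))
    also have "\<dots> \<le> liminf (\<lambda>n. ennreal (i + 1 / Suc (s n)))"
    proof (intro Liminf_mono always_eventually allI)
      fix n
      show "energy (\<nu> n) \<le> ennreal (i + 1 / Suc (s n))"
        using \<mu>(2)[of "s n"] i by (simp add: \<nu>_def ennreal_plus)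
    qed
    also have "\<dots> = ennreal i"
    proof -
      have "(\<lambda>n. 1 / real (Suc n)) \<longlonglongrightarrow> 0" by real_asymp
      hence "(\<lambda>n. 1 / real (Suc (s n))) \<longlonglongrightarrow> 0" using LIMSEQ_subseq_LIMSEQ[OF _ s(1)] by (auto simp: comp_def)
      from tendsto_add[OF tendsto_const[of i] this] have "(\<lambda>n. i + 1 / real (Suc (s n))) \<longlonglongrightarrow> i" by simp
      thus ?thesis by (intro lim_imp_Liminf tendsto_ennrealI) auto
    qed
    finally have "energy M \<le> I" using i by simp
    thus ?thesis using Mh INF_lower[of _ "Collect half_prob" energy] unfolding I_def
      by (intro exI[of _ M]) (auto intro: order_trans)
  qed
qed

end

section \<open>Boundedness and uniqueness of the scalar minimizer\<close>

lemma integrable_log_unit: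
  "integrable lborel (\<lambda>t. indicator {0<..<1} t * (- ln t) :: real)"
proof -
  have "set_integrable lborel (einterval 0 1) (\<lambda>t. - ln t :: real)"
  proof (rule interval_integral_FTC_nonneg(1))
    show "((\<lambda>t. t - t * ln t) has_real_derivative - ln t) (at t)" if "0 < ereal t" for t
      using that by (auto intro!: derivative_eq_intros)
    show "isCont (\<lambda>t. - ln t) t" if "0 < ereal t" for t using that by (auto intro!: continuous_intros)
    show "AE t in lborel. 0 < ereal t \<longrightarrow> ereal t < 1 \<longrightarrow> 0 \<le> - ln t" by auto
    have "((\<lambda>t. t - t * ln t) \<longlongrightarrow> 0) (at_right (0::real))" by real_asymp
    thus "(((\<lambda>t. t - t * ln t) \<circ> real_of_ereal) \<longlongrightarrow> 0) (at_right 0)"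
      unfolding zero_ereal_def by (simp add: ereal_tendsto_simps)
    have "((\<lambda>t. t - t * ln t) \<longlongrightarrow> 1 - 1 * ln 1) (at_left (1::real))" by (intro tendsto_intros) auto
    thus "(((\<lambda>t. t - t * ln t) \<circ> real_of_ereal) \<longlongrightarrow> 1) (at_left 1)"
      unfolding one_ereal_def by (simp add: ereal_tendsto_simps)
  qed auto
  moreover have "einterval 0 1 = {0<..<1::real}" by (auto simp: einterval_def)
  ultimately show ?thesis by (simp add: set_integrable_def)
qed

text \<open>A competitor of finite energy, which shows that the minimal energy is finite.\<close>

definition unit_uniform :: "real measure" where
  "unit_uniform = uniform_measure lborel {0..1}"

lemma nn_integral_unit_uniform:
  "f \<in> borel_measurable borel \<Longrightarrow> (\<integral>\<^sup>+x. f x \<partial>unit_uniform) = (\<integral>\<^sup>+x. f x * indicator {0..1} x \<partial>lborel)"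
  unfolding unit_uniform_def by (subst nn_integral_uniform_measure) (auto simp: divide_ennreal_def)

lemma half_prob_unit_uniform: "half_prob unit_uniform"
proof -
  have "prob_space unit_uniform" unfolding unit_uniform_def by (rule prob_space_uniform_measure) auto
  moreover have "AE x in unit_uniform. 0 \<le> x"
    unfolding unit_uniform_def by (rule AE_uniform_measureI) auto
  moreover have "sets unit_uniform = sets borel" by (simp add: unit_uniform_def)
  ultimately show ?thesis by (simp add: half_prob_def)
qed

lemma AE_unit_uniform: "AE x in unit_uniform. x \<in> {0..1}"
  unfolding unit_uniform_def by (rule AE_uniform_measureI) auto

lemma log_compatible_unit_uniform: "log_compatible unit_uniform unit_uniform"
proof -
  let ?U = unit_uniform
  note h = half_probD[OF half_prob_unit_uniform]
  interpret U: prob_space ?U by (rule h(1))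
  note [measurable_cong] = h(2)
  \<comment> \<open>On the unit interval the kernel is nonnegative and bounded by one of two translates of \<open>g\<close>, according to the order of \<open>x\<close> and \<open>y\<close>.\<close>
  define g where "g t = indicator {0<..<1} t * (- ln t)" for t :: real
  have [measurable]: "g \<in> borel_measurable borel" unfolding g_def by measurable
  have g0: "g t \<ge> 0" for t by (simp add: g_def indicator_def)
  define G where "G = (\<integral>\<^sup>+t. ennreal (g t) \<partial>lborel)"
  have G: "G < \<infinity>"
  proof -
    have "integrable lborel g" using integrable_log_unit by (simp add: g_def[abs_def])
    thus ?thesis by (simp add: G_def integrable_iff_bounded abs_of_nonneg[OF g0])
  qed
  have at: "emeasure ?U {x} = 0" for x
    using emeasure_lborel_countable[of "{x} \<inter> {0..1}"] unfolding unit_uniform_def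
    by (subst emeasure_uniform_measure) (auto simp: Int_commute)
  have ae: "AE z in ?U \<Otimes>\<^sub>M ?U. fst z \<noteq> snd z" by (intro AE_off_diagonal h at)
  have shift: "(\<integral>\<^sup>+y. ennreal (g (x - y)) \<partial>lborel) = G" "(\<integral>\<^sup>+y. ennreal (g (y - x)) \<partial>lborel) = G" for x
    using nn_integral_real_affine[of "\<lambda>t. ennreal (g t)" "-1" x] nn_integral_real_affine[of "\<lambda>t. ennreal (g t)" 1 "- x"]
    by (simp_all add: G_def)
  have "(\<integral>\<^sup>+z. ennreal (norm (ln \<bar>fst z - snd z\<bar>)) \<partial>(?U \<Otimes>\<^sub>M ?U)) = (\<integral>\<^sup>+x. \<integral>\<^sup>+y. ennreal \<bar>ln \<bar>x - y\<bar>\<bar> \<partial>?U \<partial>?U)"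
    by (subst U.nn_integral_fst[symmetric]) auto
  also have "\<dots> \<le> (\<integral>\<^sup>+x. G + G \<partial>?U)"
  proof (rule nn_integral_mono_AE, use AE_unit_uniform in eventually_elim)
    case (elim x)
    have "(\<integral>\<^sup>+y. ennreal \<bar>ln \<bar>x - y\<bar>\<bar> \<partial>?U) = (\<integral>\<^sup>+y. ennreal \<bar>ln \<bar>x - y\<bar>\<bar> * indicator {0..1} y \<partial>lborel)"
      by (rule nn_integral_unit_uniform) measurable
    also have "\<dots> \<le> (\<integral>\<^sup>+y. ennreal (g (x - y)) + ennreal (g (y - x)) \<partial>lborel)"
    proof (intro nn_integral_mono)
      fix y :: real
      show "ennreal \<bar>ln \<bar>x - y\<bar>\<bar> * indicator {0..1} y \<le> ennreal (g (x - y)) + ennreal (g (y - x))"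
      proof (cases "y \<in> {0..1} \<and> x \<noteq> y \<and> \<bar>x - y\<bar> \<noteq> 1")
        case True
        hence "\<bar>x - y\<bar> < 1" using elim by (auto simp: abs_if split: if_splits)
        thus ?thesis using True g0
          by (cases "x < y") (auto simp: g_def indicator_def abs_if add_increasing add_increasing2)
      qed (auto simp: indicator_def)
    qed
    also have "\<dots> = G + G" by (subst nn_integral_add) (auto simp: shift)
    finally show ?case .
  qed
  also have "\<dots> < \<infinity>" using G by (simp add: U.emeasure_space_1)
  finally have "integrable (?U \<Otimes>\<^sub>M ?U) (\<lambda>z. ln \<bar>fst z - snd z\<bar>)" by (intro integrableI_bounded) auto
  with ae show ?thesis by (simp add: log_compatible_def)
qed

text \<open>The measure \<open>(\<mu> + \<nu>) / 2\<close>, as the law of a fair random choice between independent samples of \<open>\<mu>\<close> and \<open>\<nu>\<close>.\<close>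

definition mixture :: "real measure \<Rightarrow> real measure \<Rightarrow> real measure" where
  "mixture \<mu> \<nu> = distr (measure_pmf (bernoulli_pmf (1/2)) \<Otimes>\<^sub>M (\<mu> \<Otimes>\<^sub>M \<nu>)) borel (\<lambda>(b, z). if b then fst z else snd z)"

lemma
  assumes "half_prob \<mu>" "half_prob \<nu>"
  shows half_prob_mixture: "half_prob (mixture \<mu> \<nu>)"
    and nn_integral_mixture: "f \<in> borel_measurable borel \<Longrightarrow>
      (\<integral>\<^sup>+x. f x \<partial>mixture \<mu> \<nu>) = ennreal (1/2) * ((\<integral>\<^sup>+x. f x \<partial>\<mu>) + (\<integral>\<^sup>+x. f x \<partial>\<nu>))"
proof -
  note m = half_probD[OF assms(1)] and n = half_probD[OF assms(2)]
  interpret m: prob_space \<mu> by (rule m(1))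
  interpret n: prob_space \<nu> by (rule n(1))
  interpret mn: pair_prob_space \<mu> \<nu> ..
  let ?B = "measure_pmf (bernoulli_pmf (1/2))"
  interpret B: prob_space ?B by (rule measure_pmf.prob_space_axioms)
  interpret Bmn: pair_prob_space ?B "\<mu> \<Otimes>\<^sub>M \<nu>" ..
  note [measurable_cong] = m(2) n(2)
  have sel [measurable]: "(\<lambda>(b, z). if b then fst z else snd z) \<in> measurable (?B \<Otimes>\<^sub>M (\<mu> \<Otimes>\<^sub>M \<nu>)) (borel :: real measure)"
    by measurable
  show nn: "(\<integral>\<^sup>+x. f x \<partial>mixture \<mu> \<nu>) = ennreal (1/2) * ((\<integral>\<^sup>+x. f x \<partial>\<mu>) + (\<integral>\<^sup>+x. f x \<partial>\<nu>))"
    if [measurable]: "f \<in> borel_measurable borel" for f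
  proof -
    have 1: "(\<integral>\<^sup>+z. f (fst z) \<partial>(\<mu> \<Otimes>\<^sub>M \<nu>)) = (\<integral>\<^sup>+x. f x \<partial>\<mu>)"
      by (subst n.nn_integral_fst[symmetric]) (auto simp: n.emeasure_space_1)
    have 2: "(\<integral>\<^sup>+z. f (snd z) \<partial>(\<mu> \<Otimes>\<^sub>M \<nu>)) = (\<integral>\<^sup>+x. f x \<partial>\<nu>)"
      by (subst n.nn_integral_fst[symmetric]) (auto simp: m.emeasure_space_1)
    have "(\<integral>\<^sup>+x. f x \<partial>mixture \<mu> \<nu>) = (\<integral>\<^sup>+w. f ((\<lambda>(b, z). if b then fst z else snd z) w) \<partial>(?B \<Otimes>\<^sub>M (\<mu> \<Otimes>\<^sub>M \<nu>)))"
      unfolding mixture_def by (rule nn_integral_distr) measurable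
    also have "\<dots> = (\<integral>\<^sup>+b. \<integral>\<^sup>+z. f (if b then fst z else snd z) \<partial>(\<mu> \<Otimes>\<^sub>M \<nu>) \<partial>?B)"
      by (subst mn.nn_integral_fst[symmetric]) auto
    also have "\<dots> = ennreal (1/2) * ((\<integral>\<^sup>+x. f x \<partial>\<mu>) + (\<integral>\<^sup>+x. f x \<partial>\<nu>))"
      by (subst nn_integral_bernoulli_pmf) (auto simp: 1 2 distrib_left mult.commute)
    finally show ?thesis .
  qed
  have "prob_space (mixture \<mu> \<nu>)" unfolding mixture_def by (rule Bmn.prob_space_distr) measurable
  moreover have "AE x in mixture \<mu> \<nu>. 0 \<le> x"
  proof -
    have "(\<integral>\<^sup>+x. indicator {..<0} x \<partial>\<mu>) = 0" "(\<integral>\<^sup>+x. indicator {..<0} x \<partial>\<nu>) = 0"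
      using m(3) n(3) by (auto simp: nn_integral_0_iff_AE indicator_def not_less elim!: eventually_mono)
    hence "(\<integral>\<^sup>+x. indicator {..<0} x \<partial>mixture \<mu> \<nu>) = 0" by (simp add: nn)
    thus ?thesis by (subst (asm) nn_integral_0_iff_AE) (auto simp: mixture_def indicator_def not_less elim!: eventually_mono)
  qed
  moreover have "sets (mixture \<mu> \<nu>) = sets borel" by (simp add: mixture_def)
  ultimately show "half_prob (mixture \<mu> \<nu>)" by (simp add: half_prob_def)
qed

context external_field
begin

lemma shifted_kernel_measurable_pair:
  assumes "half_prob \<mu>" "half_prob \<nu>"
  shows "(\<lambda>z. shifted_kernel (fst z) (snd z)) \<in> borel_measurable (\<mu> \<Otimes>\<^sub>M \<nu>)"
proof -
  note [measurable_cong] = half_probD(2)[OF assms(1)] half_probD(2)[OF assms(2)]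
  show ?thesis by measurable
qed

definition cross_energy :: "real measure \<Rightarrow> real measure \<Rightarrow> ennreal" where
  "cross_energy \<mu> \<nu> = (\<integral>\<^sup>+x. \<integral>\<^sup>+y. shifted_kernel x y \<partial>\<nu> \<partial>\<mu>)"

lemma cross_energy_pair:
  assumes "half_prob \<mu>" "half_prob \<nu>"
  shows "cross_energy \<mu> \<nu> = (\<integral>\<^sup>+z. shifted_kernel (fst z) (snd z) \<partial>(\<mu> \<Otimes>\<^sub>M \<nu>))"
proof -
  interpret n: prob_space \<nu> using half_probD[OF assms(2)] by simp
  show ?thesis unfolding cross_energy_def
    by (subst n.nn_integral_fst[OF shifted_kernel_measurable_pair[OF assms], symmetric]) simp
qed

lemma energy_eq_cross_energy: "half_prob \<mu> \<Longrightarrow> energy \<mu> = cross_energy \<mu> \<mu>"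
  by (simp add: cross_energy_pair energy_def)

lemma shifted_kernel_section_measurable [measurable]: "shifted_kernel x \<in> borel_measurable borel"
  using measurable_compose[OF _ shifted_kernel_measurable, of "\<lambda>y. (x, y)" borel] by simp

lemma inner_measurable:
  assumes "half_prob \<nu>"
  shows "(\<lambda>x. \<integral>\<^sup>+y. shifted_kernel x y \<partial>\<nu>) \<in> borel_measurable borel"
proof -
  interpret n: prob_space \<nu> using half_probD[OF assms] by simp
  note [measurable_cong] = half_probD(2)[OF assms]
  show ?thesis unfolding shifted_kernel_def field_kernel_def by measurable
qed

lemma energy_mixture:
  assumes "half_prob \<mu>" "half_prob \<nu>"
  shows "energy (mixture \<mu> \<nu>) = ennreal (1/4) * (cross_energy \<mu> \<mu> + cross_energy \<mu> \<nu> + cross_energy \<nu> \<mu> + cross_energy \<nu> \<nu>)"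
proof -
  note m = half_probD[OF assms(1)] and n = half_probD[OF assms(2)]
  note hm = half_prob_mixture[OF assms]
  note [measurable] = inner_measurable[OF assms(1)] inner_measurable[OF assms(2)]
  note [measurable_cong] = m(2) n(2)
  have "energy (mixture \<mu> \<nu>) = (\<integral>\<^sup>+x. ennreal (1/2) * ((\<integral>\<^sup>+y. shifted_kernel x y \<partial>\<mu>) + (\<integral>\<^sup>+y. shifted_kernel x y \<partial>\<nu>)) \<partial>mixture \<mu> \<nu>)"
    unfolding energy_eq_cross_energy[OF hm] cross_energy_def by (simp add: nn_integral_mixture[OF assms])
  also have "\<dots> = ennreal (1/2) * ((\<integral>\<^sup>+x. ennreal (1/2) * ((\<integral>\<^sup>+y. shifted_kernel x y \<partial>\<mu>) + (\<integral>\<^sup>+y. shifted_kernel x y \<partial>\<nu>)) \<partial>\<mu>)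
      + (\<integral>\<^sup>+x. ennreal (1/2) * ((\<integral>\<^sup>+y. shifted_kernel x y \<partial>\<mu>) + (\<integral>\<^sup>+y. shifted_kernel x y \<partial>\<nu>)) \<partial>\<nu>))"
    by (rule nn_integral_mixture[OF assms]) measurable
  also have "\<dots> = ennreal (1/2) * (ennreal (1/2) * (cross_energy \<mu> \<mu> + cross_energy \<mu> \<nu>) + ennreal (1/2) * (cross_energy \<nu> \<mu> + cross_energy \<nu> \<nu>))"
    by (simp add: nn_integral_cmult nn_integral_add cross_energy_def)
  also have "\<dots> = (ennreal (1/2) * ennreal (1/2)) * (cross_energy \<mu> \<mu> + cross_energy \<mu> \<nu> + cross_energy \<nu> \<mu> + cross_energy \<nu> \<nu>)"
    by (simp only: distrib_left[symmetric] mult.assoc[symmetric] add.assoc[symmetric])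
  also have "ennreal (1/2) * ennreal (1/2) = ennreal (1/4)" by (subst ennreal_mult[symmetric]) auto
  finally show ?thesis .
qed

text \<open>For these measures each of the three terms of the scalar functional is finite, so that it can be expanded
as a real quadratic form.\<close>

definition tame :: "real measure \<Rightarrow> bool" where
  "tame \<mu> \<longleftrightarrow> half_prob \<mu> \<and> log_compatible \<mu> \<mu> \<and> integrable \<mu> field"

lemma tameD:
  assumes "tame \<mu>"
  shows "half_prob \<mu>" "finite_borel \<mu>" "log_compatible \<mu> \<mu>" "integrable \<mu> field" "AE x in \<mu>. x > 0"
    "lifted_measure r \<mu>" "sets \<mu> = sets borel"
proof -
  show *: "half_prob \<mu>" "log_compatible \<mu> \<mu>" "integrable \<mu> field" using assms by (auto simp: tame_def)
  note h = half_probD[OF *(1)]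
  show "finite_borel \<mu>" by (rule h(4))
  show "sets \<mu> = sets borel" by (rule h(2))
  have "{0} \<in> null_sets \<mu>" using no_atoms[OF h(4) *(2), of 0] h(2) by (auto simp: null_sets_def)
  hence "AE x in \<mu>. x \<noteq> 0" by (rule AE_I') auto
  thus p: "AE x in \<mu>. x > 0" using h(3) by eventually_elim simp
  show "lifted_measure r \<mu>" using r h(4) p *(2) by unfold_locales
qed

text \<open>The logarithmic energy of this image is the second term of the scalar functional, so that positive
definiteness applies to this term as well.\<close>

definition root_push :: "real measure \<Rightarrow> real measure" where
  "root_push \<mu> = distr \<mu> borel (root r)"

lemma finite_borel_root_push: "tame \<mu> \<Longrightarrow> finite_borel (root_push \<mu>)"
proof -
  assume "tame \<mu>"
  note t = tameD[OF this]
  interpret finite_measure \<mu> using finite_borelD[OF t(2)] by simp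
  note [measurable_cong] = t(7)
  show ?thesis unfolding root_push_def finite_borel_def by (auto intro!: finite_measure_distr)
qed

lemma root_push_pair:
  assumes "tame \<mu>" "tame \<nu>"
  shows "root_push \<mu> \<Otimes>\<^sub>M root_push \<nu> = distr (\<mu> \<Otimes>\<^sub>M \<nu>) (borel \<Otimes>\<^sub>M borel) (\<lambda>(x, y). (root r x, root r y))"
proof -
  note m = tameD[OF assms(1)] and n = tameD[OF assms(2)]
  note [measurable_cong] = m(7) n(7)
  interpret finite_measure "root_push \<nu>" using finite_borelD[OF finite_borel_root_push[OF assms(2)]] by simp
  show ?thesis unfolding root_push_def
    by (rule pair_measure_distr) (use sigma_finite_measure_axioms in \<open>auto simp: root_push_def\<close>)
qed

lemma log_root_push:
  assumes "tame \<mu>" "tame \<nu>"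
  shows "log_compatible (root_push \<mu>) (root_push \<nu>) \<longleftrightarrow>
      integrable (\<mu> \<Otimes>\<^sub>M \<nu>) (\<lambda>z. ln \<bar>root r (fst z) - root r (snd z)\<bar>) \<and> (AE z in \<mu> \<Otimes>\<^sub>M \<nu>. fst z \<noteq> snd z)"
    and "log_inner (root_push \<mu>) (root_push \<nu>) = - (\<integral>z. ln \<bar>root r (fst z) - root r (snd z)\<bar> \<partial>(\<mu> \<Otimes>\<^sub>M \<nu>))"
proof -
  note m = tameD[OF assms(1)] and n = tameD[OF assms(2)]
  note [measurable_cong] = finite_borel_pair(2)[OF m(2) n(2)]
  have g: "(\<lambda>(x, y). (root r x, root r y)) \<in> measurable (\<mu> \<Otimes>\<^sub>M \<nu>) (borel \<Otimes>\<^sub>M borel)" by measurable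
  have inj: "root r x \<noteq> root r y \<longleftrightarrow> x \<noteq> y" for x y using r by simp
  show "log_compatible (root_push \<mu>) (root_push \<nu>) \<longleftrightarrow>
      integrable (\<mu> \<Otimes>\<^sub>M \<nu>) (\<lambda>z. ln \<bar>root r (fst z) - root r (snd z)\<bar>) \<and> (AE z in \<mu> \<Otimes>\<^sub>M \<nu>. fst z \<noteq> snd z)"
    unfolding log_compatible_def root_push_pair[OF assms]
    using inj by (subst integrable_distr_eq[OF g], measurable, subst AE_distr_iff[OF g]) (auto simp: split_beta')
  show "log_inner (root_push \<mu>) (root_push \<nu>) = - (\<integral>z. ln \<bar>root r (fst z) - root r (snd z)\<bar> \<partial>(\<mu> \<Otimes>\<^sub>M \<nu>))"
    unfolding log_inner_def root_push_pair[OF assms]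
    by (subst integral_distr[OF g]) (auto simp: split_beta')
qed

lemma log_compatible_root_push:
  assumes "tame \<mu>" "tame \<nu>"
  shows "log_compatible (root_push \<mu>) (root_push \<nu>)"
proof -
  have self: "log_compatible (root_push \<mu>) (root_push \<mu>)" if "tame \<mu>" for \<mu>
  proof -
    interpret lifted_measure r \<mu> by (rule tameD(6)[OF that])
    show ?thesis using log_root_push(1)[OF that that] integrable_root_log lc by (simp add: log_compatible_def)
  qed
  show ?thesis
    by (rule log_compatible_cross[OF finite_borel_root_push[OF assms(1)] finite_borel_root_push[OF assms(2)]
          self[OF assms(1)] self[OF assms(2)]])
qed

definition field_inner :: "real measure \<Rightarrow> real measure \<Rightarrow> real" where
  "field_inner \<mu> \<nu> = (log_inner \<mu> \<nu> + log_inner (root_push \<mu>) (root_push \<nu>)) / 2 + (integral\<^sup>L \<mu> field + integral\<^sup>L \<nu> field) / 2"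

lemma cross_energy_field_inner:
  assumes "tame \<mu>" "tame \<nu>"
  shows "cross_energy \<mu> \<nu> = ennreal (field_inner \<mu> \<nu> + field_bound)" and "field_inner \<mu> \<nu> + field_bound \<ge> 0"
proof -
  note m = tameD[OF assms(1)] and n = tameD[OF assms(2)]
  note hm = half_probD[OF m(1)] and hn = half_probD[OF n(1)]
  let ?P = "\<mu> \<Otimes>\<^sub>M \<nu>"
  interpret mp: prob_space \<mu> by (rule hm(1))
  interpret np: prob_space \<nu> by (rule hn(1))
  interpret P: pair_prob_space \<mu> \<nu> ..
  note [measurable_cong] = m(7) n(7)
  have lc: "log_compatible \<mu> \<nu>" by (rule log_compatible_cross[OF m(2) n(2) m(3) n(3)])
  have i1: "integrable ?P (\<lambda>z. ln \<bar>fst z - snd z\<bar>)" and ae: "AE z in ?P. fst z \<noteq> snd z" using lc by (auto simp: log_compatible_def)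
  have i2: "integrable ?P (\<lambda>z. ln \<bar>root r (fst z) - root r (snd z)\<bar>)"
    using log_compatible_root_push[OF assms] log_root_push(1)[OF assms] by simp
  have i3: "integrable ?P (\<lambda>z. field (fst z))" by (rule integrable_fst_pair[OF m(2) n(2) m(4)])
  have i4: "integrable ?P (\<lambda>z. field (snd z))" by (rule integrable_snd_pair[OF m(2) n(2) n(4)])
  have f1: "(\<integral>z. field (fst z) \<partial>?P) = integral\<^sup>L \<mu> field"
    using P.integral_fst'[OF i3] by (simp add: np.prob_space)
  have f2: "(\<integral>z. field (snd z) \<partial>?P) = integral\<^sup>L \<nu> field"
    using P.integral_fst'[OF i4] by (simp add: mp.prob_space)
  have k: "integrable ?P (\<lambda>z. field_kernel (fst z) (snd z) + field_bound)"
    unfolding field_kernel_def using i1 i2 i3 i4 by simp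
  have kI: "(\<integral>z. field_kernel (fst z) (snd z) + field_bound \<partial>?P) = field_inner \<mu> \<nu> + field_bound"
    unfolding field_kernel_def field_inner_def log_root_push(2)[OF assms] log_inner_def[of \<mu> \<nu>] using i1 i2 i3 i4 f1 f2
    by (simp add: P.prob_space field_simps)
  have nn: "AE z in ?P. 0 \<le> field_kernel (fst z) (snd z) + field_bound"
    using AE_pair_nonneg[OF m(1) n(1)] ae by eventually_elim (use field_kernel_nonneg in auto)
  have "cross_energy \<mu> \<nu> = (\<integral>\<^sup>+z. ennreal (field_kernel (fst z) (snd z) + field_bound) \<partial>?P)"
    unfolding cross_energy_pair[OF m(1) n(1)]
    by (intro nn_integral_cong_AE, use ae in eventually_elim) (simp add: shifted_kernel_def)
  also have "\<dots> = ennreal (field_inner \<mu> \<nu> + field_bound)" using nn_integral_eq_integral[OF k nn] kI by simp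
  finally show "cross_energy \<mu> \<nu> = ennreal (field_inner \<mu> \<nu> + field_bound)" .
  show "field_inner \<mu> \<nu> + field_bound \<ge> 0" unfolding kI[symmetric] using nn by (rule integral_nonneg_AE)
qed

lemma tame_unit_uniform: "tame unit_uniform"
proof -
  note h = half_probD[OF half_prob_unit_uniform]
  interpret prob_space unit_uniform by (rule h(1))
  note [measurable_cong] = h(2)
  have "continuous_on {0..1} field" using continuous_field continuous_on_subset by blast
  hence "compact (field ` {0..1})" by (intro compact_continuous_image) auto
  then obtain B where B: "\<And>x. x \<in> {0..1} \<Longrightarrow> \<bar>field x\<bar> \<le> B" by (force dest: compact_imp_bounded simp: bounded_iff)
  have "integrable unit_uniform field"
  proof (rule integrable_const_bound[where B = B])
    show "AE x in unit_uniform. norm (field x) \<le> B"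
      using AE_unit_uniform by eventually_elim (use B in auto)
  qed measurable
  thus ?thesis using half_prob_unit_uniform log_compatible_unit_uniform by (simp add: tame_def)
qed

definition minimizer :: "real measure \<Rightarrow> bool" where
  "minimizer \<mu> \<longleftrightarrow> half_prob \<mu> \<and> (\<forall>\<nu>. half_prob \<nu> \<longrightarrow> energy \<mu> \<le> energy \<nu>)"

lemma minimizer_finite: "minimizer \<mu> \<Longrightarrow> energy \<mu> < \<infinity>"
proof -
  assume "minimizer \<mu>"
  hence "energy \<mu> \<le> energy unit_uniform" using half_prob_unit_uniform by (simp add: minimizer_def)
  also have "\<dots> < \<infinity>" using cross_energy_field_inner(1)[OF tame_unit_uniform tame_unit_uniform] energy_eq_cross_energy[OF half_prob_unit_uniform] by simp
  finally show ?thesis .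
qed

text \<open>Let \<open>e\<close> be the minimal energy and \<open>A = {0..R}\<close> a set of mass \<open>p\<close>, with \<open>R\<close> so large that the kernel is at
least \<open>e + 1\<close> off \<open>A \<times> A\<close>. The restriction of \<open>\<mu>\<close> to \<open>A\<close>, normalized, is a competitor, so the part of the
energy on \<open>A \<times> A\<close> is at least \<open>e * p\<^sup>2\<close>. Adding the other part gives \<open>e * p\<^sup>2 + (e + 1) * (1 - p\<^sup>2) \<le> e\<close>, which
forces \<open>p = 1\<close>.\<close>

lemma minimizer_bounded:
  assumes mu: "minimizer \<mu>"
  obtains R where "R \<ge> 0" "AE x in \<mu>. x \<in> {0..R}"
proof -
  have h: "half_prob \<mu>" using mu by (simp add: minimizer_def)
  note m = half_probD[OF h]
  interpret prob_space \<mu> by (rule m(1))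
  interpret PP: pair_prob_space \<mu> \<mu> ..
  note [measurable_cong] = m(2)
  obtain e where e: "e \<ge> 0" "energy \<mu> = ennreal e" using minimizer_finite[OF mu] by (cases "energy \<mu>") auto
  \<comment> \<open>The kernel is bounded below by the mean of the two excesses, so one coordinate beyond \<open>R\<close> gives \<open>e + 1\<close>.\<close>
  obtain R where R: "R \<ge> 0" "\<And>x. x > R \<Longrightarrow> excess x \<ge> 2 * (e + 1)" using excess_large by blast
  define A where "A = {0..R}"
  have [measurable]: "A \<in> sets borel" "A \<in> sets \<mu>" using m(2) by (auto simp: A_def)
  define p where "p = measure \<mu> A"
  have p: "0 \<le> p" "p \<le> 1" "emeasure \<mu> A = ennreal p" by (auto simp: p_def emeasure_eq_measure)
  let ?P = "\<mu> \<Otimes>\<^sub>M \<mu>"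
  define X where "X = (\<integral>\<^sup>+z. shifted_kernel (fst z) (snd z) * indicator (A \<times> A) z \<partial>?P)"
  have AA: "emeasure ?P (A \<times> A) = ennreal (p * p)"
    using p by (subst emeasure_pair_measure_Times) (auto simp: ennreal_mult)
  have comp: "emeasure ?P (space ?P - A \<times> A) = ennreal (1 - p * p)"
  proof -
    have "measure ?P (space ?P - A \<times> A) = 1 - measure ?P (A \<times> A)" by (rule PP.prob_compl) measurable
    thus ?thesis using AA p by (simp add: PP.emeasure_eq_measure)
  qed
  have "X + ennreal (e + 1) * ennreal (1 - p * p) = X + (\<integral>\<^sup>+z. ennreal (e + 1) * indicator (space ?P - A \<times> A) z \<partial>?P)"
    unfolding comp[symmetric] by (subst nn_integral_cmult_indicator) auto
  also have "\<dots> = (\<integral>\<^sup>+z. shifted_kernel (fst z) (snd z) * indicator (A \<times> A) z + ennreal (e + 1) * indicator (space ?P - A \<times> A) z \<partial>?P)"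
    unfolding X_def by (subst nn_integral_add) auto
  also have "\<dots> \<le> energy \<mu>"
    unfolding energy_def
  proof (intro nn_integral_mono_AE, use AE_pair_nonneg[OF h h] in eventually_elim)
    case (elim z)
    show ?case
    proof (cases "z \<in> A \<times> A")
      case False
      hence "fst z > R \<or> snd z > R" using elim by (cases z) (auto simp: A_def)
      hence "e + 1 \<le> (excess (fst z) + excess (snd z)) / 2"
        using R(2)[of "fst z"] R(2)[of "snd z"] excess_nonneg[of "fst z"] excess_nonneg[of "snd z"] elim by auto
      hence "ennreal (e + 1) \<le> ennreal ((excess (fst z) + excess (snd z)) / 2)" by (rule ennreal_leI)
      also have "\<dots> \<le> shifted_kernel (fst z) (snd z)" using elim by (intro shifted_kernel_ge) auto
      finally show ?thesis using False by (auto simp: indicator_def)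
    qed auto
  qed
  finally have le: "X + ennreal (e + 1) * ennreal (1 - p * p) \<le> ennreal e" unfolding e(2) .
  hence "X < \<infinity>" by (metis add_increasing2 ennreal_less_top infinity_ennreal_def le_less_trans zero_le order_refl add.commute add_left_mono le_add_same_cancel1)
  then obtain x where x: "x \<ge> 0" "X = ennreal x" by (cases X) auto
  have pp: "p * p \<le> 1" using p by (simp add: mult_le_one)
  have "ennreal (x + (e + 1) * (1 - p * p)) \<le> ennreal e"
    using le x e pp by (simp add: ennreal_mult ennreal_plus)
  hence le': "x + (e + 1) * (1 - p * p) \<le> e" using e by simp
  have "e * (p * p) \<le> x"
  proof (cases "p = 0")
    case False
    let ?N = "uniform_measure \<mu> A"
    have pN: "prob_space ?N" using p False by (intro prob_space_uniform_measure) auto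
    have "AE x in ?N. 0 \<le> x"
      by (rule AE_uniform_measureI) (simp_all add: A_def m(2))
    moreover have "sets ?N = sets borel" by (simp add: m(2))
    ultimately have hN: "half_prob ?N" using pN unfolding half_prob_def by blast
    have nnN: "(\<integral>\<^sup>+x. f x \<partial>?N) = (\<integral>\<^sup>+x. f x * indicator A x \<partial>\<mu>) / ennreal p" if "f \<in> borel_measurable borel" for f
      using that p by (subst nn_integral_uniform_measure) auto
    note [measurable] = inner_measurable[OF hN]
    have "ennreal e \<le> energy ?N" using mu hN e by (auto simp: minimizer_def)
    also have "energy ?N = (\<integral>\<^sup>+x. (\<integral>\<^sup>+y. shifted_kernel x y * indicator A y \<partial>\<mu>) / ennreal p * indicator A x \<partial>\<mu>) / ennreal p"
      unfolding energy_eq_cross_energy[OF hN] cross_energy_def by (subst nnN) (auto simp: nnN)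
    also have "\<dots> = (\<integral>\<^sup>+x. (\<integral>\<^sup>+y. shifted_kernel x y * indicator A y * indicator A x \<partial>\<mu>) / ennreal p \<partial>\<mu>) / ennreal p"
      by (intro arg_cong2[where f = "(/)"] nn_integral_cong refl) (auto simp: indicator_def)
    also have "\<dots> = (\<integral>\<^sup>+x. (\<integral>\<^sup>+y. shifted_kernel x y * indicator A y * indicator A x \<partial>\<mu>) \<partial>\<mu>) / ennreal p / ennreal p"
    proof -
      have "(\<lambda>x. \<integral>\<^sup>+y. shifted_kernel x y * indicator A y * indicator A x \<partial>\<mu>) \<in> borel_measurable \<mu>"
        unfolding shifted_kernel_def field_kernel_def by measurable
      thus ?thesis by (simp add: nn_integral_divide)
    qed
    also have "(\<integral>\<^sup>+x. (\<integral>\<^sup>+y. shifted_kernel x y * indicator A y * indicator A x \<partial>\<mu>) \<partial>\<mu>) = X"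
      unfolding X_def by (subst nn_integral_fst[symmetric]) (auto simp: indicator_times mult_ac)
    also have "X / ennreal p / ennreal p = ennreal (x / p / p)" using x p False by (simp add: divide_ennreal)
    finally have "e \<le> x / p / p" using x p by (simp add: ennreal_le_iff)
    thus ?thesis using p False by (simp add: field_simps)
  qed (use x in simp)
  hence "e * (p * p) + (e + 1) * (1 - p * p) \<le> e" using le' by linarith
  hence "1 \<le> p * p" by (simp add: algebra_simps)
  hence "p = 1" using p mult_le_one[of p p] by (metis dual_order.antisym mult_cancel_left1 mult_left_le order_trans)
  hence "AE x in \<mu>. x \<in> A" using prob_eq_1[of A] by (simp add: p_def)
  thus ?thesis using that[of R] R by (simp add: A_def)
qed

text \<open>On a bounded set the field is bounded and both logarithms are bounded above. So if the combined kernel is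
integrable, no cancellation between its terms is possible.\<close>

lemma minimizer_tame:
  assumes mu: "minimizer \<mu>"
  shows "tame \<mu>"
proof -
  have h: "half_prob \<mu>" using mu by (simp add: minimizer_def)
  note m = half_probD[OF h]
  interpret prob_space \<mu> by (rule m(1))
  interpret PP: pair_prob_space \<mu> \<mu> ..
  note [measurable_cong] = m(2)
  let ?P = "\<mu> \<Otimes>\<^sub>M \<mu>"
  obtain R where R: "R \<ge> 0" "AE x in \<mu>. x \<in> {0..R}" using minimizer_bounded[OF mu] by blast
  have "continuous_on {0..R} field" using continuous_field continuous_on_subset by blast
  hence "compact (field ` {0..R})" by (intro compact_continuous_image) auto
  then obtain B where B: "\<And>x. x \<in> {0..R} \<Longrightarrow> \<bar>field x\<bar> \<le> B" by (force dest: compact_imp_bounded simp: bounded_iff)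
  have fi: "integrable \<mu> field"
  proof (rule integrable_const_bound[where B = B])
    show "AE x in \<mu>. norm (field x) \<le> B"
      using R(2) by eventually_elim (use B in auto)
  qed measurable
  have "AE z in ?P. shifted_kernel (fst z) (snd z) \<noteq> \<infinity>"
    using minimizer_finite[OF mu] unfolding energy_def by (intro nn_integral_PInf_AE shifted_kernel_measurable_pair h) auto
  hence ae: "AE z in ?P. fst z \<noteq> snd z" by eventually_elim (auto simp: shifted_kernel_def split: if_splits)
  have box: "AE z in ?P. fst z \<in> {0..R} \<and> snd z \<in> {0..R}"
  proof (rule PP.AE_pair_measure)
    show "AE x in \<mu>. AE y in \<mu>. fst (x, y) \<in> {0..R} \<and> snd (x, y) \<in> {0..R}"
      using R(2)
    proof eventually_elim
      case (elim x)
      show ?case using R(2) by eventually_elim (use elim in simp)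
    qed
  qed measurable
  have ki: "integrable ?P (\<lambda>z. field_kernel (fst z) (snd z) + field_bound)"
  proof (rule integrableI_bounded)
    have "(\<integral>\<^sup>+z. ennreal (norm (field_kernel (fst z) (snd z) + field_bound)) \<partial>?P) = energy \<mu>"
      unfolding energy_def
    proof (intro nn_integral_cong_AE, use ae box in eventually_elim)
      case (elim z)
      thus ?case using field_kernel_nonneg[of "fst z" "snd z"] by (simp add: shifted_kernel_def)
    qed
    thus "(\<integral>\<^sup>+z. ennreal (norm (field_kernel (fst z) (snd z) + field_bound)) \<partial>?P) < \<infinity>" using minimizer_finite[OF mu] by simp
  qed measurable
  \<comment> \<open>Upper bounds of the two logarithms and of the field; twice the kernel plus \<open>?C\<close> dominates \<open>ln \<bar>x - y\<bar>\<close> from both sides.\<close>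
  let ?C = "ln (1 + R) + ln (1 + root r R) + 2 * B"
  have "integrable ?P (\<lambda>z. ln \<bar>fst z - snd z\<bar>)"
  proof (rule Bochner_Integration.integrable_bound)
    show "integrable ?P (\<lambda>z. 2 * (field_kernel (fst z) (snd z) + field_bound) + ?C)"
      by (rule Bochner_Integration.integrable_add[OF integrable_mult_right[OF ki] PP.integrable_const])
    show "AE z in ?P. norm (ln \<bar>fst z - snd z\<bar>) \<le> norm (2 * (field_kernel (fst z) (snd z) + field_bound) + ?C)"
      using ae box
    proof eventually_elim
      case (elim z)
      let ?x = "fst z" and ?y = "snd z"
      have xy: "0 \<le> ?x" "?x \<le> R" "0 \<le> ?y" "?y \<le> R" "?x \<noteq> ?y" using elim by auto
      have k: "0 \<le> field_kernel ?x ?y + field_bound" using field_kernel_nonneg xy by simp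
      have l1: "ln \<bar>?x - ?y\<bar> \<le> ln (1 + R)" using xy by (subst ln_le_cancel_iff) auto
      have rr: "0 \<le> root r ?x" "root r ?x \<le> root r R" "0 \<le> root r ?y" "root r ?y \<le> root r R" "root r ?x \<noteq> root r ?y"
        using xy r by auto
      have l2: "ln \<bar>root r ?x - root r ?y\<bar> \<le> ln (1 + root r R)" using rr by (subst ln_le_cancel_iff) auto
      have l0: "0 \<le> ln (1 + R)" "0 \<le> ln (1 + root r R)" using R r by (auto simp: ln_ge_zero)
      have b: "\<bar>field ?x\<bar> \<le> B" "\<bar>field ?y\<bar> \<le> B" using B xy by auto
      have "- ln \<bar>?x - ?y\<bar> = 2 * field_kernel ?x ?y + ln \<bar>root r ?x - root r ?y\<bar> - field ?x - field ?y"
        by (simp add: field_kernel_def field_simps)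
      also have "\<dots> \<le> 2 * (field_kernel ?x ?y + field_bound) + ln (1 + root r R) + 2 * B"
        using l2 b[THEN abs_le_D2] field_bound(1) by simp
      finally have "- ln \<bar>?x - ?y\<bar> \<le> 2 * (field_kernel ?x ?y + field_bound) + ?C" using l0 by simp
      moreover have "ln \<bar>?x - ?y\<bar> \<le> 2 * (field_kernel ?x ?y + field_bound) + ?C"
        using l1 l0 k b[THEN abs_ge_zero[THEN order_trans]] by simp
      ultimately have "\<bar>ln \<bar>?x - ?y\<bar>\<bar> \<le> 2 * (field_kernel ?x ?y + field_bound) + ?C" by (intro abs_leI)
      thus ?case by simp
    qed
  qed measurable
  with ae have "log_compatible \<mu> \<mu>" by (simp add: log_compatible_def)
  thus ?thesis using h fi by (simp add: tame_def)
qed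

text \<open>The case of a single component of \<open>nikishin_form_pos_def\<close>.\<close>

lemma log_inner_pos_def:
  assumes fin: "finite_borel \<mu>" "finite_borel \<nu>" and mass: "measure \<mu> UNIV = measure \<nu> UNIV"
    and lc: "log_compatible \<mu> \<mu>" "log_compatible \<nu> \<nu>"
  shows "2 * log_inner \<mu> \<nu> \<le> log_inner \<mu> \<mu> + log_inner \<nu> \<nu>"
    and "2 * log_inner \<mu> \<nu> = log_inner \<mu> \<mu> + log_inner \<nu> \<nu> \<Longrightarrow> \<mu> = \<nu>"
proof -
  note c = log_compatible_cross[OF fin lc] log_compatible_cross[OF fin(2,1) lc(2,1)]
  have Q: "(\<Sum>j<(1::nat). diff_inner \<mu> \<nu> \<mu> \<nu>) - (\<Sum>j<(1::nat) - 1. diff_inner \<mu> \<nu> \<mu> \<nu>)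
      = log_inner \<mu> \<mu> + log_inner \<nu> \<nu> - 2 * log_inner \<mu> \<nu>"
    by (simp add: diff_inner_def log_inner_commute[OF fin(2,1)])
  note pd = nikishin_form_pos_def[of 1 "\<lambda>_. \<mu>" "\<lambda>_. \<nu>", OF order_refl fin mass lc(1) c lc(2), unfolded Q]
  show "2 * log_inner \<mu> \<nu> \<le> log_inner \<mu> \<mu> + log_inner \<nu> \<nu>" using pd(1) by simp
  show "2 * log_inner \<mu> \<nu> = log_inner \<mu> \<mu> + log_inner \<nu> \<nu> \<Longrightarrow> \<mu> = \<nu>" using pd(2)[of 0] by simp
qed

text \<open>Strict convexity: the energy of the mixture of two different minimizers would be smaller than the minimum,
by a quarter of the quadratic form at their difference.\<close>

proposition minimizer_unique:
  assumes "minimizer \<mu>" "minimizer \<nu>"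
  shows "\<mu> = \<nu>"
proof -
  have hm: "half_prob \<mu>" and hn: "half_prob \<nu>" using assms by (auto simp: minimizer_def)
  note t = minimizer_tame[OF assms(1)] minimizer_tame[OF assms(2)]
  note m = tameD[OF t(1)] and n = tameD[OF t(2)]
  have mass: "measure \<mu> UNIV = measure \<nu> UNIV" using half_probD(5)[OF hm] half_probD(5)[OF hn] by simp
  have massr: "measure (root_push \<mu>) UNIV = measure (root_push \<nu>) UNIV"
  proof -
    note [measurable_cong] = m(7) n(7)
    show ?thesis using mass half_probD(6)[OF hm] half_probD(6)[OF hn] by (simp add: root_push_def measure_distr)
  qed
  note pd = log_inner_pos_def[OF m(2) n(2) mass m(3) n(3)]
  note pdr = log_inner_pos_def[OF finite_borel_root_push[OF t(1)] finite_borel_root_push[OF t(2)] massr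
     log_compatible_root_push[OF t(1) t(1)] log_compatible_root_push[OF t(2) t(2)]]
  let ?b = field_bound
  define i where "i = field_inner \<mu> \<mu>"
  have c: "cross_energy \<mu> \<mu> = ennreal (field_inner \<mu> \<mu> + ?b)" "cross_energy \<mu> \<nu> = ennreal (field_inner \<mu> \<nu> + ?b)"
     "cross_energy \<nu> \<mu> = ennreal (field_inner \<nu> \<mu> + ?b)" "cross_energy \<nu> \<nu> = ennreal (field_inner \<nu> \<nu> + ?b)"
    using cross_energy_field_inner(1) t by auto
  have c0: "field_inner \<mu> \<mu> + ?b \<ge> 0" "field_inner \<mu> \<nu> + ?b \<ge> 0" "field_inner \<nu> \<mu> + ?b \<ge> 0" "field_inner \<nu> \<nu> + ?b \<ge> 0"
    using cross_energy_field_inner(2) t by auto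
  have eq: "field_inner \<nu> \<nu> = i"
  proof -
    have "energy \<mu> = energy \<nu>" using assms by (auto simp: minimizer_def intro: antisym)
    thus ?thesis using c c0 energy_eq_cross_energy[OF hm] energy_eq_cross_energy[OF hn] by (simp add: i_def)
  qed
  have comm: "field_inner \<nu> \<mu> = field_inner \<mu> \<nu>"
    using log_inner_commute[OF m(2) n(2)] log_inner_commute[OF finite_borel_root_push[OF t(1)] finite_borel_root_push[OF t(2)]]
    by (simp add: field_inner_def add.commute)
  have "energy \<mu> \<le> energy (mixture \<mu> \<nu>)" using assms(1) half_prob_mixture[OF hm hn] by (simp add: minimizer_def)
  hence "ennreal (i + ?b) \<le> ennreal (1/4 * ((i + ?b) + (field_inner \<mu> \<nu> + ?b) + (field_inner \<mu> \<nu> + ?b) + (i + ?b)))"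
    unfolding energy_mixture[OF hm hn] energy_eq_cross_energy[OF hm] c comm eq using c0 eq
    by (simp add: i_def[symmetric] ennreal_plus[symmetric] ennreal_mult[symmetric] del: ennreal_plus)
  hence "i + ?b \<le> 1/4 * ((i + ?b) + (field_inner \<mu> \<nu> + ?b) + (field_inner \<mu> \<nu> + ?b) + (i + ?b))"
    using c0 eq by (subst (asm) ennreal_le_iff) (auto simp: i_def)
  hence ge: "i \<le> field_inner \<mu> \<nu>" by simp
  have "field_inner \<mu> \<mu> + field_inner \<nu> \<nu> - 2 * field_inner \<mu> \<nu> =
     ((log_inner \<mu> \<mu> + log_inner \<nu> \<nu> - 2 * log_inner \<mu> \<nu>) +
      (log_inner (root_push \<mu>) (root_push \<mu>) + log_inner (root_push \<nu>) (root_push \<nu>) - 2 * log_inner (root_push \<mu>) (root_push \<nu>))) / 2"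
    by (simp add: field_inner_def field_simps)
  hence "log_inner \<mu> \<mu> + log_inner \<nu> \<nu> - 2 * log_inner \<mu> \<nu> \<le> 0"
    using ge eq pdr(1) by (simp add: i_def)
  hence "2 * log_inner \<mu> \<nu> = log_inner \<mu> \<mu> + log_inner \<nu> \<nu>" using pd(1) by simp
  thus ?thesis by (rule pd(2))
qed

end

section \<open>The vector problem\<close>

lemma closed_Delta: "closed (Delta j)"
  by (simp add: Delta_def)

text \<open>A measure of finite energy has no atom at the origin, so it is carried by the open half-line.\<close>

lemma admissible_component:
  assumes adm: "admissible_vector r m" and j: "j < r"
  shows "finite_borel (m j)" "log_compatible (m j) (m j)" "on_side j (m j)" "measure (m j) UNIV = 1 - real j / real r"
proof -
  have c: "1 - real j / real r \<ge> 0" using j by (simp add: field_simps)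
  have s: "sets (m j) = sets borel" and sup: "measure_support (m j) \<subseteq> Delta (int j)"
    and e: "emeasure (m j) (Delta (int j)) = ennreal (1 - real j / real r)" and fe: "finite_log_energy (m j)"
    using adm j by (auto simp: admissible_vector_def)
  have sp: "space (m j) = UNIV" using sets_eq_imp_space_eq[OF s] by simp
  have ae: "AE x in m j. x \<in> Delta (int j)" using measure_support_subset_iff[OF s closed_Delta] sup by blast
  have "emeasure (m j) UNIV = emeasure (m j) (Delta (int j))"
    using ae s closed_Delta[of "int j"] by (intro emeasure_eq_AE) auto
  hence u: "emeasure (m j) UNIV = ennreal (1 - real j / real r)" using e by simp
  show fin: "finite_borel (m j)" using s sp u by (auto simp: finite_borel_def intro!: finite_measureI)
  show "measure (m j) UNIV = 1 - real j / real r" using u c by (simp add: measure_def)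
  show lc: "log_compatible (m j) (m j)" using fe finite_log_energy_iff[OF fin] by simp
  have "{0} \<in> null_sets (m j)" using no_atoms[OF fin lc, of 0] s by (auto simp: null_sets_def)
  hence "AE x in m j. x \<noteq> 0" by (rule AE_I') auto
  with ae show "on_side j (m j)" unfolding on_side_def
    by eventually_elim (auto simp: Delta_def split: if_splits)
qed

lemma admissible_vectorI:
  assumes ext: "m \<in> extensional {..<r}"
    and comp: "\<And>j. j < r \<Longrightarrow> finite_borel (m j)" "\<And>j. j < r \<Longrightarrow> log_compatible (m j) (m j)"
      "\<And>j. j < r \<Longrightarrow> on_side j (m j)" "\<And>j. j < r \<Longrightarrow> measure (m j) UNIV = 1 - real j / real r"
  shows "admissible_vector r m"
  unfolding admissible_vector_def
proof (intro conjI allI impI ext)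
  fix j assume j: "j < r"
  note fin = comp(1)[OF j]
  show s: "sets (m j) = sets borel" by (rule finite_borelD(2)[OF fin])
  interpret finite_measure "m j" by (rule finite_borelD(1)[OF fin])
  have ae: "AE x in m j. x \<in> Delta (int j)"
    using comp(3)[OF j] unfolding on_side_def
    by eventually_elim (auto simp: Delta_def split: if_splits)
  thus "measure_support (m j) \<subseteq> Delta (int j)" using measure_support_subset_iff[OF s closed_Delta] by blast
  have "emeasure (m j) (Delta (int j)) = emeasure (m j) UNIV"
    using ae s closed_Delta[of "int j"] by (intro emeasure_eq_AE) auto
  thus "emeasure (m j) (Delta (int j)) = ennreal (1 - real j / real r)"
    using comp(4)[OF j] by (simp add: emeasure_eq_measure)
  show "finite_log_energy (m j)" using finite_log_energy_iff[OF fin] comp(2)[OF j] by simp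
qed

context external_field
begin

lemma energy_tame: "tame \<mu> \<Longrightarrow> energy \<mu> = ennreal (field_inner \<mu> \<mu> + field_bound)"
  using energy_eq_cross_energy[OF tameD(1)] cross_energy_field_inner(1) by simp

lemma field_inner_self:
  assumes "tame \<mu>"
  shows "field_inner \<mu> \<mu> = (log_inner \<mu> \<mu> + lifted_measure.root_inner r \<mu>) / 2 + integral\<^sup>L \<mu> field"
  unfolding field_inner_def log_root_push(2)[OF assms assms] lifted_measure.root_inner_def[OF tameD(6)[OF assms]]
  by simp

text \<open>The negative part of the field is bounded, so the only alternative to integrability is the value infinity.\<close>

lemma field_integral:
  assumes h: "half_prob \<mu>"
  shows "ereal_integral \<mu> (\<lambda>x. ereal (V x)) = (if integrable \<mu> field then ereal (integral\<^sup>L \<mu> field) else \<infinity>)"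
proof -
  note m = half_probD[OF h]
  interpret prob_space \<mu> by (rule m(1))
  note [measurable_cong] = m(2)
  have ae: "AE x in \<mu>. ereal (V x) = ereal (field x)" using m(3) by eventually_elim (simp add: field_eq)
  show ?thesis
  proof (cases "integrable \<mu> field")
    case True
    thus ?thesis using ereal_integral_real[OF True ae] by simp
  next
    case False
    have e: "(\<integral>\<^sup>+x. e2ennreal (ereal (V x)) \<partial>\<mu>) = (\<integral>\<^sup>+x. ennreal (field x) \<partial>\<mu>)"
      "(\<integral>\<^sup>+x. e2ennreal (- ereal (V x)) \<partial>\<mu>) = (\<integral>\<^sup>+x. ennreal (- field x) \<partial>\<mu>)"
      by (intro nn_integral_cong_AE; use ae in \<open>eventually_elim, simp\<close>)+
    have "(\<integral>\<^sup>+x. ennreal (- field x) \<partial>\<mu>) \<le> (\<integral>\<^sup>+x. ennreal field_bound \<partial>\<mu>)"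
    proof (intro nn_integral_mono_AE, use m(3) in eventually_elim)
      case (elim x)
      have "ln (1 + x\<^sup>2) \<ge> 0" by (intro ln_ge_zero) simp
      hence "- field x \<le> field_bound" using field_bound(2)[OF elim] field_eq[OF elim] by linarith
      thus ?case by (rule ennreal_leI)
    qed
    hence neg: "(\<integral>\<^sup>+x. ennreal (- field x) \<partial>\<mu>) < \<infinity>" by (auto simp: emeasure_space_1 intro: le_less_trans)
    hence "(\<integral>\<^sup>+x. ennreal (field x) \<partial>\<mu>) = \<infinity>" using False unfolding real_integrable_def by auto
    moreover obtain b where "(\<integral>\<^sup>+x. ennreal (- field x) \<partial>\<mu>) = ennreal b" "b \<ge> 0"
      using neg by (cases "\<integral>\<^sup>+x. ennreal (- field x) \<partial>\<mu>") auto
    ultimately show ?thesis unfolding ereal_integral_def e using False by (simp add: top_ennreal.rep_eq)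
  qed
qed

lemma admissible_half_prob:
  assumes "admissible_vector r m"
  shows "half_prob (m 0)"
proof -
  have r0: "0 < r" using r by simp
  note c = admissible_component[OF assms r0]
  interpret finite_measure "m 0" by (rule finite_borelD(1)[OF c(1)])
  have "prob_space (m 0)"
    using c(4) finite_borelD(3)[OF c(1)] by (intro prob_spaceI) (simp add: emeasure_eq_measure)
  moreover have "AE x in m 0. 0 \<le> x" using c(3) unfolding on_side_def by eventually_elim simp
  ultimately show ?thesis using finite_borelD(2)[OF c(1)] by (simp add: half_prob_def)
qed

text \<open>All logarithmic terms are finite, the mutual ones by \<open>log_compatible_cross\<close>; only the field can make the
energy infinite.\<close>

lemma vector_energy_eq:
  assumes adm: "admissible_vector r m"
  shows "vector_energy r V m =
    (if integrable (m 0) field then ereal (vector_log_energy r m + integral\<^sup>L (m 0) field) else \<infinity>)"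
proof -
  note c = admissible_component[OF adm]
  have 1: "(\<Sum>j<r. log_energy (m j)) = ereal (\<Sum>j<r. log_inner (m j) (m j))"
    unfolding log_energy_def sum_ereal[symmetric] using c(2) by (intro sum.cong refl mutual_energy_log_inner) auto
  have 2: "(\<Sum>j<r - 1. mutual_energy (m j) (m (j + 1))) = ereal (\<Sum>j<r - 1. log_inner (m j) (m (j + 1)))"
    unfolding sum_ereal[symmetric]
  proof (intro sum.cong refl mutual_energy_log_inner)
    fix j assume "j \<in> {..<r - 1}"
    hence j: "j < r" "j + 1 < r" by auto
    show "log_compatible (m j) (m (j + 1))"
      by (rule log_compatible_cross[OF c(1)[OF j(1)] c(1)[OF j(2)] c(2)[OF j(1)] c(2)[OF j(2)]])
  qed
  show ?thesis unfolding vector_energy_def 1 2 field_integral[OF admissible_half_prob[OF adm]] vector_log_energy_def by simp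
qed

text \<open>The reduction of the vector problem to its first component.\<close>

lemma vector_log_energy_ge_scalar:
  assumes adm: "admissible_vector r m" and i: "integrable (m 0) field"
  shows "tame (m 0)" and "field_inner (m 0) (m 0) \<le> vector_log_energy r m + integral\<^sup>L (m 0) field"
    and "vector_log_energy r m + integral\<^sup>L (m 0) field = field_inner (m 0) (m 0) \<Longrightarrow> j < r \<Longrightarrow> m j = lift r (m 0) j"
proof -
  have r0: "0 < r" using r by simp
  note c = admissible_component[OF adm]
  show t: "tame (m 0)" using admissible_half_prob[OF adm] c(2)[OF r0] i by (simp add: tame_def)
  interpret lifted_measure r "m 0" by (rule tameD(6)[OF t])
  have mass: "measure (m j) UNIV = (1 - real j / real r) * measure (m 0) UNIV" if "j < r" for j
    using c(4)[OF that] c(4)[OF r0] by simp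
  note ge = vector_log_energy_ge[of m, OF c(1) c(2) c(3) refl mass]
  show "field_inner (m 0) (m 0) \<le> vector_log_energy r m + integral\<^sup>L (m 0) field"
    unfolding field_inner_self[OF t] using ge(1) by simp
  assume "vector_log_energy r m + integral\<^sup>L (m 0) field = field_inner (m 0) (m 0)" and j: "j < r"
  hence e: "vector_log_energy r m = (log_inner (m 0) (m 0) + root_inner) / 2"
    unfolding field_inner_self[OF t] by linarith
  show "m j = lift r (m 0) j" by (rule ge(2)) (use e j in blast)+
qed

lemma lift_admissible:
  assumes t: "tame \<mu>"
  defines "L \<equiv> restrict (lift r \<mu>) {..<r}"
  shows "admissible_vector r L" and "L 0 = \<mu>" and "vector_energy r V L = ereal (field_inner \<mu> \<mu>)"
proof -
  interpret lifted_measure r \<mu> by (rule tameD(6)[OF t])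
  have r0: "0 < r" using r by simp
  have Lj: "L j = lift r \<mu> j" if "j < r" for j using that by (simp add: L_def)
  show L0: "L 0 = \<mu>" using Lj[OF r0] by (simp add: lift_def)
  show adm: "admissible_vector r L"
  proof (rule admissible_vectorI)
    show "L \<in> extensional {..<r}" by (simp add: L_def)
    show "measure (L j) UNIV = 1 - real j / real r" if "j < r" for j
      using measure_lift[OF that] half_probD(5)[OF tameD(1)[OF t]] Lj[OF that] by simp
  qed (use Lj finite_borel_lift log_compatible_lift on_side_lift in auto)
  have "vector_log_energy r L = vector_log_energy r (lift r \<mu>)"
    unfolding vector_log_energy_def using Lj by (intro arg_cong2[where f = minus] sum.cong) auto
  thus "vector_energy r V L = ereal (field_inner \<mu> \<mu>)"
    unfolding vector_energy_eq[OF adm] L0 field_inner_self[OF t] using vector_log_energy_lift tameD(4)[OF t] by simp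
qed

lemma minimizer_iff: "is_arg_min (scalar_energy r V) half_line_prob \<mu> \<longleftrightarrow> minimizer \<mu>"
  unfolding is_arg_min_scalar_iff minimizer_def ..

lemma minimizer_field_inner_le:
  assumes "minimizer \<mu>" "tame \<nu>"
  shows "field_inner \<mu> \<mu> \<le> field_inner \<nu> \<nu>" and "field_inner \<nu> \<nu> \<le> field_inner \<mu> \<mu> \<Longrightarrow> minimizer \<nu>"
proof -
  note t = minimizer_tame[OF assms(1)]
  note h = tameD(1)[OF assms(2)]
  note e = energy_tame[OF t] energy_tame[OF assms(2)]
  note p = cross_energy_field_inner(2)[OF t t] cross_energy_field_inner(2)[OF assms(2) assms(2)]
  have "energy \<mu> \<le> energy \<nu>" using assms(1) h by (simp add: minimizer_def)
  thus "field_inner \<mu> \<mu> \<le> field_inner \<nu> \<nu>" unfolding e using p by simp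
  assume "field_inner \<nu> \<nu> \<le> field_inner \<mu> \<mu>"
  hence "energy \<nu> \<le> energy \<mu>" unfolding e by (intro ennreal_leI) simp
  thus "minimizer \<nu>" using assms(1) h by (auto simp: minimizer_def intro: order_trans)
qed

text \<open>The vector energy of \<open>m\<close> is bounded below by the scalar energy of \<open>m 0\<close>, and this by the scalar minimum,
which the lift of \<open>\<mu>\<close> attains. Equality in the second estimate forces \<open>m 0 = \<mu>\<close> by uniqueness, and then
equality in the first forces \<open>m\<close> to be the lift.\<close>

proposition vector_minimizer_iff:
  assumes mu: "minimizer \<mu>"
  shows "is_arg_min (vector_energy r V) (admissible_vector r) m \<longleftrightarrow> m = restrict (lift r \<mu>) {..<r}"
proof -
  let ?L = "restrict (lift r \<mu>) {..<r}"
  note t = minimizer_tame[OF mu]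
  note L = lift_admissible[OF t]
  have bound: "vector_energy r V ?L \<le> vector_energy r V m" if adm: "admissible_vector r m" for m
  proof (cases "integrable (m 0) field")
    case True
    have "field_inner \<mu> \<mu> \<le> vector_log_energy r m + integral\<^sup>L (m 0) field"
      using vector_log_energy_ge_scalar(2)[OF adm True] minimizer_field_inner_le(1)[OF mu vector_log_energy_ge_scalar(1)[OF adm True]] by linarith
    thus ?thesis unfolding L(3) vector_energy_eq[OF adm] using True by simp
  qed (simp add: vector_energy_eq[OF adm])
  have eq: "m = ?L" if adm: "admissible_vector r m" and le: "vector_energy r V m \<le> vector_energy r V ?L" for m
  proof -
    have i: "integrable (m 0) field"
      using le unfolding L(3) vector_energy_eq[OF adm] by (auto split: if_splits)
    note ge = vector_log_energy_ge_scalar[OF adm i]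
    have "vector_log_energy r m + integral\<^sup>L (m 0) field \<le> field_inner \<mu> \<mu>"
      using le i unfolding L(3) vector_energy_eq[OF adm] by simp
    moreover have "field_inner \<mu> \<mu> \<le> field_inner (m 0) (m 0)" by (rule minimizer_field_inner_le(1)[OF mu ge(1)])
    ultimately have e: "vector_log_energy r m + integral\<^sup>L (m 0) field = field_inner (m 0) (m 0)" "field_inner (m 0) (m 0) \<le> field_inner \<mu> \<mu>"
      using ge(2) by linarith+
    have m0: "m 0 = \<mu>" by (rule minimizer_unique[OF minimizer_field_inner_le(2)[OF mu ge(1) e(2)] mu])
    show "m = ?L"
    proof (rule extensionalityI)
      show "m \<in> extensional {..<r}" using adm by (simp add: admissible_vector_def)
      show "m j = ?L j" if "j \<in> {..<r}" for j using ge(3)[OF e(1), of j] that m0 by simp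
    qed simp
  qed
  show ?thesis unfolding is_arg_min_linorder using bound eq L(1) by blast
qed

lemma compact_minimizer_support:
  assumes "minimizer \<mu>"
  shows "compact (measure_support \<mu>)"
proof -
  obtain R where R: "AE x in \<mu>. x \<in> {0..R}" using minimizer_bounded[OF assms] by blast
  have "sets \<mu> = sets borel" using assms half_probD(2) by (auto simp: minimizer_def)
  hence "measure_support \<mu> \<subseteq> {0..R}" using measure_support_subset_iff[of \<mu> "{0..R}"] R by simp
  thus ?thesis using closed_measure_support bounded_subset[OF bounded_closed_interval] by (auto simp: compact_eq_bounded_closed)
qed

end

theorem theorem1p1:
  fixes r :: nat and V :: "real \<Rightarrow> real"
  assumes "r \<ge> 1"
    and "continuous_on {0..} V"
    and "filterlim (\<lambda>x. V x - ln (1 + x\<^sup>2)) at_top at_top"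
  shows "(\<exists>!\<mu>. is_arg_min (vector_energy r V) (admissible_vector r) \<mu>) \<and>
    (\<forall>\<mu>. is_arg_min (vector_energy r V) (admissible_vector r) \<mu> \<longrightarrow>
       compact (measure_support (\<mu> 0)) \<and>
       is_arg_min (scalar_energy r V) half_line_prob (\<mu> 0) \<and>
       (\<forall>\<nu>. is_arg_min (scalar_energy r V) half_line_prob \<nu> \<longrightarrow> \<nu> = \<mu> 0))"
proof -
  interpret external_field r V using assms by unfold_locales
  obtain \<mu> where \<mu>: "minimizer \<mu>" using energy_attained by (auto simp: minimizer_def)
  note iff = vector_minimizer_iff[OF \<mu>]
  have zero: "restrict (lift r \<mu>) {..<r} 0 = \<mu>" by (rule lift_admissible(2)[OF minimizer_tame[OF \<mu>]])
  show ?thesis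
    unfolding iff minimizer_iff
  proof (intro conjI allI impI ex1I)
    fix m assume "m = restrict (lift r \<mu>) {..<r}"
    hence m0: "m 0 = \<mu>" using zero by (rule trans[OF fun_cong])
    show "compact (measure_support (m 0))" "minimizer (m 0)"
      unfolding m0 by (fact compact_minimizer_support[OF \<mu>] \<mu>)+
    fix \<nu> assume "minimizer \<nu>"
    thus "\<nu> = m 0" unfolding m0 by (rule minimizer_unique[OF _ \<mu>])
  qed (rule refl)
qed

end
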